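(* Let $V\subseteq L^2(\mathcal{X})$ be a closed subspace, and let $Z_\sigma: L^2(\mathcal{X})\to L^2(\widehat{\Gamma},L^2(C))$ be the generalized Zak transform. The following conditions are equivalent: (1) $V$ is a $(\Gamma,\sigma)$-invariant space; (2) there exists a measurable range function $J:\widehat{\Gamma}\to\{\text{closed subspaces of }L^2(C)\}$ such that $$V=\{f\in L^2(\mathcal{X}) : Z_\sigma[f](\alpha)\in J(\alpha)\ \text{for a.e. } \alpha\in\widehat{\Gamma}\}.$$ Identifying range functions which are equal almost everywhere, the correspondence between $(\Gamma,\sigma)$-invariant spaces and measurable range functions given by (2) is one-to-one and onto. Moreover, if $V=S_\sigma^\Gamma(\mathcal{A})$ for some (finite or) countable subset $\mathcal{A}$ of $L^2(\mathcal{X})$, then the measurable range function $J$ associated to $V$ is given by $$J(\alpha)=\overline{\mathrm{span}}\{Z_\sigma[\phi](\alpha) : \phi\in\mathcal{A}\}\quad\text{for a.e. }\alpha\in\widehat{\Gamma}.$$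
   Context: Setting. $\Gamma$ is a countable discrete abelian group (written additively, identity $e$), $\widehat{\Gamma}$ is its (compact) dual group with Haar measure $m_{\widehat{\Gamma}}$ normalized by $m_{\widehat{\Gamma}}(\widehat{\Gamma})=1$, and $(\gamma,\alpha)$ denotes the value of the character $\alpha\in\widehat{\Gamma}$ at $\gamma\in\Gamma$. $(\mathcal{X},\mu)$ is a $\sigma$-finite measure space with $L^2(\mathcal{X})=L^2(\mathcal{X},\mu)$ separable. $\sigma:\Gamma\times\mathcal{X}\to\mathcal{X}$ is an action: each $\sigma_\gamma:=\sigma(\gamma,\cdot)$ is measurable, $\sigma_\gamma\circ\sigma_{\gamma'}=\sigma_{\gamma+\gamma'}$, and $\sigma_e$ is the identity. The action is quasi-$\Gamma$-invariant: there is a measurable function $J_\sigma:\Gamma\times\mathcal{X}\to(0,\infty)$ (the Jacobian) with $d\mu(\sigma_\gamma(x))=J_\sigma(\gamma,x)\,d\mu(x)$, i.e. $\mu(\sigma_\gamma(E))=\int_E J_\sigma(\gamma,x)\,d\mu(x)$ for measurable $E$. The action has the tiling property with tiling set $C$: $C\subseteq\mathcal{X}$ is measurable, $\mu(\sigma_\gamma(C)\cap\sigma_{\gamma'}(C))=0$ for $\gamma\ne\gamma'$, and $\mu(\mathcal{X}\setminus\bigcup_{\gamma\in\Gamma}\sigma_\gamma(C))=0$. $L^2(C)$ is taken with respect to $\mu|_C$. The associated unitary representation of $\Gamma$ on $L^2(\mathcal{X})$ is $\Pi_\sigma(\gamma)\psi(x)=J_\sigma(-\gamma,x)^{1/2}\psi(\sigma_{-\gamma}(x))$.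 A closed subspace $V\subseteq L^2(\mathcal{X})$ is $(\Gamma,\sigma)$-invariant if $\Pi_\sigma(\gamma)f\in V$ for all $f\in V$, $\gamma\in\Gamma$. For $\mathcal{A}\subseteq L^2(\mathcal{X})$, $S_\sigma^\Gamma(\mathcal{A})=\overline{\mathrm{span}}\{\Pi_\sigma(\gamma)\phi:\phi\in\mathcal{A},\gamma\in\Gamma\}$. The generalized Zak transform is the isometric isomorphism $Z_\sigma:L^2(\mathcal{X})\to L^2(\widehat{\Gamma},L^2(C))$, $Z_\sigma[\psi](\alpha)(x)=\sum_{\gamma\in\Gamma}[(\Pi_\sigma(\gamma)\psi)(x)]\,(-\gamma,\alpha)$, the sum being the $\ell^2(\Gamma)\to L^2(\widehat\Gamma)$ Fourier transform of the sequence $\{(\Pi_\sigma(\gamma)\psi)(x)\}_{\gamma\in\Gamma}$, which is in $\ell^2(\Gamma)$ for a.e. $x$. A range function is a mapping $J:\widehat{\Gamma}\to\{\text{closed subspaces of }L^2(C)\}$ together with the orthogonal projections $P_J(\alpha)$ of $L^2(C)$ onto $J(\alpha)$; it is measurable if for every $a\in L^2(C)$ the map $\alpha\mapsto P_J(\alpha)a$ is measurable as a vector-valued function. *)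

theory Defs
  imports "HOL-Analysis.Analysis" "HOL-Library.Function_Algebras"
begin

text \<open>
  Elements of \<open>L\<^sup>2(M)\<close> are represented by square-integrable functions.  Sets of elements of
  \<open>L\<^sup>2(M)\<close> that are closed in the \<open>L\<^sup>2\<close> sense are automatically saturated under a.e. equality, so
  closed subspaces in this representation correspond bijectively to closed subspaces of the
  quotient, and equality of two of them as sets of functions is equality of subspaces.
\<close>

interpretation cfun: vector_space "\<lambda>(c::complex) (f::'x \<Rightarrow> complex). (\<lambda>x. c * f x)"
  by unfold_locales (auto simp: fun_eq_iff algebra_simps)

definition L2 :: "'x measure \<Rightarrow> ('x \<Rightarrow> complex) set" where
  "L2 M = {f \<in> borel_measurable M. integrable M (\<lambda>x. (cmod (f x))\<^sup>2)}"

definition l2_norm :: "'x measure \<Rightarrow> ('x \<Rightarrow> complex) \<Rightarrow> real" where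
  "l2_norm M f = sqrt (\<integral>x. (cmod (f x))\<^sup>2 \<partial>M)"

definition l2_inner :: "'x measure \<Rightarrow> ('x \<Rightarrow> complex) \<Rightarrow> ('x \<Rightarrow> complex) \<Rightarrow> complex" where
  "l2_inner M f g = (\<integral>x. f x * cnj (g x) \<partial>M)"

definition l2_closure :: "'x measure \<Rightarrow> ('x \<Rightarrow> complex) set \<Rightarrow> ('x \<Rightarrow> complex) set" where
  "l2_closure M S = {f \<in> L2 M. \<forall>\<epsilon>>0. \<exists>g\<in>S. l2_norm M (f - g) < \<epsilon>}"

definition l2_separable :: "'x measure \<Rightarrow> bool" where
  "l2_separable M \<longleftrightarrow> (\<exists>D. countable D \<and> D \<subseteq> L2 M \<and> l2_closure M D = L2 M)"

definition closed_subspace :: "'x measure \<Rightarrow> ('x \<Rightarrow> complex) set \<Rightarrow> bool" where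
  "closed_subspace M V \<longleftrightarrow> V \<subseteq> L2 M \<and> cfun.subspace V \<and> l2_closure M V = V"

definition closed_span :: "'x measure \<Rightarrow> ('x \<Rightarrow> complex) set \<Rightarrow> ('x \<Rightarrow> complex) set" where
  "closed_span M A = l2_closure M (cfun.span A)"

text \<open>Determined up to a.e. equality when \<open>V\<close> is a closed subspace and \<open>a \<in> L2 M\<close>.\<close>
definition l2_proj :: "'x measure \<Rightarrow> ('x \<Rightarrow> complex) set \<Rightarrow> ('x \<Rightarrow> complex) \<Rightarrow> ('x \<Rightarrow> complex)" where
  "l2_proj M V a = (SOME p. p \<in> V \<and> (\<forall>v\<in>V. l2_inner M (a - p) v = 0))"

definition l2_open :: "'x measure \<Rightarrow> ('x \<Rightarrow> complex) set \<Rightarrow> bool" where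
  "l2_open M U \<longleftrightarrow> U \<subseteq> L2 M \<and>
     (\<forall>f\<in>U. \<exists>\<epsilon>>0. \<forall>g\<in>L2 M. l2_norm M (g - f) < \<epsilon> \<longrightarrow> g \<in> U)"

text \<open>
  The Borel \<open>\<sigma>\<close>-algebra of the norm topology.  For separable \<open>L\<^sup>2(M)\<close>, measurability into it
  is the same as strong or weak measurability of a vector-valued function.
\<close>
definition l2_borel :: "'x measure \<Rightarrow> ('x \<Rightarrow> complex) measure" where
  "l2_borel M = sigma (L2 M) {U. l2_open M U}"

text \<open>
  Jointly measurable representatives of the elements of \<open>L\<^sup>2(N, L\<^sup>2(M))\<close>.
\<close>
definition L2_vec :: "'a measure \<Rightarrow> 'x measure \<Rightarrow> ('a \<Rightarrow> 'x \<Rightarrow> complex) set" where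
  "L2_vec N M = {F. (\<lambda>(\<alpha>, x). F \<alpha> x) \<in> borel_measurable (N \<Otimes>\<^sub>M M) \<and>
     (\<forall>\<alpha>\<in>space N. F \<alpha> \<in> L2 M) \<and> integrable N (\<lambda>\<alpha>. (l2_norm M (F \<alpha>))\<^sup>2)}"


subsection \<open>The dual group and its Fourier transform\<close>

definition characters :: "('g::ab_group_add \<Rightarrow> complex) set" where
  "characters = {\<xi>. (\<forall>a b. \<xi> (a + b) = \<xi> a * \<xi> b) \<and> (\<forall>a. cmod (\<xi> a) = 1)}"

text \<open>
  The type class topology on functions is that of pointwise convergence, which for a discrete
  group is the topology of the dual.  For a countable group the dual is compact and metrizable, so
  every Borel probability measure on it is regular and regularity need not be required.
\<close>
definition normalized_haar :: "('g::ab_group_add \<Rightarrow> complex) measure \<Rightarrow> bool" where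
  "normalized_haar m \<longleftrightarrow>
     sets m = sets (restrict_space borel characters) \<and>
     emeasure m characters = 1 \<and>
     (\<forall>\<xi>\<in>characters. \<forall>E\<in>sets m. emeasure m ((\<lambda>\<eta>. \<xi> * \<eta>) ` E) = emeasure m E)"

text \<open>
  \<open>g\<close> is (a representative of) the image of \<open>c\<close> under the Fourier transform from
  \<open>\<ell>\<^sup>2(\<Gamma>)\<close> to \<open>L\<^sup>2\<close> of the dual, i.e. the sum of \<open>c \<gamma> (-\<gamma>, \<alpha>)\<close> in the sense of unconditional
  \<open>L\<^sup>2\<close> convergence.  The characters being orthonormal, the sum converges only if
  \<open>c \<in> \<ell>\<^sup>2(\<Gamma>)\<close>.
\<close>
definition is_fourier ::
  "('g::ab_group_add \<Rightarrow> complex) measure \<Rightarrow> ('g \<Rightarrow> complex) \<Rightarrow> (('g \<Rightarrow> complex) \<Rightarrow> complex) \<Rightarrow> bool"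
where
  "is_fourier m c g \<longleftrightarrow> g \<in> L2 m \<and>
     ((\<lambda>F. l2_norm m (\<lambda>\<alpha>. (\<Sum>\<gamma>\<in>F. c \<gamma> * \<alpha> (- \<gamma>)) - g \<alpha>)) \<longlongrightarrow> 0) (finite_subsets_at_top UNIV)"


subsection \<open>Quasi-invariant actions with the tiling property\<close>

definition measurable_action :: "'x measure \<Rightarrow> ('g::ab_group_add \<Rightarrow> 'x \<Rightarrow> 'x) \<Rightarrow> bool" where
  "measurable_action M \<sigma> \<longleftrightarrow>
     (\<forall>\<gamma>. \<sigma> \<gamma> \<in> M \<rightarrow>\<^sub>M M) \<and>
     (\<forall>\<gamma> \<gamma>'. \<forall>x\<in>space M. \<sigma> \<gamma> (\<sigma> \<gamma>' x) = \<sigma> (\<gamma> + \<gamma>') x) \<and>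
     (\<forall>x\<in>space M. \<sigma> 0 x = x)"

definition is_jacobian ::
  "'x measure \<Rightarrow> ('g::ab_group_add \<Rightarrow> 'x \<Rightarrow> 'x) \<Rightarrow> ('g \<Rightarrow> 'x \<Rightarrow> real) \<Rightarrow> bool" where
  "is_jacobian M \<sigma> Jac \<longleftrightarrow>
     (\<lambda>(\<gamma>, x). Jac \<gamma> x) \<in> borel_measurable (count_space UNIV \<Otimes>\<^sub>M M) \<and>
     (\<forall>\<gamma>. \<forall>x\<in>space M. 0 < Jac \<gamma> x) \<and>
     (\<forall>\<gamma>. \<forall>E\<in>sets M. emeasure M (\<sigma> \<gamma> ` E) = (\<integral>\<^sup>+x\<in>E. ennreal (Jac \<gamma> x) \<partial>M))"

definition tiling_set ::
  "'x measure \<Rightarrow> ('g::ab_group_add \<Rightarrow> 'x \<Rightarrow> 'x) \<Rightarrow> 'x set \<Rightarrow> bool" where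
  "tiling_set M \<sigma> C \<longleftrightarrow> C \<in> sets M \<and>
     (\<forall>\<gamma> \<gamma>'. \<gamma> \<noteq> \<gamma>' \<longrightarrow> emeasure M (\<sigma> \<gamma> ` C \<inter> \<sigma> \<gamma>' ` C) = 0) \<and>
     emeasure M (space M - (\<Union>\<gamma>. \<sigma> \<gamma> ` C)) = 0"

definition rep ::
  "('g::ab_group_add \<Rightarrow> 'x \<Rightarrow> 'x) \<Rightarrow> ('g \<Rightarrow> 'x \<Rightarrow> real) \<Rightarrow> 'g \<Rightarrow> ('x \<Rightarrow> complex) \<Rightarrow> 'x \<Rightarrow> complex"
where
  "rep \<sigma> Jac \<gamma> \<psi> x = complex_of_real (sqrt (Jac (- \<gamma>) x)) * \<psi> (\<sigma> (- \<gamma>) x)"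

definition invariant_space ::
  "'x measure \<Rightarrow> ('g::ab_group_add \<Rightarrow> 'x \<Rightarrow> 'x) \<Rightarrow> ('g \<Rightarrow> 'x \<Rightarrow> real) \<Rightarrow> ('x \<Rightarrow> complex) set \<Rightarrow> bool"
where
  "invariant_space M \<sigma> Jac V \<longleftrightarrow>
     closed_subspace M V \<and> (\<forall>\<gamma>. \<forall>f\<in>V. rep \<sigma> Jac \<gamma> f \<in> V)"

definition generated_space ::
  "'x measure \<Rightarrow> ('g::ab_group_add \<Rightarrow> 'x \<Rightarrow> 'x) \<Rightarrow> ('g \<Rightarrow> 'x \<Rightarrow> real)
    \<Rightarrow> ('x \<Rightarrow> complex) set \<Rightarrow> ('x \<Rightarrow> complex) set"
where
  "generated_space M \<sigma> Jac A = closed_span M {rep \<sigma> Jac \<gamma> \<phi> | \<phi> \<gamma>. \<phi> \<in> A}"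

text \<open>
  The Fourier transform only defines \<open>\<alpha> \<mapsto> Z[\<psi>](\<alpha>)(x)\<close> up to null sets, separately for almost
  every \<open>x \<in> C\<close>; joint measurability is what makes these sections into an element of
  \<open>L\<^sup>2\<close> of the dual with values in \<open>L\<^sup>2(C)\<close>, unique by Fubini's theorem.
\<close>
definition zak ::
  "'x measure \<Rightarrow> ('g::ab_group_add \<Rightarrow> 'x \<Rightarrow> 'x) \<Rightarrow> ('g \<Rightarrow> 'x \<Rightarrow> real) \<Rightarrow> 'x set
    \<Rightarrow> ('g \<Rightarrow> complex) measure \<Rightarrow> ('x \<Rightarrow> complex) \<Rightarrow> ('g \<Rightarrow> complex) \<Rightarrow> 'x \<Rightarrow> complex"
where
  "zak M \<sigma> Jac C m \<psi> = (SOME F. F \<in> L2_vec m (restrict_space M C) \<and>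
     (AE x in restrict_space M C. is_fourier m (\<lambda>\<gamma>. rep \<sigma> Jac \<gamma> \<psi> x) (\<lambda>\<alpha>. F \<alpha> x)))"


subsection \<open>Range functions\<close>

definition measurable_range_function ::
  "'a measure \<Rightarrow> 'x measure \<Rightarrow> ('a \<Rightarrow> ('x \<Rightarrow> complex) set) \<Rightarrow> bool" where
  "measurable_range_function m N J \<longleftrightarrow>
     (\<forall>\<alpha>\<in>space m. closed_subspace N (J \<alpha>)) \<and>
     (\<forall>a\<in>L2 N. (\<lambda>\<alpha>. l2_proj N (J \<alpha>) a) \<in> m \<rightarrow>\<^sub>M l2_borel N)"

definition range_function_ae_eq ::
  "'a measure \<Rightarrow> 'x measure \<Rightarrow> (('a \<Rightarrow> ('x \<Rightarrow> complex) set) \<times> ('a \<Rightarrow> ('x \<Rightarrow> complex) set)) set"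
where
  "range_function_ae_eq m N = {(J, J').
     measurable_range_function m N J \<and> measurable_range_function m N J' \<and>
     (AE \<alpha> in m. J \<alpha> = J' \<alpha>)}"

definition range_space ::
  "'x measure \<Rightarrow> ('g::ab_group_add \<Rightarrow> 'x \<Rightarrow> 'x) \<Rightarrow> ('g \<Rightarrow> 'x \<Rightarrow> real) \<Rightarrow> 'x set
    \<Rightarrow> ('g \<Rightarrow> complex) measure \<Rightarrow> (('g \<Rightarrow> complex) \<Rightarrow> ('x \<Rightarrow> complex) set) \<Rightarrow> ('x \<Rightarrow> complex) set"
where
  "range_space M \<sigma> Jac C m J = {f \<in> L2 M. AE \<alpha> in m. zak M \<sigma> Jac C m f \<alpha> \<in> J \<alpha>}"

end

theory Submission imports Defs begin

text \<open>
  The Zak transform is a unitary map from \<open>L\<^sup>2(M)\<close> onto the square-integrable fields of functions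
  on the tile, and it turns the translation by a group element \<open>a\<close> into multiplication by the
  character value \<open>\<alpha> a\<close>.  Let \<open>V\<close> be generated by a countable family (every invariant space is, by
  separability), let \<open>J(\<alpha>)\<close> be the closed span of the transforms of the generators at \<open>\<alpha>\<close>, and let
  \<open>h\<close> lie in the space of \<open>J\<close> and be orthogonal to \<open>V\<close>.  For every generator \<open>\<phi>\<close> the function
  \<open>\<alpha> \<mapsto> \<langle>Z h(\<alpha>), Z \<phi>(\<alpha>)\<rangle>\<close> has vanishing Fourier coefficients, hence vanishes almost everywhere; so
  \<open>Z h(\<alpha>)\<close> lies in \<open>J(\<alpha>)\<close> and is orthogonal to it, and \<open>h = 0\<close>.  Measurability of \<open>J\<close> comes from
  the distances to \<open>J(\<alpha>)\<close>, which are infima over rational combinations of the generators.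
  Surjectivity of the transform follows by the same orthogonality argument from the fact that
  functions on the tile have constant transforms; it implies that the space of \<open>J\<close> determines \<open>J\<close>.
\<close>

text \<open>Three obstacles shape the argument. The transform \<open>zak\<close> is a choice among
  representatives, so it is linear and equivariant only up to null sets. Everything is therefore
  proved for the relation \<open>is_zak\<close>, which every admissible field satisfies, and carried
  over by uniqueness up to fibres of norm zero; \<open>l2_proj\<close> calls for the same caution.
  Next, Fourier analysis on the dual has two independent sources. Parseval rests on orthogonality of
  the evaluations at group elements, which needs characters separating points of the group; these
  come from extending characters of subgroups, by divisibility of the circle. Uniqueness rests on
  density of trigonometric polynomials (Stone-Weierstrass) and reaches measurable sets through
  closed ones. Finally, fibrewise statements hold only off null sets, so each is arranged as
  countably many conditions: countable generators, a countable dense set, the countable group. The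
  isometry has an elementary source: up to Jacobian weights, the translates of a function, seen on
  the tile, list its values on all tiles, and Parseval applies along each orbit.\<close>

(* Under binders this rule loops with associativity of multiplication. *)
declare cfun.scale_scale [simp del]

section \<open>The Hilbert space of square-integrable functions\<close>

lemma borel_measurable_cnj [measurable (raw)]:
  "f \<in> borel_measurable M \<Longrightarrow> (\<lambda>x. cnj (f x)) \<in> borel_measurable M"
  by (rule borel_measurable_continuous_on[of cnj]) (auto intro: continuous_intros)

lemma L2_iff_nn:
  "f \<in> L2 M \<longleftrightarrow> f \<in> borel_measurable M \<and> (\<integral>\<^sup>+x. ennreal ((cmod (f x))\<^sup>2) \<partial>M) < \<infinity>"
  by (auto simp: L2_def integrable_iff_bounded)

lemma L2_measurable [measurable_dest]: "f \<in> L2 M \<Longrightarrow> f \<in> borel_measurable M"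
  by (simp add: L2_def)

lemma L2_integrable: "f \<in> L2 M \<Longrightarrow> integrable M (\<lambda>x. (cmod (f x))\<^sup>2)"
  by (simp add: L2_def)

lemma L2_zero [simp]: "0 \<in> L2 M"
  by (simp add: L2_def zero_fun_def)

lemma L2_cmult [intro]:
  assumes "f \<in> L2 M" shows "(\<lambda>x. c * f x) \<in> L2 M"
  using assms by (auto simp: L2_def norm_mult power_mult_distrib)

lemma L2_add [intro]:
  assumes "f \<in> L2 M" "g \<in> L2 M" shows "f + g \<in> L2 M"
proof -
  have [measurable]: "f \<in> borel_measurable M" "g \<in> borel_measurable M"
    using assms by (auto simp: L2_def)
  have "integrable M (\<lambda>x. (cmod (f x + g x))\<^sup>2)"
  proof (rule Bochner_Integration.integrable_bound)
    show "integrable M (\<lambda>x. 2 * (cmod (f x))\<^sup>2 + 2 * (cmod (g x))\<^sup>2)"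
      using assms by (auto simp: L2_def)
    show "AE x in M. norm ((cmod (f x + g x))\<^sup>2) \<le> norm (2 * (cmod (f x))\<^sup>2 + 2 * (cmod (g x))\<^sup>2)"
    proof (rule AE_I2)
      fix x
      have "(cmod (f x + g x))\<^sup>2 \<le> (cmod (f x) + cmod (g x))\<^sup>2"
        by (intro power_mono norm_triangle_ineq) auto
      also have "\<dots> \<le> 2 * (cmod (f x))\<^sup>2 + 2 * (cmod (g x))\<^sup>2"
        using sum_squares_bound[of "cmod (f x)" "cmod (g x)"] by (simp add: power2_sum)
      finally show "norm ((cmod (f x + g x))\<^sup>2) \<le> norm (2 * (cmod (f x))\<^sup>2 + 2 * (cmod (g x))\<^sup>2)"
        by simp
    qed
  qed measurable
  then show ?thesis
    by (auto simp: L2_def plus_fun_def)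
qed

lemma L2_uminus [intro]:
  assumes "f \<in> L2 M" shows "- f \<in> L2 M"
  using assms by (auto simp: L2_def fun_Compl_def)

lemma L2_diff [intro]:
  assumes "f \<in> L2 M" "g \<in> L2 M" shows "f - g \<in> L2 M"
  using L2_add[OF assms(1) L2_uminus[OF assms(2)]] by simp

lemma subspace_L2: "cfun.subspace (L2 M)"
  unfolding cfun.subspace_def by auto

section \<open>Inner product, norm and Cauchy-Schwarz\<close>

lemma integrable_l2_inner:
  assumes "f \<in> L2 M" "g \<in> L2 M" shows "integrable M (\<lambda>x. f x * cnj (g x))"
proof (rule Bochner_Integration.integrable_bound)
  show "integrable M (\<lambda>x. (cmod (f x))\<^sup>2 + (cmod (g x))\<^sup>2)"
    using assms by (auto simp: L2_def)
  have [measurable]: "f \<in> borel_measurable M" "g \<in> borel_measurable M"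
    using assms by (auto simp: L2_def)
  show "(\<lambda>x. f x * cnj (g x)) \<in> borel_measurable M"
    by measurable
  have *: "a * b \<le> a\<^sup>2 + b\<^sup>2" if "a \<ge> 0" "b \<ge> 0" for a b :: real
    using sum_squares_bound[of a b] mult_nonneg_nonneg[OF that] by linarith
  then show "AE x in M. norm (f x * cnj (g x)) \<le> norm ((cmod (f x))\<^sup>2 + (cmod (g x))\<^sup>2)"
    by (intro AE_I2) (simp add: norm_mult)
qed

lemma l2_inner_add_left:
  "f \<in> L2 M \<Longrightarrow> g \<in> L2 M \<Longrightarrow> h \<in> L2 M \<Longrightarrow> l2_inner M (f + g) h = l2_inner M f h + l2_inner M g h"
  by (simp add: l2_inner_def distrib_right integrable_l2_inner)

lemma l2_inner_cmult_left:
  "l2_inner M (\<lambda>x. c * f x) h = c * l2_inner M f h"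
  by (simp add: l2_inner_def mult.assoc)

lemma l2_inner_commute: "l2_inner M g f = cnj (l2_inner M f g)"
  unfolding l2_inner_def by (simp add: mult.commute flip: Bochner_Integration.integral_cnj)

lemma l2_inner_diff_left:
  "f \<in> L2 M \<Longrightarrow> g \<in> L2 M \<Longrightarrow> h \<in> L2 M \<Longrightarrow> l2_inner M (f - g) h = l2_inner M f h - l2_inner M g h"
  by (simp add: l2_inner_def left_diff_distrib integrable_l2_inner)

lemma l2_inner_add_right:
  "f \<in> L2 M \<Longrightarrow> g \<in> L2 M \<Longrightarrow> h \<in> L2 M \<Longrightarrow> l2_inner M h (f + g) = l2_inner M h f + l2_inner M h g"
  by (simp add: l2_inner_def distrib_left integrable_l2_inner)

lemma l2_inner_diff_right:
  "f \<in> L2 M \<Longrightarrow> g \<in> L2 M \<Longrightarrow> h \<in> L2 M \<Longrightarrow> l2_inner M h (f - g) = l2_inner M h f - l2_inner M h g"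
  by (simp add: l2_inner_def right_diff_distrib integrable_l2_inner)

lemma l2_inner_cmult_right:
  "l2_inner M f (\<lambda>x. c * h x) = cnj c * l2_inner M f h"
  using l2_inner_cmult_left[of M c h f] l2_inner_commute by (metis complex_cnj_mult)

lemma l2_inner_zero [simp]: "l2_inner M 0 f = 0" "l2_inner M f 0 = 0"
  by (simp_all add: l2_inner_def)

lemma l2_norm_nonneg [simp]: "0 \<le> l2_norm M f"
  by (simp add: l2_norm_def)

lemma l2_norm_sq: "(l2_norm M f)\<^sup>2 = (\<integral>x. (cmod (f x))\<^sup>2 \<partial>M)"
  by (simp add: l2_norm_def)

lemma l2_norm_zero [simp]: "l2_norm M 0 = 0"
  by (simp add: l2_norm_def)

lemma l2_inner_self: "l2_inner M f f = of_real ((l2_norm M f)\<^sup>2)"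
  unfolding l2_norm_sq l2_inner_def complex_norm_square[symmetric] by (rule integral_complex_of_real)

lemma l2_norm_nn:
  "f \<in> L2 M \<Longrightarrow> ennreal ((l2_norm M f)\<^sup>2) = (\<integral>\<^sup>+x. ennreal ((cmod (f x))\<^sup>2) \<partial>M)"
  unfolding l2_norm_sq by (rule nn_integral_eq_integral[symmetric]) (auto simp: L2_def)

lemma l2_norm_cmult: "l2_norm M (\<lambda>x. c * f x) = cmod c * l2_norm M f"
  by (simp add: l2_norm_def norm_mult power_mult_distrib real_sqrt_mult)

lemma l2_norm_uminus: "l2_norm M (- f) = l2_norm M f"
  by (simp add: l2_norm_def)

lemma l2_norm_diff_commute: "l2_norm M (f - g) = l2_norm M (g - f)"
  by (simp add: l2_norm_def norm_minus_commute)

lemma l2_norm_cong_AE: "f \<in> borel_measurable M \<Longrightarrow> g \<in> borel_measurable M \<Longrightarrow> AE x in M. f x = g x \<Longrightarrow> l2_norm M f = l2_norm M g"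
  unfolding l2_norm_def by (intro arg_cong[where f=sqrt] integral_cong_AE) auto

lemma l2_inner_cong_AE: 
  assumes [measurable]: "f \<in> borel_measurable M" "g \<in> borel_measurable M"
    "f' \<in> borel_measurable M" "g' \<in> borel_measurable M"
    and "AE x in M. f x = g x" "AE x in M. f' x = g' x"
  shows "l2_inner M f f' = l2_inner M g g'"
  unfolding l2_inner_def using assms(5-6) by (intro integral_cong_AE) auto

lemma l2_norm_eq_0_iff: "f \<in> L2 M \<Longrightarrow> l2_norm M f = 0 \<longleftrightarrow> (AE x in M. f x = 0)"
  unfolding l2_norm_def by (simp add: integral_nonneg_eq_0_iff_AE L2_def)

lemma l2_norm_add_sq:
  assumes "f \<in> L2 M" "g \<in> L2 M"
  shows "(l2_norm M (f + g))\<^sup>2 = (l2_norm M f)\<^sup>2 + (l2_norm M g)\<^sup>2 + 2 * Re (l2_inner M f g)"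
proof -
  have "l2_inner M (f + g) (f + g)
      = l2_inner M f f + l2_inner M g g + (l2_inner M f g + cnj (l2_inner M f g))"
    using assms by (simp add: l2_inner_add_left l2_inner_add_right L2_add l2_inner_commute[of M g f])
  then have "complex_of_real ((l2_norm M (f + g))\<^sup>2)
      = of_real ((l2_norm M f)\<^sup>2 + (l2_norm M g)\<^sup>2 + 2 * Re (l2_inner M f g))"
    unfolding l2_inner_self complex_add_cnj by simp
  then show ?thesis using of_real_eq_iff by blast
qed

lemma l2_norm_diff_sq:
  assumes "f \<in> L2 M" "g \<in> L2 M"
  shows "(l2_norm M (f - g))\<^sup>2 = (l2_norm M f)\<^sup>2 + (l2_norm M g)\<^sup>2 - 2 * Re (l2_inner M f g)"
proof -
  have "l2_inner M f (- g) = - l2_inner M f g"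
    using l2_inner_diff_right[OF L2_zero assms(2) assms(1)] by simp
  then show ?thesis
    using l2_norm_add_sq[OF assms(1) L2_uminus[OF assms(2)]] by (simp add: l2_norm_uminus)
qed

lemma l2_inner_zero_AE:
  assumes "f \<in> L2 M" "g \<in> L2 M" "l2_norm M g = 0" shows "l2_inner M f g = 0"
proof -
  have "l2_inner M f g = l2_inner M f 0"
    using assms(3) by (intro l2_inner_cong_AE) (auto simp: l2_norm_eq_0_iff[OF assms(2)] zero_fun_def
        intro: L2_measurable assms)
  then show ?thesis by simp
qed

lemma l2_Cauchy_Schwarz:
  assumes "f \<in> L2 M" "g \<in> L2 M"
  shows "cmod (l2_inner M f g) \<le> l2_norm M f * l2_norm M g"
proof (cases "l2_norm M g = 0")
  case True
  then show ?thesis by (simp add: l2_inner_zero_AE[OF assms])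
next
  case False
  define c where "c = l2_inner M f g"
  define n where "n = (l2_norm M g)\<^sup>2"
  have n: "n > 0" using False by (simp add: n_def)
  define k where "k = c / complex_of_real n"
  have kg: "(\<lambda>x. k * g x) \<in> L2 M" using assms by auto
  \<comment> \<open>With this \<open>k\<close> the vector \<open>k g\<close> is the component of
    \<open>f\<close> along \<open>g\<close>; nonnegativity of the squared norm of the remainder is
    the inequality.\<close>
  have "0 \<le> (l2_norm M (f - (\<lambda>x. k * g x)))\<^sup>2" by simp
  also have "\<dots> = (l2_norm M f)\<^sup>2 + (cmod k)\<^sup>2 * n - 2 * Re (cnj k * c)"
    unfolding l2_norm_diff_sq[OF assms(1) kg] l2_norm_cmult l2_inner_cmult_right
    by (simp add: c_def n_def power_mult_distrib)
  also have "(cmod k)\<^sup>2 = (cmod c)\<^sup>2 / n\<^sup>2"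
    using n by (simp add: k_def norm_divide power_divide)
  also have "cnj k * c = cnj c * c / of_real n" by (simp add: k_def)
  also have "cnj c * c = of_real ((cmod c)\<^sup>2)"
    using complex_norm_square[of c] by (simp add: mult.commute)
  also have "Re (of_real ((cmod c)\<^sup>2) / of_real n) = (cmod c)\<^sup>2 / n"
    unfolding of_real_divide[symmetric] by simp
  finally have "(cmod c)\<^sup>2 / n \<le> (l2_norm M f)\<^sup>2"
    using n by (simp add: power2_eq_square)
  then have "(cmod c)\<^sup>2 \<le> (l2_norm M f * l2_norm M g)\<^sup>2"
    using n by (simp add: n_def divide_le_eq power_mult_distrib)
  then show ?thesis
    unfolding c_def by (rule power2_le_imp_le) simp
qed

lemma l2_norm_triangle:
  assumes "f \<in> L2 M" "g \<in> L2 M"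
  shows "l2_norm M (f + g) \<le> l2_norm M f + l2_norm M g"
proof (rule power2_le_imp_le)
  have "Re (l2_inner M f g) \<le> l2_norm M f * l2_norm M g"
    using l2_Cauchy_Schwarz[OF assms] complex_Re_le_cmod order_trans by blast
  then show "(l2_norm M (f + g))\<^sup>2 \<le> (l2_norm M f + l2_norm M g)\<^sup>2"
    unfolding l2_norm_add_sq[OF assms] power2_sum by simp
qed simp

lemma l2_norm_triangle_diff:
  assumes "f \<in> L2 M" "g \<in> L2 M" "h \<in> L2 M"
  shows "l2_norm M (f - h) \<le> l2_norm M (f - g) + l2_norm M (g - h)"
  using l2_norm_triangle[of "f - g" M "g - h"] assms by auto

lemma l2_norm_triangle_rev:
  assumes "f \<in> L2 M" "g \<in> L2 M"
  shows "\<bar>l2_norm M f - l2_norm M g\<bar> \<le> l2_norm M (f - g)"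
  using l2_norm_triangle[of "f - g" M g] l2_norm_triangle[of "g - f" M f] assms
    l2_norm_diff_commute[of M f g] L2_diff by fastforce

section \<open>Limits almost everywhere and completeness\<close>

lemma L2_cong_AE:
  assumes "f \<in> L2 M" "g \<in> borel_measurable M" "AE x in M. f x = g x"
  shows "g \<in> L2 M"
proof -
  have "(\<integral>\<^sup>+x. ennreal ((cmod (g x))\<^sup>2) \<partial>M) = (\<integral>\<^sup>+x. ennreal ((cmod (f x))\<^sup>2) \<partial>M)"
    using assms(3) by (intro nn_integral_cong_AE) auto
  then show ?thesis using assms by (simp add: L2_iff_nn)
qed

text \<open>The weights \<open>4 ^ n\<close> give pointwise geometric decay of the increments almost everywhere.\<close>
lemma L2_fast_Cauchy_converges:
  assumes f: "\<And>n. f n \<in> L2 M" and fast: "\<And>n. (l2_norm M (f (Suc n) - f n))\<^sup>2 \<le> (1/8)^n"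
  shows "AE x in M. convergent (\<lambda>n. f n x)"
proof -
  have [measurable]: "f n \<in> borel_measurable M" for n using f by (simp add: L2_def)
  have "(\<integral>\<^sup>+x. (\<Sum>n. ennreal (4^n * (cmod (f (Suc n) x - f n x))\<^sup>2)) \<partial>M)
      = (\<Sum>n. \<integral>\<^sup>+x. ennreal (4^n * (cmod (f (Suc n) x - f n x))\<^sup>2) \<partial>M)"
    by (rule nn_integral_suminf) measurable
  also have "\<dots> \<le> (\<Sum>n. ennreal ((1/2)^n))"
  proof (rule suminf_le)
    fix n
    have "(\<integral>\<^sup>+x. ennreal (4^n * (cmod (f (Suc n) x - f n x))\<^sup>2) \<partial>M)
        = ennreal (4^n) * (\<integral>\<^sup>+x. ennreal ((cmod ((f (Suc n) - f n) x))\<^sup>2) \<partial>M)"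
      by (subst nn_integral_cmult[symmetric]) (auto simp: ennreal_mult)
    also have "\<dots> = ennreal (4^n * (l2_norm M (f (Suc n) - f n))\<^sup>2)"
      by (subst l2_norm_nn[symmetric]) (auto simp: f L2_diff ennreal_mult)
    also have "\<dots> \<le> ennreal (4^n * (1/8)^n)"
      by (intro ennreal_leI mult_left_mono fast) simp
    also have "(4::real)^n * (1/8)^n = (1/2)^n"
      by (simp add: power_mult_distrib[symmetric])
    finally show "(\<integral>\<^sup>+x. ennreal (4^n * (cmod (f (Suc n) x - f n x))\<^sup>2) \<partial>M) \<le> ennreal ((1/2)^n)" .
  qed simp_all
  also have "\<dots> < \<infinity>"
    by (subst suminf_ennreal2) (auto intro: summable_geometric)
  finally have "AE x in M. (\<Sum>n. ennreal (4^n * (cmod (f (Suc n) x - f n x))\<^sup>2)) \<noteq> \<infinity>"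
    by (intro nn_integral_PInf_AE) auto
  then show ?thesis
  proof eventually_elim
    case (elim x)
    define a where "a n = 4^n * (cmod (f (Suc n) x - f n x))\<^sup>2" for n
    have "summable a"
      by (rule summable_suminf_not_top) (use elim in \<open>auto simp: a_def\<close>)
    then have "Bseq a"
      using summable_imp_Bseq by blast
    then obtain K where K: "\<And>n. norm (a n) \<le> K" "K > 0"
      by (auto simp: Bseq_def)
    have bd: "norm (f (Suc n) x - f n x) \<le> sqrt K * (1/2)^n" for n
    proof (rule power2_le_imp_le)
      have "(cmod (f (Suc n) x - f n x))\<^sup>2 \<le> K / 4^n"
        using K(1)[of n] by (simp add: a_def field_simps)
      also have "\<dots> = (sqrt K * (1/2)^n)\<^sup>2"
        using K(2) by (simp add: power_mult_distrib power_divide power2_eq_square flip: power_mult_distrib)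
      finally show "(norm (f (Suc n) x - f n x))\<^sup>2 \<le> (sqrt K * (1/2)^n)\<^sup>2" .
    qed (use K in simp)
    have "summable (\<lambda>n. f (Suc n) x - f n x)"
      by (rule summable_comparison_test'[where g="\<lambda>n. sqrt K * (1/2)^n" and N=0])
        (use bd in \<open>auto intro!: summable_mult summable_geometric\<close>)
    then have "convergent (\<lambda>n. \<Sum>i<n. f (Suc i) x - f i x)"
      by (simp add: summable_iff_convergent)
    then have "convergent (\<lambda>n. f 0 x + (\<Sum>i<n. f (Suc i) x - f i x))"
      by (intro convergent_add convergent_const)
    then show ?case
      using sum_lessThan_telescope[of "\<lambda>n. f n x"] by simp
  qed
qed

text \<open>Fatou's lemma for squared moduli. The bound is asked only from \<open>n0\<close> on,
  because it will be applied to the increments \<open>f k - f n\<close> with \<open>n\<close> fixed,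
  which are controlled only for k \<ge> n.\<close>

lemma l2_norm_le_Fatou:
  assumes f: "\<And>n. f n \<in> L2 M" and g: "g \<in> borel_measurable M"
    and lim: "AE x in M. (\<lambda>n. f n x) \<longlonglongrightarrow> g x"
    and bd: "\<And>n. n \<ge> n0 \<Longrightarrow> l2_norm M (f n) \<le> B"
  shows "g \<in> L2 M" "l2_norm M g \<le> B"
proof -
  have [measurable]: "f n \<in> borel_measurable M" for n using f by (simp add: L2_def)
  note g[measurable]
  have B0: "B \<ge> 0" using bd[of n0] l2_norm_nonneg[of M "f n0"] by linarith
  have "(\<integral>\<^sup>+x. ennreal ((cmod (g x))\<^sup>2) \<partial>M)
      = (\<integral>\<^sup>+x. liminf (\<lambda>n. ennreal ((cmod (f n x))\<^sup>2)) \<partial>M)"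
    using lim
  proof (intro nn_integral_cong_AE, eventually_elim)
    case (elim x)
    have "(\<lambda>n. ennreal ((cmod (f n x))\<^sup>2)) \<longlonglongrightarrow> ennreal ((cmod (g x))\<^sup>2)"
      by (intro tendsto_intros elim tendsto_ennrealI)
    then show ?case by (metis lim_imp_Liminf sequentially_bot)
  qed
  also have "\<dots> \<le> liminf (\<lambda>n. \<integral>\<^sup>+x. ennreal ((cmod (f n x))\<^sup>2) \<partial>M)"
    by (rule nn_integral_liminf) measurable
  also have "\<dots> \<le> ennreal (B\<^sup>2)"
  proof (rule Liminf_le)
    show "\<forall>\<^sub>F n in sequentially. (\<integral>\<^sup>+x. ennreal ((cmod (f n x))\<^sup>2) \<partial>M) \<le> ennreal (B\<^sup>2)"
      using eventually_ge_at_top[of n0]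
      by eventually_elim (auto simp: l2_norm_nn[OF f, symmetric] intro!: ennreal_leI power_mono bd)
  qed simp
  finally have *: "(\<integral>\<^sup>+x. ennreal ((cmod (g x))\<^sup>2) \<partial>M) \<le> ennreal (B\<^sup>2)" .
  then show "g \<in> L2 M"
    using le_less_trans by (fastforce simp: L2_iff_nn)
  from * have "(l2_norm M g)\<^sup>2 \<le> B\<^sup>2"
    unfolding l2_norm_nn[OF \<open>g \<in> L2 M\<close>, symmetric] using B0 by (simp add: ennreal_le_iff)
  then show "l2_norm M g \<le> B" using B0 power2_le_imp_le by blast
qed

text \<open>Letting k grow in \<open>f k - f n\<close>, Fatou passes the bound to the pointwise
  limit, so the limit almost everywhere is also the limit in norm, at the same rate.\<close>

lemma L2_fast_Cauchy_limit:
  assumes f: "\<And>n. f n \<in> L2 M" and fast: "\<And>n k. k \<ge> n \<Longrightarrow> (l2_norm M (f k - f n))\<^sup>2 \<le> (1/8)^n"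
  obtains g where "g \<in> L2 M" "\<And>n. (l2_norm M (f n - g))\<^sup>2 \<le> (1/8)^n"
proof -
  have [measurable]: "f n \<in> borel_measurable M" for n using f by (simp add: L2_def)
  define g where "g x = lim (\<lambda>n. f n x)" for x
  have [measurable]: "g \<in> borel_measurable M"
    unfolding g_def by measurable
  have lim: "AE x in M. (\<lambda>n. f n x) \<longlonglongrightarrow> g x"
    using L2_fast_Cauchy_converges[OF f fast[OF le_SucI[OF order_refl]]]
    by eventually_elim (simp add: convergent_LIMSEQ_iff g_def)
  have *: "g - f n \<in> L2 M \<and> l2_norm M (g - f n) \<le> sqrt ((1/8)^n)" for n
  proof -
    have 1: "(\<lambda>x. g x - f n x) \<in> borel_measurable M" by measurable
    have "AE x in M. (\<lambda>k. (f k - f n) x) \<longlonglongrightarrow> (g - f n) x"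
      using lim by eventually_elim (auto intro!: tendsto_intros)
    moreover have "l2_norm M (f k - f n) \<le> sqrt ((1/8)^n)" if "k \<ge> n" for k
      using fast[OF that] real_le_rsqrt by blast
    ultimately show ?thesis
      using l2_norm_le_Fatou[of "\<lambda>k. f k - f n" M "g - f n" n "sqrt ((1/8)^n)"] f 1
        L2_diff[OF f f] unfolding fun_diff_def by blast
  qed
  then have "g \<in> L2 M" using L2_add[of "g - f 0" M "f 0"] f by simp
  moreover have "(l2_norm M (f n - g))\<^sup>2 \<le> (1/8)^n" for n
    using power_mono[OF conjunct2[OF *[of n]], of 2] by (simp add: l2_norm_diff_commute)
  ultimately show thesis by (rule that)
qed

lemma L2_complete:
  assumes f: "\<And>n. f n \<in> L2 M"
    and cauchy: "\<And>\<epsilon>. \<epsilon> > 0 \<Longrightarrow> \<exists>N. \<forall>m\<ge>N. \<forall>n\<ge>N. l2_norm M (f m - f n) < \<epsilon>"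
  obtains g where "g \<in> L2 M" "(\<lambda>n. l2_norm M (f n - g)) \<longlonglongrightarrow> 0"
proof -
  have "\<exists>N. \<forall>m\<ge>N. \<forall>n\<ge>N. l2_norm M (f m - f n) < sqrt ((1/8)^k)" for k :: nat
    by (rule cauchy) simp
  then obtain N where N: "\<And>k m n. m \<ge> N k \<Longrightarrow> n \<ge> N k \<Longrightarrow> l2_norm M (f m - f n) < sqrt ((1/8)^k)"
    by metis
  \<comment> \<open>Summing the thresholds makes the index monotone while keeping \<open>r k\<close>
    above \<open>N k\<close>.\<close>
  define r where "r k = (\<Sum>i\<le>k. N i)" for k
  have rN: "r k \<ge> N k" for k
    unfolding r_def by (rule member_le_sum) auto
  have rmono: "r k \<le> r l" if "k \<le> l" for k l
    unfolding r_def using that by (intro sum_mono2) auto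
  have sq: "(l2_norm M h)\<^sup>2 \<le> (1/8)^n" if "l2_norm M h < sqrt ((1/8)^n)" for h and n :: nat
    using power_mono[OF less_imp_le[OF that], of 2] by simp
  have "(l2_norm M (f (r k) - f (r n)))\<^sup>2 \<le> (1/8)^n" if "k \<ge> n" for n k
    using N[of n "r k" "r n"] rN[of n] rmono[OF that] by (intro sq) auto
  from L2_fast_Cauchy_limit[of "\<lambda>k. f (r k)", OF f this]
  obtain g where g: "g \<in> L2 M" "\<And>n. (l2_norm M (f (r n) - g))\<^sup>2 \<le> (1/8)^n"
    by blast
  have lim: "(\<lambda>n. l2_norm M (f n - g)) \<longlonglongrightarrow> 0"
  proof (rule LIMSEQ_I)
    fix \<epsilon> :: real assume "\<epsilon> > 0"
    have "(\<lambda>k. (1/8::real)^k) \<longlonglongrightarrow> 0"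
      by (rule LIMSEQ_realpow_zero) auto
    then have "\<forall>\<^sub>F k in sequentially. (1/8::real)^k < (\<epsilon>/2)\<^sup>2"
      using \<open>\<epsilon> > 0\<close> by (intro order_tendstoD(2)[of _ 0]) auto
    then obtain k where k: "(1/8::real)^k < (\<epsilon>/2)\<^sup>2"
      by (auto simp: eventually_sequentially)
    then have s: "sqrt ((1/8)^k) < \<epsilon>/2"
      using \<open>\<epsilon> > 0\<close> by (intro real_less_lsqrt k) auto
    have "l2_norm M (f (r k) - g) < \<epsilon>/2"
      using g(2)[of k] k \<open>\<epsilon> > 0\<close> by (intro power2_less_imp_less[of _ "\<epsilon>/2"]) auto
    moreover have "l2_norm M (f n - f (r k)) < \<epsilon>/2" if "n \<ge> r k" for n
      using N[of k n "r k"] rN[of k] that s by auto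
    ultimately have "norm (l2_norm M (f n - g) - 0) < \<epsilon>" if "n \<ge> r k" for n
      using l2_norm_triangle_diff[OF f[of n] f[of "r k"] g(1)] that by fastforce
    then show "\<exists>no. \<forall>n\<ge>no. norm (l2_norm M (f n - g) - 0) < \<epsilon>" by blast
  qed
  show thesis by (rule that[OF g(1) lim])
qed

section \<open>Closed subspaces and orthogonal projections\<close>

lemma closed_subspaceD:
  assumes "closed_subspace M V"
  shows "V \<subseteq> L2 M" "cfun.subspace V" "l2_closure M V = V"
  using assms by (auto simp: closed_subspace_def)

lemma closed_subspace_limit:
  assumes "closed_subspace M V" "f \<in> L2 M" "\<And>n::nat. g n \<in> V" "(\<lambda>n. l2_norm M (g n - f)) \<longlonglongrightarrow> 0"
  shows "f \<in> V"
proof -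
  have "f \<in> l2_closure M V"
    unfolding l2_closure_def
  proof (intro CollectI conjI allI impI assms(2))
    fix \<epsilon> :: real assume "\<epsilon> > 0"
    then have "\<forall>\<^sub>F n in sequentially. l2_norm M (g n - f) < \<epsilon>"
      by (rule order_tendstoD(2)[OF assms(4)])
    then obtain n where "l2_norm M (g n - f) < \<epsilon>"
      by (auto simp: eventually_sequentially)
    then show "\<exists>g\<in>V. l2_norm M (f - g) < \<epsilon>"
      using assms(3) l2_norm_diff_commute by metis
  qed
  then show ?thesis using closed_subspaceD(3)[OF assms(1)] by simp
qed

text \<open>The constant sequence \<open>f\<close> converges to \<open>g\<close> in norm; closedness
  thus saturates a subspace under equality almost everywhere.\<close>

lemma closed_subspace_AE:
  assumes "closed_subspace M V" "f \<in> V" "g \<in> borel_measurable M" "AE x in M. f x = g x"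
  shows "g \<in> V"
proof (rule closed_subspace_limit[OF assms(1)])
  have f: "f \<in> L2 M" using assms closed_subspaceD by blast
  show g: "g \<in> L2 M" by (rule L2_cong_AE[OF f assms(3,4)])
  show "\<And>n::nat. f \<in> V" by fact
  have "l2_norm M (f - g) = 0"
    using assms(4) by (simp add: l2_norm_eq_0_iff[OF L2_diff[OF f g]])
  then show "(\<lambda>n::nat. l2_norm M (f - g)) \<longlonglongrightarrow> 0" by simp
qed

text \<open>A minimizing sequence for the distance is Cauchy by the parallelogram law, and its limit
  attains the infimum; minimality then forces orthogonality of the residual.\<close>

lemma projection_exists:
  assumes V: "closed_subspace M V" and a: "a \<in> L2 M"
  obtains p where "p \<in> V" "\<And>v. v \<in> V \<Longrightarrow> l2_inner M (a - p) v = 0"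
proof -
  note sub = closed_subspaceD[OF V]
  have V_L2: "v \<in> L2 M" if "v \<in> V" for v using that sub by blast
  define D where "D = (\<lambda>v. (l2_norm M (a - v))\<^sup>2) ` V"
  have D0: "D \<noteq> {}" using cfun.subspace_0[OF sub(2)] by (auto simp: D_def)
  have bdd: "bdd_below D" by (rule bdd_belowI[of _ 0]) (auto simp: D_def)
  define d where "d = Inf D"
  have dle: "d \<le> (l2_norm M (a - v))\<^sup>2" if "v \<in> V" for v
    unfolding d_def using that bdd by (intro cInf_lower) (auto simp: D_def)
  have "\<exists>v\<in>V. (l2_norm M (a - v))\<^sup>2 < d + inverse (real (Suc n))" for n
    using cInf_lessD[OF D0, of "d + inverse (real (Suc n))"] unfolding d_def[symmetric]
    by (auto simp: D_def)
  then obtain v where v: "\<And>n. v n \<in> V" "\<And>n. (l2_norm M (a - v n))\<^sup>2 < d + inverse (real (Suc n))"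
    by metis
  \<comment> \<open>Half of \<open>A + B\<close> is \<open>a\<close> minus the midpoint of
    \<open>v m\<close> and \<open>v n\<close>, which lies in \<open>V\<close>. So the squared norm
    of \<open>A + B\<close> is at least \<open>4 * d\<close>, and the parallelogram law leaves only
    the two excesses over the infimum.\<close>
  have par: "(l2_norm M (v m - v n))\<^sup>2 \<le> 2 * inverse (real (Suc m)) + 2 * inverse (real (Suc n))" for m n
  proof -
    define A where "A = a - v m" define B where "B = a - v n"
    have AB: "A \<in> L2 M" "B \<in> L2 M" using a V_L2[OF v(1)] by (auto simp: A_def B_def)
    have e1: "B - A = v m - v n" by (simp add: A_def B_def)
    have mid: "(\<lambda>x. (1/2) * (v m + v n) x) \<in> V"
      using cfun.subspace_scale[OF sub(2)] cfun.subspace_add[OF sub(2)] v(1) by blast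
    define q where "q = a - (\<lambda>x. (1/2) * (v m + v n) x)"
    have e2: "A + B = (\<lambda>x. 2 * q x)"
      by (auto simp: A_def B_def q_def fun_eq_iff algebra_simps)
    have "(l2_norm M (A + B))\<^sup>2 = 4 * (l2_norm M q)\<^sup>2"
      unfolding e2 l2_norm_cmult by (simp add: power_mult_distrib)
    then have "4 * d \<le> (l2_norm M (A + B))\<^sup>2" using dle[OF mid] unfolding q_def by linarith
    moreover have "(l2_norm M (B - A))\<^sup>2 + (l2_norm M (A + B))\<^sup>2 = 2 * (l2_norm M A)\<^sup>2 + 2 * (l2_norm M B)\<^sup>2"
      using l2_norm_add_sq[OF AB] l2_norm_diff_sq[OF AB] by (simp add: l2_norm_diff_commute)
    moreover have "(l2_norm M A)\<^sup>2 < d + inverse (real (Suc m))" "(l2_norm M B)\<^sup>2 < d + inverse (real (Suc n))"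
      using v(2) by (auto simp: A_def B_def)
    ultimately show ?thesis unfolding e1[symmetric] by linarith
  qed
  obtain p where p: "p \<in> L2 M" "(\<lambda>n. l2_norm M (v n - p)) \<longlonglongrightarrow> 0"
  proof (rule L2_complete[of v M])
    show "v n \<in> L2 M" for n using V_L2 v by blast
    fix \<epsilon> :: real assume \<epsilon>: "\<epsilon> > 0"
    then obtain N where N: "inverse (real (Suc N)) < \<epsilon>\<^sup>2 / 4"
      using reals_Archimedean[of "\<epsilon>\<^sup>2/4"] by auto
    have "l2_norm M (v m - v n) < \<epsilon>" if "m \<ge> N" "n \<ge> N" for m n
    proof (rule power2_less_imp_less)
      have "inverse (real (Suc m)) \<le> inverse (real (Suc N))" "inverse (real (Suc n)) \<le> inverse (real (Suc N))"
        using that by (auto intro!: le_imp_inverse_le)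
      then show "(l2_norm M (v m - v n))\<^sup>2 < \<epsilon>\<^sup>2" using par[of m n] N by linarith
    qed (use \<epsilon> in simp)
    then show "\<exists>N. \<forall>m\<ge>N. \<forall>n\<ge>N. l2_norm M (v m - v n) < \<epsilon>" by blast
  qed blast
  have pV: "p \<in> V" by (rule closed_subspace_limit[OF V p(1) v(1) p(2)])
  have "(\<lambda>n. (sqrt (d + inverse (real (Suc n))) + l2_norm M (v n - p))\<^sup>2) \<longlonglongrightarrow> (sqrt (d + 0) + 0)\<^sup>2"
    by (intro tendsto_intros p(2) LIMSEQ_inverse_real_of_nat)
  moreover have "(l2_norm M (a - p))\<^sup>2 \<le> (sqrt (d + inverse (real (Suc n))) + l2_norm M (v n - p))\<^sup>2" for n
  proof (intro power_mono)
    have "l2_norm M (a - v n) \<le> sqrt (d + inverse (real (Suc n)))"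
      using v(2)[of n] by (intro real_le_rsqrt) auto
    then show "l2_norm M (a - p) \<le> sqrt (d + inverse (real (Suc n))) + l2_norm M (v n - p)"
      using l2_norm_triangle_diff[OF a V_L2[OF v(1)[of n]] p(1)] by simp
  qed simp
  ultimately have le: "(l2_norm M (a - p))\<^sup>2 \<le> (sqrt (d + 0) + 0)\<^sup>2"
    by (intro LIMSEQ_le_const) auto
  have "d \<ge> 0" unfolding d_def using D0 by (intro cInf_greatest) (auto simp: D_def)
  then have min: "(l2_norm M (a - p))\<^sup>2 \<le> d" using le by simp
  have "l2_inner M (a - p) w = 0" if w: "w \<in> V" for w
  proof (rule ccontr)
    define c where "c = l2_inner M (a - p) w"
    \<comment> \<open>Moving \<open>p\<close> by \<open>q = s c w\<close> changes the squared
      distance by |c|^2 s (s |w|^2 - 2), which is negative once s |w|^2 < 1. The 1 in the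
      denominator gives this and keeps \<open>s\<close> defined when \<open>w\<close> has norm
      zero.\<close>
    define s where "s = 1 / (1 + (l2_norm M w)\<^sup>2)"
    assume "l2_inner M (a - p) w \<noteq> 0"
    then have c: "(cmod c)\<^sup>2 > 0" by (simp add: c_def)
    have w2: "w \<in> L2 M" using V_L2 w by blast
    have s: "s > 0" "s * (l2_norm M w)\<^sup>2 < 1" by (auto simp: s_def add_pos_nonneg divide_simps)
    define q where "q = (\<lambda>x. (of_real s * c) * w x)"
    have q: "q \<in> V" "q \<in> L2 M"
      using cfun.subspace_scale[OF sub(2) w] V_L2 by (auto simp: q_def)
    have "d \<le> (l2_norm M (a - (p + q)))\<^sup>2"
      by (rule dle) (intro cfun.subspace_add[OF sub(2)] pV q)
    also have "a - (p + q) = (a - p) - q" by simp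
    also have "(l2_norm M ((a - p) - q))\<^sup>2
        = (l2_norm M (a - p))\<^sup>2 + (l2_norm M q)\<^sup>2 - 2 * Re (l2_inner M (a - p) q)"
      by (rule l2_norm_diff_sq) (use a p q in auto)
    also have "l2_inner M (a - p) q = of_real s * (c * cnj c)"
      unfolding q_def l2_inner_cmult_right c_def[symmetric] by simp
    also have "\<dots> = of_real (s * (cmod c)\<^sup>2)" by (simp only: complex_norm_square[symmetric] of_real_mult)
    also have "(l2_norm M q)\<^sup>2 = s * (cmod c)\<^sup>2 * (s * (l2_norm M w)\<^sup>2)"
      unfolding q_def l2_norm_cmult using s by (simp add: norm_mult power_mult_distrib power2_eq_square)
    finally have "2 * (s * (cmod c)\<^sup>2) \<le> s * (cmod c)\<^sup>2 * (s * (l2_norm M w)\<^sup>2)"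
      using min unfolding Re_complex_of_real by linarith
    moreover have "s * (cmod c)\<^sup>2 * (s * (l2_norm M w)\<^sup>2) < s * (cmod c)\<^sup>2 * 1"
      using s c by (intro mult_strict_left_mono) auto
    moreover have "s * (cmod c)\<^sup>2 > 0" using s c by simp
    ultimately show False by linarith
  qed
  with pV show thesis by (rule that)
qed

lemma subset_l2_closure: "S \<subseteq> L2 M \<Longrightarrow> S \<subseteq> l2_closure M S"
proof
  fix f assume "S \<subseteq> L2 M" "f \<in> S"
  then show "f \<in> l2_closure M S"
    unfolding l2_closure_def by (auto intro!: bexI[of _ f])
qed

lemma l2_closure_mono: "S \<subseteq> T \<Longrightarrow> l2_closure M S \<subseteq> l2_closure M T"
  by (auto simp: l2_closure_def) blast

lemma l2_closureD: "f \<in> l2_closure M S \<Longrightarrow> \<epsilon> > 0 \<Longrightarrow> \<exists>g\<in>S. l2_norm M (f - g) < \<epsilon>"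
  by (simp add: l2_closure_def)

lemma l2_closure_idem:
  assumes "S \<subseteq> L2 M" shows "l2_closure M (l2_closure M S) = l2_closure M S"
proof
  show "l2_closure M (l2_closure M S) \<subseteq> l2_closure M S"
  proof
    fix f assume f: "f \<in> l2_closure M (l2_closure M S)"
    then have fL: "f \<in> L2 M" by (simp add: l2_closure_def)
    have "\<exists>g\<in>S. l2_norm M (f - g) < \<epsilon>" if \<epsilon>: "\<epsilon> > 0" for \<epsilon>
    proof -
      obtain h where h: "h \<in> l2_closure M S" "l2_norm M (f - h) < \<epsilon>/2"
        using l2_closureD[OF f half_gt_zero[OF \<epsilon>]] by blast
      then obtain g where g: "g \<in> S" "l2_norm M (h - g) < \<epsilon>/2"
        using l2_closureD[OF h(1) half_gt_zero[OF \<epsilon>]] by blast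
      have "l2_norm M (f - g) \<le> l2_norm M (f - h) + l2_norm M (h - g)"
        using g h assms fL by (intro l2_norm_triangle_diff) (auto simp: l2_closure_def)
      then show ?thesis using g h by (intro bexI[of _ g]) auto
    qed
    then show "f \<in> l2_closure M S" using fL by (simp add: l2_closure_def)
  qed
  show "l2_closure M S \<subseteq> l2_closure M (l2_closure M S)"
    by (rule subset_l2_closure) (auto simp: l2_closure_def)
qed

lemma subspace_l2_closure:
  assumes S: "S \<subseteq> L2 M" "cfun.subspace S" shows "cfun.subspace (l2_closure M S)"
  unfolding cfun.subspace_def
proof (intro conjI allI ballI)
  show "0 \<in> l2_closure M S"
    using subset_l2_closure[OF S(1)] cfun.subspace_0[OF S(2)] by blast
next
  fix f g assume fg: "f \<in> l2_closure M S" "g \<in> l2_closure M S"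
  then have L: "f \<in> L2 M" "g \<in> L2 M" by (auto simp: l2_closure_def)
  have "\<exists>h\<in>S. l2_norm M (f + g - h) < \<epsilon>" if \<epsilon>: "\<epsilon> > 0" for \<epsilon>
  proof -
    obtain f' where f': "f' \<in> S" "l2_norm M (f - f') < \<epsilon>/2"
      using l2_closureD[OF fg(1) half_gt_zero[OF \<epsilon>]] by blast
    obtain g' where g': "g' \<in> S" "l2_norm M (g - g') < \<epsilon>/2"
      using l2_closureD[OF fg(2) half_gt_zero[OF \<epsilon>]] by blast
    have "l2_norm M ((f - f') + (g - g')) \<le> l2_norm M (f - f') + l2_norm M (g - g')"
      using f' g' L S by (intro l2_norm_triangle) auto
    then have "l2_norm M (f + g - (f' + g')) < \<epsilon>" using f' g' by (simp add: algebra_simps)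
    then show ?thesis using cfun.subspace_add[OF S(2) f'(1) g'(1)] by blast
  qed
  then show "f + g \<in> l2_closure M S" using L by (auto simp: l2_closure_def)
next
  fix c f assume f: "f \<in> l2_closure M S"
  then have L: "f \<in> L2 M" by (auto simp: l2_closure_def)
  have "\<exists>h\<in>S. l2_norm M ((\<lambda>x. c * f x) - h) < \<epsilon>" if \<epsilon>: "\<epsilon> > 0" for \<epsilon>
  proof -
    \<comment> \<open>The added 1 keeps the divisor positive when \<open>c\<close> is 0.\<close>
    have pos: "0 < cmod c + 1" by (simp add: add_nonneg_pos)
    obtain f' where f': "f' \<in> S" "l2_norm M (f - f') < \<epsilon> / (cmod c + 1)"
      using l2_closureD[OF f divide_pos_pos[OF \<epsilon> pos]] by blast
    have "(\<lambda>x. c * f x) - (\<lambda>x. c * f' x) = (\<lambda>x. c * (f - f') x)"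
      by (auto simp: fun_eq_iff algebra_simps)
    then have "l2_norm M ((\<lambda>x. c * f x) - (\<lambda>x. c * f' x)) = cmod c * l2_norm M (f - f')"
      by (metis l2_norm_cmult)
    also have "\<dots> \<le> (cmod c + 1) * l2_norm M (f - f')" by (simp add: mult_right_mono)
    also have "\<dots> < \<epsilon>" using f'(2) pos by (simp add: field_simps)
    finally show ?thesis using cfun.subspace_scale[OF S(2) f'(1)] by blast
  qed
  then show "(\<lambda>x. c * f x) \<in> l2_closure M S" using L by (auto simp: l2_closure_def)
qed

lemma span_subset_L2: "A \<subseteq> L2 M \<Longrightarrow> cfun.span A \<subseteq> L2 M"
  by (rule cfun.span_minimal[OF _ subspace_L2])

lemma closed_subspace_closed_span:
  assumes "A \<subseteq> L2 M" shows "closed_subspace M (closed_span M A)"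
  unfolding closed_subspace_def closed_span_def
  using subspace_l2_closure[OF span_subset_L2[OF assms] cfun.subspace_span]
    l2_closure_idem[OF span_subset_L2[OF assms]] by (auto simp: l2_closure_def)

lemma closed_span_superset: "A \<subseteq> L2 M \<Longrightarrow> A \<subseteq> closed_span M A"
  unfolding closed_span_def
  using subset_l2_closure[OF span_subset_L2] cfun.span_superset by blast

lemma closed_span_minimal:
  "closed_subspace M V \<Longrightarrow> A \<subseteq> V \<Longrightarrow> closed_span M A \<subseteq> V"
  unfolding closed_span_def
  using l2_closure_mono[OF cfun.span_minimal] by (metis closed_subspaceD(2,3))

lemma closed_subspace_add: "closed_subspace M V \<Longrightarrow> f \<in> V \<Longrightarrow> g \<in> V \<Longrightarrow> f + g \<in> V"
  using cfun.subspace_add closed_subspaceD(2) by blast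

lemma closed_subspace_diff: "closed_subspace M V \<Longrightarrow> f \<in> V \<Longrightarrow> g \<in> V \<Longrightarrow> f - g \<in> V"
  using cfun.subspace_diff closed_subspaceD(2) by blast

lemma closed_subspace_scale: "closed_subspace M V \<Longrightarrow> f \<in> V \<Longrightarrow> (\<lambda>x. c * f x) \<in> V"
  using cfun.subspace_scale closed_subspaceD(2) by blast

lemma closed_subspace_L2: "closed_subspace M V \<Longrightarrow> f \<in> V \<Longrightarrow> f \<in> L2 M"
  using closed_subspaceD(1) by blast

text \<open>Cauchy-Schwarz makes the inner product continuous. Since the orthogonal vectors form a
  closed subspace, orthogonality to generators extends to their closed span, and orthogonality to a
  dense set extends to all vectors.\<close>

lemma closed_subspace_orthogonal:
  assumes h: "h \<in> L2 M" shows "closed_subspace M {v \<in> L2 M. l2_inner M h v = 0}" (is "closed_subspace M ?O")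
  unfolding closed_subspace_def
proof (intro conjI equalityI)
  show "cfun.subspace ?O"
    using h by (auto simp: cfun.subspace_def l2_inner_add_right l2_inner_cmult_right)
  show "?O \<subseteq> l2_closure M ?O" by (rule subset_l2_closure) auto
  show "l2_closure M ?O \<subseteq> ?O"
  proof
    fix f assume f: "f \<in> l2_closure M ?O"
    then have fL: "f \<in> L2 M" by (simp add: l2_closure_def)
    have "cmod (l2_inner M h f) \<le> 0 + \<epsilon>" if \<epsilon>: "\<epsilon> > 0" for \<epsilon>
    proof -
      have pos: "0 < l2_norm M h + 1" by (simp add: add_nonneg_pos)
      obtain g where g: "g \<in> ?O" "l2_norm M (f - g) < \<epsilon> / (l2_norm M h + 1)"
        using l2_closureD[OF f divide_pos_pos[OF \<epsilon> pos]] by blast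
      have "l2_inner M h f = l2_inner M h (f - g)"
        using g h fL by (simp add: l2_inner_diff_right)
      also have "cmod \<dots> \<le> l2_norm M h * l2_norm M (f - g)"
        using g h fL by (intro l2_Cauchy_Schwarz) auto
      also have "\<dots> \<le> (l2_norm M h + 1) * l2_norm M (f - g)" by (simp add: mult_right_mono)
      also have "\<dots> < \<epsilon>" using g(2) pos by (simp add: field_simps)
      finally show ?thesis by simp
    qed
    then have "cmod (l2_inner M h f) \<le> 0" by (rule field_le_epsilon)
    then show "f \<in> ?O" using fL by simp
  qed
qed auto

lemma orthogonal_closed_span:
  assumes "h \<in> L2 M" "A \<subseteq> L2 M" "\<And>a. a \<in> A \<Longrightarrow> l2_inner M h a = 0" "v \<in> closed_span M A"
  shows "l2_inner M h v = 0"
  using closed_span_minimal[OF closed_subspace_orthogonal[OF assms(1)], of A] assms by auto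

lemma l2_proj:
  assumes "closed_subspace M V" "a \<in> L2 M"
  shows l2_proj_in: "l2_proj M V a \<in> V"
    and l2_proj_orthogonal: "v \<in> V \<Longrightarrow> l2_inner M (a - l2_proj M V a) v = 0"
proof -
  have "\<exists>p. p \<in> V \<and> (\<forall>v\<in>V. l2_inner M (a - p) v = 0)"
    using projection_exists[OF assms] by metis
  from someI_ex[OF this]
  have *: "l2_proj M V a \<in> V \<and> (\<forall>v\<in>V. l2_inner M (a - l2_proj M V a) v = 0)"
    unfolding l2_proj_def .
  show "l2_proj M V a \<in> V" using * by simp
  show "v \<in> V \<Longrightarrow> l2_inner M (a - l2_proj M V a) v = 0" using * by simp
qed

lemma l2_proj_L2: "closed_subspace M V \<Longrightarrow> a \<in> L2 M \<Longrightarrow> l2_proj M V a \<in> L2 M"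
  using l2_proj_in closed_subspace_L2 by blast

lemma l2_proj_pythagoras:
  assumes V: "closed_subspace M V" and a: "a \<in> L2 M" and v: "v \<in> V"
  shows "(l2_norm M (a - v))\<^sup>2 = (l2_norm M (a - l2_proj M V a))\<^sup>2 + (l2_norm M (l2_proj M V a - v))\<^sup>2"
proof -
  define p where "p = l2_proj M V a"
  have p: "p \<in> V" "p \<in> L2 M" using l2_proj_in[OF V a] l2_proj_L2[OF V a] by (auto simp: p_def)
  have "l2_inner M (a - p) (p - v) = 0"
    unfolding p_def by (rule l2_proj_orthogonal[OF V a])
      (use p v closed_subspace_diff[OF V] in \<open>auto simp: p_def\<close>)
  then show ?thesis
    using l2_norm_add_sq[of "a - p" M "p - v"] a p closed_subspace_L2[OF V v] by (auto simp flip: p_def)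
qed

lemma l2_proj_best:
  assumes "closed_subspace M V" "a \<in> L2 M" "v \<in> V"
  shows "l2_norm M (a - l2_proj M V a) \<le> l2_norm M (a - v)"
  by (rule power2_le_imp_le) (simp_all add: l2_proj_pythagoras[OF assms])

text \<open>Projections of a dense set are dense in the subspace: if \<open>d\<close> is within
  \<delta> of \<open>v\<close> in \<open>J\<close>, then the projection of \<open>d\<close> is
  within \<delta> of \<open>d\<close>, hence within 2 \<delta> of \<open>v\<close>. An inclusion of
  subspaces is thereby tested on countably many vectors when \<open>D\<close> is countable, as
  needed for statements about almost every fibre.\<close>

lemma closed_subspace_subset_via_proj:
  assumes J: "closed_subspace M J" and J': "closed_subspace M J'" and D: "D \<subseteq> L2 M"
    and dense: "\<And>f \<epsilon>. f \<in> L2 M \<Longrightarrow> \<epsilon> > 0 \<Longrightarrow> \<exists>d\<in>D. l2_norm M (f - d) < \<epsilon>"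
    and proj: "\<And>d. d \<in> D \<Longrightarrow> l2_proj M J d \<in> J'"
  shows "J \<subseteq> J'"
proof
  fix v assume v: "v \<in> J"
  then have vL: "v \<in> L2 M" using J closed_subspace_L2 by blast
  have "\<exists>g\<in>J'. l2_norm M (v - g) < \<epsilon>" if \<epsilon>: "\<epsilon> > 0" for \<epsilon>
  proof -
    obtain d where d: "d \<in> D" "l2_norm M (v - d) < \<epsilon>/2" using dense[OF vL half_gt_zero[OF \<epsilon>]] by blast
    have dL: "d \<in> L2 M" using d D by blast
    have "l2_norm M (v - l2_proj M J d) \<le> l2_norm M (v - d) + l2_norm M (d - l2_proj M J d)"
      by (intro l2_norm_triangle_diff vL dL l2_proj_L2[OF J])
    moreover have "l2_norm M (d - l2_proj M J d) \<le> l2_norm M (v - d)"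
      using l2_proj_best[OF J dL v] by (simp add: l2_norm_diff_commute)
    ultimately have "l2_norm M (v - l2_proj M J d) < \<epsilon>" using d(2) by linarith
    then show ?thesis using d proj by blast
  qed
  then have "v \<in> l2_closure M J'" using vL by (simp add: l2_closure_def)
  then show "v \<in> J'" using closed_subspaceD(3)[OF J'] by simp
qed

section \<open>Separability and restriction to a measurable set\<close>

lemma l2_separableE:
  assumes "l2_separable M"
  obtains D where "countable D" "D \<subseteq> L2 M"
    "\<And>f \<epsilon>. f \<in> L2 M \<Longrightarrow> \<epsilon> > 0 \<Longrightarrow> \<exists>d\<in>D. l2_norm M (f - d) < \<epsilon>"
proof -
  obtain D where "countable D" "D \<subseteq> L2 M" "l2_closure M D = L2 M"
    using assms by (auto simp: l2_separable_def)
  then show thesis using that[of D] l2_closureD[of _ M D] by metis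
qed

text \<open>The dense set may miss \<open>V\<close> altogether. So one point of \<open>V\<close> is
  picked near \<open>d\<close> for each pair of a dense vector \<open>d\<close> and a radius 1/(n+1)
  at which such a point exists; the pairs are countable.\<close>

lemma l2_separable_subset:
  assumes "l2_separable M" "V \<subseteq> L2 M"
  obtains A where "countable A" "A \<subseteq> V"
    "\<And>f \<epsilon>. f \<in> V \<Longrightarrow> \<epsilon> > 0 \<Longrightarrow> \<exists>a\<in>A. l2_norm M (f - a) < \<epsilon>"
proof -
  obtain D where D: "countable D" "D \<subseteq> L2 M"
    "\<And>f \<epsilon>. f \<in> L2 M \<Longrightarrow> \<epsilon> > 0 \<Longrightarrow> \<exists>d\<in>D. l2_norm M (f - d) < \<epsilon>"
    using l2_separableE[OF assms(1)] by metis
  define P where "P = {(d, n::nat). d \<in> D \<and> (\<exists>v\<in>V. l2_norm M (v - d) < inverse (real (Suc n)))}"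
  define w where "w = (\<lambda>(d, n). SOME v. v \<in> V \<and> l2_norm M (v - d) < inverse (real (Suc n)))"
  have w: "w (d, n) \<in> V \<and> l2_norm M (w (d, n) - d) < inverse (real (Suc n))" if "(d, n) \<in> P" for d n
  proof -
    have "\<exists>v. v \<in> V \<and> l2_norm M (v - d) < inverse (real (Suc n))"
      using that unfolding P_def by blast
    from someI_ex[OF this] show ?thesis unfolding w_def prod.case .
  qed
  show thesis
  proof (rule that)
    have "P \<subseteq> D \<times> UNIV" by (auto simp: P_def)
    then have "countable P" using countable_subset[OF _ countable_SIGMA[OF D(1)]] by blast
    then show "countable (w ` P)" by simp
    show "w ` P \<subseteq> V" using w by auto
    fix f \<epsilon> assume f: "f \<in> V" and \<epsilon>: "(\<epsilon>::real) > 0"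
    obtain n where n: "inverse (real (Suc n)) < \<epsilon>/2" using reals_Archimedean[of "\<epsilon>/2"] \<epsilon> by auto
    obtain d where d: "d \<in> D" "l2_norm M (f - d) < inverse (real (Suc n))"
      using D(3)[of f "inverse (real (Suc n))"] f assms(2) by auto
    then have P: "(d, n) \<in> P" using f by (auto simp: P_def)
    have "l2_norm M (f - w (d, n)) \<le> l2_norm M (f - d) + l2_norm M (d - w (d, n))"
      using f d w[OF P] assms(2) D(2) by (intro l2_norm_triangle_diff) auto
    also have "l2_norm M (d - w (d, n)) < inverse (real (Suc n))"
      using w[OF P] by (simp add: l2_norm_diff_commute)
    finally have "l2_norm M (f - w (d, n)) < \<epsilon>" using d n by linarith
    then show "\<exists>a\<in>w ` P. l2_norm M (f - a) < \<epsilon>" using P by blast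
  qed
qed

lemma L2_restrict_spaceI:
  assumes C: "C \<in> sets M" and f: "f \<in> L2 M"
  shows "f \<in> L2 (restrict_space M C)"
proof -
  have CM: "C \<inter> space M \<in> sets M" using C by auto
  have "(\<integral>\<^sup>+x. ennreal ((cmod (f x))\<^sup>2) \<partial>restrict_space M C) \<le> (\<integral>\<^sup>+x. ennreal ((cmod (f x))\<^sup>2) \<partial>M)"
    unfolding nn_integral_restrict_space[OF CM] by (intro nn_integral_mono) (auto simp: indicator_def)
  then show ?thesis
    using f le_less_trans by (fastforce simp: L2_iff_nn intro: measurable_restrict_space1)
qed

lemma l2_norm_restrict_le:
  assumes C: "C \<in> sets M" and f: "f \<in> L2 M"
  shows "l2_norm (restrict_space M C) f \<le> l2_norm M f"
proof (rule power2_le_imp_le)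
  have CM: "C \<inter> space M \<in> sets M" using C by auto
  have "ennreal ((l2_norm (restrict_space M C) f)\<^sup>2) \<le> ennreal ((l2_norm M f)\<^sup>2)"
    unfolding l2_norm_nn[OF f] l2_norm_nn[OF L2_restrict_spaceI[OF C f]] nn_integral_restrict_space[OF CM]
    by (intro nn_integral_mono) (auto simp: indicator_def)
  then show "(l2_norm (restrict_space M C) f)\<^sup>2 \<le> (l2_norm M f)\<^sup>2" by simp
qed simp

lemma L2_extend:
  assumes C: "C \<in> sets M" and f: "f \<in> L2 (restrict_space M C)"
  shows "(\<lambda>x. indicator C x * f x) \<in> L2 M"
proof -
  have CM: "C \<inter> space M \<in> sets M" using C by auto
  have "(\<lambda>x. indicator C x *\<^sub>R f x) \<in> borel_measurable M"
    using f borel_measurable_restrict_space_iff[OF CM] by (auto simp: L2_def)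
  moreover have "(\<lambda>x. indicator C x *\<^sub>R f x) = (\<lambda>x. indicator C x * f x)"
    by (auto simp: indicator_def fun_eq_iff)
  moreover have "(\<integral>\<^sup>+x. ennreal ((cmod (indicator C x * f x))\<^sup>2) \<partial>M)
      = (\<integral>\<^sup>+x. ennreal ((cmod (f x))\<^sup>2) \<partial>restrict_space M C)"
    unfolding nn_integral_restrict_space[OF CM] by (intro nn_integral_cong) (auto simp: indicator_def)
  ultimately show ?thesis using f by (simp add: L2_iff_nn)
qed

text \<open>Extension by zero embeds the functions on \<open>C\<close> into those on
  \<open>M\<close>, and restriction does not increase the norm, so a dense set over \<open>M\<close>
  remains dense over \<open>C\<close>.\<close>

lemma l2_separable_restrict:
  assumes C: "C \<in> sets M" and sep: "l2_separable M"
  shows "l2_separable (restrict_space M C)"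
proof -
  let ?N = "restrict_space M C"
  obtain D where D: "countable D" "D \<subseteq> L2 M"
    "\<And>f \<epsilon>. f \<in> L2 M \<Longrightarrow> \<epsilon> > 0 \<Longrightarrow> \<exists>d\<in>D. l2_norm M (f - d) < \<epsilon>"
    using l2_separableE[OF sep] by metis
  have DN: "D \<subseteq> L2 ?N" using D(2) L2_restrict_spaceI[OF C] by blast
  have "f \<in> l2_closure ?N D" if f: "f \<in> L2 ?N" for f
    unfolding l2_closure_def
  proof (intro CollectI conjI f allI impI)
    fix \<epsilon> :: real assume "\<epsilon> > 0"
    let ?f = "\<lambda>x. indicator C x * f x"
    obtain d where d: "d \<in> D" "l2_norm M (?f - d) < \<epsilon>"
      using D(3)[OF L2_extend[OF C f] \<open>\<epsilon> > 0\<close>] by blast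
    have "l2_norm ?N (f - d) = l2_norm ?N (?f - d)"
      unfolding l2_norm_def
      by (intro arg_cong[where f=sqrt] Bochner_Integration.integral_cong) (auto simp: space_restrict_space)
    also have "\<dots> \<le> l2_norm M (?f - d)"
      using d D(2) L2_extend[OF C f] by (intro l2_norm_restrict_le[OF C]) auto
    finally show "\<exists>d\<in>D. l2_norm ?N (f - d) < \<epsilon>" using d by (intro bexI[of _ d]) auto
  qed
  moreover have "l2_closure ?N D \<subseteq> L2 ?N" by (auto simp: l2_closure_def)
  ultimately show ?thesis
    unfolding l2_separable_def using D(1) DN by blast
qed

section \<open>The Borel structure of the norm topology\<close>

lemma space_l2_borel: "space (l2_borel M) = L2 M"
  unfolding l2_borel_def by (rule space_measure_of) (auto simp: l2_open_def)

lemma l2_open_in_sets: "l2_open M U \<Longrightarrow> U \<in> sets (l2_borel M)"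
  unfolding l2_borel_def by (subst sets_measure_of) (auto simp: l2_open_def)

lemma l2_open_ball:
  assumes "d \<in> L2 M" shows "l2_open M {f \<in> L2 M. l2_norm M (f - d) < r}"
  unfolding l2_open_def
proof (intro conjI ballI)
  fix f assume f: "f \<in> {f \<in> L2 M. l2_norm M (f - d) < r}"
  show "\<exists>\<epsilon>>0. \<forall>g\<in>L2 M. l2_norm M (g - f) < \<epsilon> \<longrightarrow> g \<in> {f \<in> L2 M. l2_norm M (f - d) < r}"
  proof (intro exI[of _ "r - l2_norm M (f - d)"] conjI ballI impI)
    fix g assume g: "g \<in> L2 M" "l2_norm M (g - f) < r - l2_norm M (f - d)"
    then show "g \<in> {f \<in> L2 M. l2_norm M (f - d) < r}"
      using l2_norm_triangle_diff[of g M f d] f assms by auto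
  qed (use f in auto)
qed auto

lemma measurable_l2_norm_diff:
  assumes G: "G \<in> m \<rightarrow>\<^sub>M l2_borel M" and d: "d \<in> L2 M"
  shows "(\<lambda>\<alpha>. l2_norm M (G \<alpha> - d)) \<in> borel_measurable m"
proof (rule borel_measurableI_less)
  fix r
  have "{\<alpha> \<in> space m. l2_norm M (G \<alpha> - d) < r} = G -` {f \<in> L2 M. l2_norm M (f - d) < r} \<inter> space m"
    using measurable_space[OF G] by (auto simp: space_l2_borel)
  also have "\<dots> \<in> sets m"
    by (rule measurable_sets[OF G l2_open_in_sets[OF l2_open_ball[OF d]]])
  finally show "{\<alpha> \<in> space m. l2_norm M (G \<alpha> - d) < r} \<in> sets m" .
qed

text \<open>By separability every open set is a countable union of balls around a dense sequence.\<close>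
lemma measurable_l2_borelI:
  assumes sep: "l2_separable M" and G: "\<And>\<alpha>. \<alpha> \<in> space m \<Longrightarrow> G \<alpha> \<in> L2 M"
    and meas: "\<And>d. d \<in> L2 M \<Longrightarrow> (\<lambda>\<alpha>. l2_norm M (G \<alpha> - d)) \<in> borel_measurable m"
  shows "G \<in> m \<rightarrow>\<^sub>M l2_borel M"
  unfolding l2_borel_def
proof (rule measurable_measure_of)
  show "{U. l2_open M U} \<subseteq> Pow (L2 M)" by (auto simp: l2_open_def)
  show "G \<in> space m \<rightarrow> L2 M" using G by blast
  obtain D where D: "countable D" "D \<subseteq> L2 M"
    "\<And>f \<epsilon>. f \<in> L2 M \<Longrightarrow> \<epsilon> > 0 \<Longrightarrow> \<exists>d\<in>D. l2_norm M (f - d) < \<epsilon>"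
    using l2_separableE[OF sep] by metis
  fix U assume "U \<in> {U. l2_open M U}"
  then have U: "l2_open M U" by simp
  define I where "I = {(d, n::nat). d \<in> D \<and> {f \<in> L2 M. l2_norm M (f - d) < inverse (real (Suc n))} \<subseteq> U}"
  have "\<exists>(d, n)\<in>I. l2_norm M (f - d) < inverse (real (Suc n))" if f: "f \<in> U" for f
  proof -
    have fL: "f \<in> L2 M" using U f by (auto simp: l2_open_def)
    obtain \<epsilon> where \<epsilon>: "\<epsilon> > 0" "\<And>g. g \<in> L2 M \<Longrightarrow> l2_norm M (g - f) < \<epsilon> \<Longrightarrow> g \<in> U"
      using U f unfolding l2_open_def by blast
    obtain n where n: "inverse (real (Suc n)) < \<epsilon>/2" using reals_Archimedean[of "\<epsilon>/2"] \<epsilon>(1) by auto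
    obtain d where d: "d \<in> D" "l2_norm M (f - d) < inverse (real (Suc n))"
      using D(3)[OF fL, of "inverse (real (Suc n))"] by auto
    have "(d, n) \<in> I"
      unfolding I_def
    proof (intro CollectI case_prodI conjI d subsetI)
      fix g assume g: "g \<in> {f \<in> L2 M. l2_norm M (f - d) < inverse (real (Suc n))}"
      have "l2_norm M (g - f) \<le> l2_norm M (g - d) + l2_norm M (d - f)"
        using g d D(2) fL by (intro l2_norm_triangle_diff) auto
      then have "l2_norm M (g - f) < \<epsilon>"
        using g d n by (simp add: l2_norm_diff_commute[of M d f])
      then show "g \<in> U" using \<epsilon>(2) g by blast
    qed
    then show ?thesis using d by blast
  qed
  then have "G -` U \<inter> space m = (\<Union>(d, n)\<in>I. {\<alpha> \<in> space m. l2_norm M (G \<alpha> - d) < inverse (real (Suc n))})"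
    using G by (fastforce simp: I_def)
  also have "\<dots> \<in> sets m"
  proof (rule sets.countable_UN'')
    have "I \<subseteq> D \<times> UNIV" by (auto simp: I_def)
    then show "countable I" using countable_subset[OF _ countable_SIGMA[OF D(1)]] by blast
    show "(case i of (d, n) \<Rightarrow> {\<alpha> \<in> space m. l2_norm M (G \<alpha> - d) < inverse (real (Suc n))}) \<in> sets m"
      if "i \<in> I" for i
    proof -
      obtain d n where i: "i = (d, n)" by force
      then have [measurable]: "(\<lambda>\<alpha>. l2_norm M (G \<alpha> - d)) \<in> borel_measurable m"
        using that D(2) by (intro meas) (auto simp: I_def)
      show ?thesis unfolding i prod.case by measurable
    qed
  qed
  finally show "G -` U \<inter> space m \<in> sets m" .
qed

section \<open>Linear combinations with coefficients in a dense set\<close>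

text \<open>A list is a formal combination, independent of the vectors: the same list can be
  evaluated on the family of every fibre, and the lists over countable sets of coefficients and
  indices are countable.\<close>

definition lincomb :: "('i \<Rightarrow> 'x \<Rightarrow> complex) \<Rightarrow> (complex \<times> 'i) list \<Rightarrow> 'x \<Rightarrow> complex" where
  "lincomb F ps = (\<lambda>x. \<Sum>(c, i)\<leftarrow>ps. c * F i x)"

lemma lincomb_Nil: "lincomb F [] = 0"
  by (rule ext) (simp add: lincomb_def)

lemma lincomb_Cons: "lincomb F ((c, i) # ps) = (\<lambda>x. c * F i x) + lincomb F ps"
  by (rule ext) (simp add: lincomb_def)

lemma lincomb_append: "lincomb F (ps @ qs) = lincomb F ps + lincomb F qs"
  by (rule ext) (simp add: lincomb_def)

lemma lincomb_scale: "lincomb F (map (apfst ((*) c)) ps) = (\<lambda>x. c * lincomb F ps x)"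
proof
  show "lincomb F (map (apfst ((*) c)) ps) x = c * lincomb F ps x" for x
    unfolding lincomb_def by (induction ps) (auto simp: distrib_left mult.assoc)
qed

lemma lincomb_in_span: "xs \<in> lists (UNIV \<times> A) \<Longrightarrow> lincomb F xs \<in> cfun.span (F ` A)"
proof (induction xs rule: list.induct)
  case Nil
  then show ?case unfolding lincomb_Nil by (rule_tac cfun.span_zero)
next
  case (Cons p xs)
  obtain c i where p: "p = (c, i)" by force
  have "(\<lambda>x. c * F i x) \<in> cfun.span (F ` A)"
    using Cons p by (intro cfun.span_scale cfun.span_base) auto
  moreover have "lincomb F xs \<in> cfun.span (F ` A)" using Cons by auto
  ultimately show ?case unfolding p lincomb_Cons by (rule cfun.span_add)
qed

lemma span_imp_lincomb:
  assumes "f \<in> cfun.span (F ` A)" shows "\<exists>xs\<in>lists (UNIV \<times> A). f = lincomb F xs"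
proof -
  have "cfun.span (F ` A) \<subseteq> lincomb F ` lists (UNIV \<times> A)"
  proof (rule cfun.span_minimal)
    show "F ` A \<subseteq> lincomb F ` lists (UNIV \<times> A)"
    proof
      fix g assume "g \<in> F ` A"
      then obtain i where "i \<in> A" "g = F i" by blast
      then have "g = lincomb F [(1, i)]" "[(1, i)] \<in> lists (UNIV \<times> A)"
        by (auto simp: lincomb_def fun_eq_iff)
      then show "g \<in> lincomb F ` lists (UNIV \<times> A)" by blast
    qed
    show "cfun.subspace (lincomb F ` lists (UNIV \<times> A))"
      unfolding cfun.subspace_def
    proof (intro conjI allI ballI)
      show "0 \<in> lincomb F ` lists (UNIV \<times> A)" by (rule image_eqI[of _ _ "[]"]) (simp_all only: lincomb_Nil lists.Nil)
      fix g assume "g \<in> lincomb F ` lists (UNIV \<times> A)"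
      then obtain xs where xs: "xs \<in> lists (UNIV \<times> A)" "g = lincomb F xs" by blast
      show "(\<lambda>x. c * g x) \<in> lincomb F ` lists (UNIV \<times> A)" for c
        by (rule image_eqI[of _ _ "map (apfst ((*) c)) xs"])
          (use xs in \<open>auto simp: lincomb_scale in_lists_conv_set\<close>)
      fix h assume "h \<in> lincomb F ` lists (UNIV \<times> A)"
      then obtain ys where ys: "ys \<in> lists (UNIV \<times> A)" "h = lincomb F ys" by blast
      show "g + h \<in> lincomb F ` lists (UNIV \<times> A)"
        by (rule image_eqI[of _ _ "xs @ ys"]) (use xs ys in \<open>auto simp: lincomb_append\<close>)
    qed
  qed
  then show ?thesis using assms by blast
qed

lemma lincomb_L2:
  assumes "\<And>i. i \<in> A \<Longrightarrow> F i \<in> L2 M" "xs \<in> lists (UNIV \<times> A)" shows "lincomb F xs \<in> L2 M"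
  using lincomb_in_span[OF assms(2), of F] span_subset_L2[of "F ` A" M] assms(1) by blast

lemma lincomb_approx:
  assumes F: "\<And>i. i \<in> A \<Longrightarrow> F i \<in> L2 M" and xs: "xs \<in> lists (UNIV \<times> A)" and \<epsilon>: "\<epsilon> > 0"
    and Q: "\<And>z e. e > 0 \<Longrightarrow> \<exists>q\<in>Q. cmod (z - q) < e"
  shows "\<exists>ys\<in>lists (Q \<times> A). l2_norm M (lincomb F xs - lincomb F ys) < \<epsilon>"
  using xs \<epsilon>
proof (induction xs arbitrary: \<epsilon> rule: list.induct)
  case Nil
  then show ?case by (intro bexI[of _ "[]"]) (simp_all only: lincomb_Nil diff_0_right l2_norm_zero lists.Nil)
next
  case (Cons p xs)
  obtain c i where p: "p = (c, i)" by force
  with Cons have i: "i \<in> A" and xs: "xs \<in> lists (UNIV \<times> A)" by auto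
  obtain ys where ys: "ys \<in> lists (Q \<times> A)" "l2_norm M (lincomb F xs - lincomb F ys) < \<epsilon>/2"
    using Cons.IH[OF xs half_gt_zero[OF Cons.prems(2)]] by blast
  have pos: "0 < l2_norm M (F i) + 1" by (simp add: add_nonneg_pos)
  obtain q where q: "q \<in> Q" "cmod (c - q) < \<epsilon>/2 / (l2_norm M (F i) + 1)"
    using Q[of "\<epsilon>/2 / (l2_norm M (F i) + 1)" c] Cons.prems(2) pos by auto
  have yL: "ys \<in> lists (UNIV \<times> A)" using ys(1) by (auto simp: in_lists_conv_set)
  have eq: "lincomb F (p # xs) - lincomb F ((q, i) # ys)
      = (\<lambda>x. (c - q) * F i x) + (lincomb F xs - lincomb F ys)"
    unfolding p lincomb_Cons by (auto simp: fun_eq_iff algebra_simps)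
  have "l2_norm M (lincomb F (p # xs) - lincomb F ((q, i) # ys))
      \<le> l2_norm M (\<lambda>x. (c - q) * F i x) + l2_norm M (lincomb F xs - lincomb F ys)"
    unfolding eq
    by (intro l2_norm_triangle L2_cmult L2_diff F i lincomb_L2[OF F xs] lincomb_L2[OF F yL])
  also have "l2_norm M (\<lambda>x. (c - q) * F i x) = cmod (c - q) * l2_norm M (F i)"
    by (rule l2_norm_cmult)
  also have "\<dots> \<le> cmod (c - q) * (l2_norm M (F i) + 1)" by (intro mult_left_mono) auto
  also have "\<dots> < \<epsilon>/2" using q(2) pos by (simp add: field_simps)
  finally have "l2_norm M (lincomb F (p # xs) - lincomb F ((q, i) # ys)) < \<epsilon>" using ys(2) by linarith
  moreover have "(q, i) # ys \<in> lists (Q \<times> A)" using q(1) i ys(1) by simp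
  ultimately show ?case by blast
qed

text \<open>An infimum lies strictly below \<open>r\<close> exactly when one competitor does. For
  countable \<open>Q\<close> and \<open>A\<close> this turns sublevel sets of the distance to a
  varying closed span into countable unions, the source of measurability later.\<close>

lemma dist_closed_span_less_iff:
  assumes F: "\<And>i. i \<in> A \<Longrightarrow> F i \<in> L2 M" and a: "a \<in> L2 M"
    and Q: "\<And>z e. e > 0 \<Longrightarrow> \<exists>q\<in>Q. cmod (z - q) < e"
  shows "l2_norm M (a - l2_proj M (closed_span M (F ` A)) a) < r \<longleftrightarrow>
    (\<exists>ys\<in>lists (Q \<times> A). l2_norm M (a - lincomb F ys) < r)"
proof
  let ?J = "closed_span M (F ` A)"
  have FA: "F ` A \<subseteq> L2 M" using F by blast
  have J: "closed_subspace M ?J" by (rule closed_subspace_closed_span[OF FA])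
  show "l2_norm M (a - l2_proj M ?J a) < r" if ex: "\<exists>ys\<in>lists (Q \<times> A). l2_norm M (a - lincomb F ys) < r"
  proof -
    obtain ys where ys: "ys \<in> lists (Q \<times> A)" "l2_norm M (a - lincomb F ys) < r" using ex by (rule bexE)
    have "ys \<in> lists (UNIV \<times> A)" using ys(1) by (auto simp: in_lists_conv_set)
    then have "lincomb F ys \<in> ?J"
      unfolding closed_span_def
      by (intro subsetD[OF subset_l2_closure[OF span_subset_L2[OF FA]]] lincomb_in_span)
    then show "l2_norm M (a - l2_proj M ?J a) < r"
      by (rule le_less_trans[OF l2_proj_best[OF J a] ys(2)])
  qed
  show "\<exists>ys\<in>lists (Q \<times> A). l2_norm M (a - lincomb F ys) < r" if "l2_norm M (a - l2_proj M ?J a) < r"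
  proof -
    define p where "p = l2_proj M ?J a"
    \<comment> \<open>The slack below \<open>r\<close> is spent in two halves: on replacing the
      projection by an element of the span, and on moving the coefficients into
      \<open>Q\<close>.\<close>
    define e where "e = r - l2_norm M (a - p)"
    have \<epsilon>: "e > 0" using that by (simp add: p_def e_def)
    have p: "p \<in> ?J" "p \<in> L2 M" using l2_proj_in[OF J a] l2_proj_L2[OF J a] by (auto simp: p_def)
    obtain s where s: "s \<in> cfun.span (F ` A)" "l2_norm M (p - s) < e/2"
      using l2_closureD[OF p(1)[unfolded closed_span_def] half_gt_zero[OF \<epsilon>]] by blast
    obtain xs where xs: "xs \<in> lists (UNIV \<times> A)" "s = lincomb F xs"
      using span_imp_lincomb[OF s(1)] by blast
    obtain ys where ys: "ys \<in> lists (Q \<times> A)" "l2_norm M (lincomb F xs - lincomb F ys) < e/2"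
      using lincomb_approx[of A F M xs "e/2" Q] F xs(1) half_gt_zero[OF \<epsilon>] Q by blast
    have yL: "ys \<in> lists (UNIV \<times> A)" using ys(1) by (auto simp: in_lists_conv_set)
    note L = lincomb_L2[OF F xs(1)] lincomb_L2[OF F yL]
    have "l2_norm M (a - lincomb F ys) \<le> l2_norm M (a - p) + l2_norm M (p - lincomb F ys)"
      by (intro l2_norm_triangle_diff a p L)
    moreover have "l2_norm M (p - lincomb F ys) \<le> l2_norm M (p - s) + l2_norm M (s - lincomb F ys)"
      unfolding xs by (intro l2_norm_triangle_diff a p L)
    ultimately have "l2_norm M (a - lincomb F ys) < r"
      using s(2) ys(2) unfolding xs(2) using e_def by linarith
    then show ?thesis using ys(1) by (rule bexI)
  qed
qed

section \<open>Characters of a discrete abelian group\<close>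

text \<open>Parametrizes the cyclic subgroup generated by \<open>g\<close>, along which characters
  are extended one element at a time.\<close>

definition zmul :: "int \<Rightarrow> 'g::ab_group_add \<Rightarrow> 'g" where
  "zmul k g = (if 0 \<le> k then ((+) g ^^ nat k) 0 else - (((+) g ^^ nat (- k)) 0))"

lemma zmul_0 [simp]: "zmul 0 g = 0"
  by (simp add: zmul_def)

lemma zmul_succ: "zmul (k + 1) g = zmul k g + g"
proof (cases "k \<ge> 0")
  case True
  then have "nat (k + 1) = Suc (nat k)" by simp
  then show ?thesis using True by (simp add: zmul_def add.commute)
next
  case False
  then have eq: "nat (- k) = Suc (nat (- (k + 1)))" by simp
  have "zmul (k + 1) g = - (((+) g ^^ nat (- (k + 1))) 0)"
    using False by (cases "k = -1") (auto simp: zmul_def)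
  moreover have "zmul k g = - (g + ((+) g ^^ nat (- (k + 1))) 0)"
    using False eq by (simp add: zmul_def)
  ultimately show ?thesis by simp
qed

lemma zmul_pred: "zmul (k - 1) g = zmul k g - g"
  using zmul_succ[of "k - 1" g] by simp

lemma zmul_1 [simp]: "zmul 1 g = g"
  using zmul_succ[of 0 g] by simp

lemma zmul_add: "zmul (k + l) g = zmul k g + zmul l g"
proof (induction k rule: int_induct[where k=0])
  case (step1 i)
  then show ?case using zmul_succ[of "i + l" g] zmul_succ[of i g] by (simp add: algebra_simps)
next
  case (step2 i)
  have "i - 1 + l = (i + l) - 1" by simp
  then show ?case unfolding \<open>i - 1 + l = (i + l) - 1\<close> zmul_pred step2(2) by (simp add: algebra_simps)
qed simp

lemma zmul_uminus: "zmul (- k) g = - zmul k g"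
  using zmul_add[of k "- k" g] by (simp add: eq_neg_iff_add_eq_0 add.commute)

text \<open>Division with remainder by the least positive element. The trivial subgroup is covered
  by d = 0, which divides only 0.\<close>

lemma int_subgroup_dvd:
  fixes S :: "int set"
  assumes 0: "0 \<in> S" and diff: "\<And>k l. k \<in> S \<Longrightarrow> l \<in> S \<Longrightarrow> k - l \<in> S"
  shows "\<exists>d::nat. \<forall>k. k \<in> S \<longleftrightarrow> int d dvd k"
proof (cases "\<exists>n>0. int n \<in> S")
  case False
  have "k \<in> S \<longleftrightarrow> k = 0" for k
  proof
    assume k: "k \<in> S"
    then have "- k \<in> S" using diff[OF 0] by fastforce
    then show "k = 0"
      using False k by (cases "k > 0"; cases "k < 0") (auto dest: spec[of _ "nat k"] spec[of _ "nat (- k)"])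
  qed (use 0 in simp)
  then show ?thesis by (intro exI[of _ 0]) simp
next
  case True
  define d where "d = (LEAST n. n > 0 \<and> int n \<in> S)"
  have d: "d > 0" "int d \<in> S" using LeastI_ex[OF True] by (auto simp: d_def)
  have least: "d \<le> n" if "n > 0" "int n \<in> S" for n
    unfolding d_def using that by (intro Least_le) auto
  have add: "k + l \<in> S" if "k \<in> S" "l \<in> S" for k l
    using diff[OF that(1) diff[OF 0 that(2)]] by simp
  have mult: "int d * q \<in> S" for q
  proof (induction q rule: int_induct[where k=0])
    case (step1 i)
    then show ?case using add[of "int d * i" "int d"] d(2) by (simp add: algebra_simps)
  next
    case (step2 i)
    then show ?case using diff[of "int d * i" "int d"] d(2) by (simp add: algebra_simps)
  qed (use 0 in simp)
  have "k \<in> S \<longleftrightarrow> int d dvd k" for k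
  proof
    assume k: "k \<in> S"
    have r: "k mod int d \<in> S"
      using diff[OF k mult[of "k div int d"]] by (simp add: minus_mult_div_eq_mod)
    have "k mod int d \<ge> 0" "k mod int d < int d" using d by auto
    then have "k mod int d = 0"
      using least[of "nat (k mod int d)"] r by (cases "k mod int d = 0") auto
    then show "int d dvd k" by auto
  qed (use mult in \<open>auto simp: dvd_def\<close>)
  then show ?thesis by blast
qed

section \<open>Extending characters from subgroups\<close>

text \<open>Graphs of characters of subgroups.\<close>
definition partial_character :: "('g::ab_group_add \<times> complex) set \<Rightarrow> bool" where
  "partial_character G \<longleftrightarrow> (0, 1) \<in> G \<and>
     (\<forall>a w b v. (a, w) \<in> G \<longrightarrow> (b, v) \<in> G \<longrightarrow> (a + b, w * v) \<in> G) \<and>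
     (\<forall>a w. (a, w) \<in> G \<longrightarrow> (- a, inverse w) \<in> G) \<and>
     (\<forall>a w. (a, w) \<in> G \<longrightarrow> cmod w = 1) \<and> (\<forall>w. (0, w) \<in> G \<longrightarrow> w = 1)"

lemma partial_characterD:
  assumes "partial_character G"
  shows "(0, 1) \<in> G" "(a, w) \<in> G \<Longrightarrow> (b, v) \<in> G \<Longrightarrow> (a + b, w * v) \<in> G"
    "(a, w) \<in> G \<Longrightarrow> (- a, inverse w) \<in> G" "(a, w) \<in> G \<Longrightarrow> cmod w = 1" "(0, w) \<in> G \<Longrightarrow> w = 1"
  using assms unfolding partial_character_def by blast+

lemma partial_character_unique:
  assumes G: "partial_character G" and "(a, w) \<in> G" "(a, v) \<in> G" shows "w = v"
proof -
  have "(a + - a, w * inverse v) \<in> G"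
    by (intro partial_characterD(2,3)[OF G] assms)
  then have "w * inverse v = 1" using partial_characterD(5)[OF G] by simp
  moreover have "v \<noteq> 0" using partial_characterD(4)[OF G assms(3)] by auto
  ultimately show ?thesis by (simp add: field_simps)
qed

text \<open>The new graph is that of the subgroup generated by the old domain and \<open>g\<close>.
  An element may be written as \<open>a + zmul k g\<close> in several ways; \<open>comp\<close>
  makes the values agree. Since the graph is a subgroup, single-valuedness has to be checked only
  above 0.\<close>

lemma partial_character_extend:
  assumes G: "partial_character G" and z: "cmod z = 1"
    and comp: "\<And>k w. (zmul k g, w) \<in> G \<Longrightarrow> w = z powi k"
  defines "H \<equiv> {(a + zmul k g, w * z powi k) | a w k. (a, w) \<in> G}"
  shows "partial_character H" "G \<subseteq> H" "(g, z) \<in> H"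
proof -
  have z0: "z \<noteq> 0" using z by auto
  have I: "(a + zmul k g, w * z powi k) \<in> H" if "(a, w) \<in> G" for a w k
    using that unfolding H_def by blast
  show GH: "G \<subseteq> H"
  proof
    fix p assume "p \<in> G"
    then show "p \<in> H" using I[of "fst p" "snd p" 0] by simp
  qed
  show "(g, z) \<in> H" using I[OF partial_characterD(1)[OF G], of 1] by simp
  show "partial_character H"
    unfolding partial_character_def
  proof (intro conjI allI impI)
    show "(0, 1) \<in> H" using GH partial_characterD(1)[OF G] by blast
  next
    fix a w b v assume "(a, w) \<in> H" "(b, v) \<in> H"
    then obtain a' w' k b' v' l where
      "a = a' + zmul k g" "w = w' * z powi k" "(a', w') \<in> G"
      "b = b' + zmul l g" "v = v' * z powi l" "(b', v') \<in> G"
      unfolding H_def by blast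
    then show "(a + b, w * v) \<in> H"
      using I[OF partial_characterD(2)[OF G], of a' w' b' v' "k + l"] z0
      by (simp add: zmul_add power_int_add algebra_simps)
  next
    fix a w assume "(a, w) \<in> H"
    then obtain a' w' k where aw: "a = a' + zmul k g" "w = w' * z powi k" "(a', w') \<in> G"
      unfolding H_def by blast
    then show "(- a, inverse w) \<in> H"
      using I[OF partial_characterD(3)[OF G aw(3)], of "- k"]
      by (simp add: zmul_uminus power_int_minus)
    show "cmod w = 1" using partial_characterD(4)[OF G aw(3)] aw(2) z
      by (simp add: norm_mult norm_power_int)
  next
    fix w assume "(0, w) \<in> H"
    then obtain a' w' k where aw: "0 = a' + zmul k g" "w = w' * z powi k" "(a', w') \<in> G"
      unfolding H_def by blast
    then have "a' = zmul (- k) g" by (simp add: zmul_uminus eq_neg_iff_add_eq_0)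
    then have "w' = z powi (- k)" using comp aw(3) by blast
    then show "w = 1" using aw(2) z0 by (simp add: power_int_minus)
  qed
qed

lemma partial_character_zmul:
  assumes G: "partial_character G" and "(a, w) \<in> G" shows "(zmul k a, w powi k) \<in> G"
proof -
  have w0: "w \<noteq> 0" using partial_characterD(4)[OF G assms(2)] by auto
  show ?thesis
  proof (induction k rule: int_induct[where k=0])
    case base
    then show ?case using partial_characterD(1)[OF G] by simp
  next
    case (step1 i)
    then show ?case
      using partial_characterD(2)[OF G step1(2) assms(2)] w0 by (simp add: zmul_succ power_int_add)
  next
    case (step2 i)
    have "w powi (i - 1) = w powi i * inverse w"
      using w0 by (simp add: power_int_diff field_simps)
    then show ?case
      using partial_characterD(2)[OF G step2(2) partial_characterD(3)[OF G assms(2)]]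
      by (simp add: zmul_pred)
  qed
qed

lemma zmul_zmul: "zmul k (zmul l g) = zmul (l * k) g"
proof (induction k rule: int_induct[where k=0])
  case (step1 i)
  then show ?case by (simp add: zmul_succ zmul_add distrib_left)
next
  case (step2 i)
  have "zmul (l * (i - 1)) g = zmul (l * i + - l) g" by (simp add: algebra_simps)
  also have "\<dots> = zmul (l * i) g - zmul l g" unfolding zmul_add zmul_uminus by simp
  finally show ?case using step2 by (simp add: zmul_pred)
qed simp

lemma unit_complex_root:
  assumes "cmod u = 1" "n > 0" obtains z where "cmod z = 1" "z ^ n = u"
proof
  have u: "u = cis (Arg u)"
    using assms by (metis cis_Arg complex_sgn_def div_by_1 norm_zero of_real_1 scaleR_one inverse_1 zero_neq_one)
  have "cis (Arg u / real n) ^ n = cis (real n * (Arg u / real n))" by (rule Complex.DeMoivre)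
  also have "\<dots> = u" using assms u by simp
  finally show "cis (Arg u / real n) ^ n = u" .
qed simp

text \<open>Divisibility of the circle. The exponents k with k g in the domain are the multiples of
  some d, so it is enough that z is a d-th root of the value prescribed at d g. If d = 0, only k = 0
  imposes a condition and z = 1 will do.\<close>

lemma partial_character_compatible_value:
  assumes G: "partial_character G"
  obtains z where "cmod z = 1" "\<And>k w. (zmul k g, w) \<in> G \<Longrightarrow> w = z powi k"
proof -
  define S where "S = {k. \<exists>w. (zmul k g, w) \<in> G}"
  have "0 \<in> S" using partial_characterD(1)[OF G] by (auto simp: S_def)
  moreover have "k - l \<in> S" if "k \<in> S" "l \<in> S" for k l
  proof -
    obtain w v where "(zmul k g, w) \<in> G" "(zmul l g, v) \<in> G" using \<open>k \<in> S\<close> \<open>l \<in> S\<close> by (auto simp: S_def)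
    then have "(zmul k g + - zmul l g, w * inverse v) \<in> G"
      by (intro partial_characterD(2,3)[OF G])
    moreover have "zmul (k - l) g = zmul k g + - zmul l g"
      using zmul_add[of k "- l" g] by (simp add: zmul_uminus)
    ultimately show ?thesis by (auto simp: S_def)
  qed
  ultimately obtain d where d: "\<And>k. k \<in> S \<longleftrightarrow> int d dvd k"
    using int_subgroup_dvd[of S] by blast
  show thesis
  proof (cases "d = 0")
    case True
    show thesis
    proof (rule that[of 1])
      fix k w assume kw: "(zmul k g, w) \<in> G"
      then have "k = 0" using d[of k] True by (auto simp: S_def)
      then show "w = 1 powi k" using kw partial_characterD(5)[OF G] by simp
    qed simp
  next
    case False
    obtain u where u: "(zmul (int d) g, u) \<in> G" using d[of "int d"] by (auto simp: S_def)
    obtain z where z: "cmod z = 1" "z ^ d = u"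
      using unit_complex_root[OF partial_characterD(4)[OF G u]] False by blast
    show thesis
    proof (rule that[OF z(1)])
      fix k w assume kw: "(zmul k g, w) \<in> G"
      then obtain q where q: "k = int d * q" using d[of k] by (auto simp: S_def dvd_def)
      have "(zmul k g, u powi q) \<in> G"
        using partial_character_zmul[OF G u, of q] by (simp add: zmul_zmul q)
      then have "w = u powi q" by (rule partial_character_unique[OF G kw])
      then show "w = z powi k" by (simp add: q power_int_mult flip: z(2))
    qed
  qed
qed

text \<open>Zorn's lemma: a maximal partial character is total, because it could otherwise be
  extended to one more element.\<close>

lemma partial_character_total_extension:
  assumes G: "partial_character G"
  obtains \<xi> where "\<xi> \<in> characters" "\<And>a w. (a, w) \<in> G \<Longrightarrow> \<xi> a = w"
proof -
  define \<A> where "\<A> = {H. partial_character H \<and> G \<subseteq> H}"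
  have "\<exists>M\<in>\<A>. \<forall>X\<in>\<A>. M \<subseteq> X \<longrightarrow> X = M"
  proof (rule subset_Zorn_nonempty)
    show "\<A> \<noteq> {}" using G by (auto simp: \<A>_def)
    fix \<C> assume ne: "\<C> \<noteq> {}" and ch: "subset.chain \<A> \<C>"
    have CA: "\<And>H. H \<in> \<C> \<Longrightarrow> partial_character H \<and> G \<subseteq> H"
      using ch by (auto simp: subset.chain_def \<A>_def)
    have dir: "\<exists>H\<in>\<C>. p \<in> H \<and> q \<in> H" if pq: "p \<in> \<Union>\<C>" "q \<in> \<Union>\<C>" for p q
    proof -
      obtain H K where HK: "H \<in> \<C>" "p \<in> H" "K \<in> \<C>" "q \<in> K" using pq by blast
      then have "H \<subseteq> K \<or> K \<subseteq> H" using ch unfolding subset.chain_def by blast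
      then show ?thesis using HK by blast
    qed
    have "partial_character (\<Union>\<C>)"
      unfolding partial_character_def
    proof (intro conjI allI impI)
      show "(0, 1) \<in> \<Union>\<C>" using ne CA partial_characterD(1) by blast
    next
      fix a w b v assume "(a, w) \<in> \<Union>\<C>" "(b, v) \<in> \<Union>\<C>"
      then obtain H where "H \<in> \<C>" "(a, w) \<in> H" "(b, v) \<in> H" using dir by blast
      then show "(a + b, w * v) \<in> \<Union>\<C>" using CA partial_characterD(2) by blast
    next
      fix a w assume "(a, w) \<in> \<Union>\<C>"
      then show "(- a, inverse w) \<in> \<Union>\<C>" using CA partial_characterD(3) by blast
    next
      fix a w assume "(a, w) \<in> \<Union>\<C>"
      then show "cmod w = 1" using CA partial_characterD(4) by blast
    next
      fix w assume "(0, w) \<in> \<Union>\<C>"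
      then show "w = 1" using CA partial_characterD(5) by blast
    qed
    moreover have "G \<subseteq> \<Union>\<C>" using ne CA by blast
    ultimately show "\<Union>\<C> \<in> \<A>" by (simp add: \<A>_def)
  qed
  then obtain M where "M \<in> \<A>" and max': "\<forall>X\<in>\<A>. M \<subseteq> X \<longrightarrow> X = M"
    by (rule bexE)
  then have M: "partial_character M" "G \<subseteq> M" by (auto simp: \<A>_def)
  have max: "X = M" if "partial_character X" "G \<subseteq> X" "M \<subseteq> X" for X
    using max' that by (simp add: \<A>_def)
  have total: "\<exists>w. (a, w) \<in> M" for a
  proof -
    obtain z where z: "cmod z = 1" "\<And>k w. (zmul k a, w) \<in> M \<Longrightarrow> w = z powi k"
      using partial_character_compatible_value[OF M(1)] by blast
    note ext = partial_character_extend[OF M(1) z(1), of a, OF z(2)]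
    have "(a, z) \<in> M" using max[OF ext(1)] ext(2,3) M(2) by blast
    then show ?thesis by blast
  qed
  define \<xi> where "\<xi> a = (SOME w. (a, w) \<in> M)" for a
  have mem: "(a, \<xi> a) \<in> M" for a
    unfolding \<xi>_def by (rule someI_ex[OF total])
  note uniq = partial_character_unique[OF M(1)]
  have "\<xi> \<in> characters"
    unfolding characters_def
    using uniq[OF mem partial_characterD(2)[OF M(1) mem mem]] partial_characterD(4)[OF M(1) mem] by auto
  moreover have "\<xi> a = w" if "(a, w) \<in> G" for a w
    using uniq[OF mem, of a w] that M(2) by blast
  ultimately show thesis by (rule that)
qed

theorem characters_separate:
  assumes g: "(g::'g::ab_group_add) \<noteq> 0"
  obtains \<xi> where "\<xi> \<in> characters" "\<xi> g \<noteq> 1"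
proof -
  have G: "partial_character {(0::'g, 1::complex)}" by (auto simp: partial_character_def)
  have "0 \<in> {k. zmul k g = 0}" by simp
  moreover have "k - l \<in> {k. zmul k g = 0}" if "k \<in> {k. zmul k g = 0}" "l \<in> {k. zmul k g = 0}" for k l
    using that zmul_add[of k "- l" g] by (simp add: zmul_uminus)
  ultimately obtain d where d: "\<And>k. k \<in> {k. zmul k g = 0} \<longleftrightarrow> int d dvd k"
    using int_subgroup_dvd[of "{k. zmul k g = 0}"] by blast
  have d1: "d \<noteq> 1" using d[of 1] g by auto
  \<comment> \<open>Here \<open>d\<close> is the order of \<open>g\<close>, with 0 standing for
    infinite order. A d-th root of unity other than 1 is wanted; it exists since d \<noteq> 1. For
    infinite order any unit complex number is compatible, and -1 is taken.\<close>
  obtain z where z: "cmod z = 1" "z ^ d = 1" "z \<noteq> 1"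
  proof (cases "d = 0")
    case False
    have "cis (2 * pi / real d) \<noteq> 1"
    proof
      assume "cis (2 * pi / real d) = 1"
      then have "cos (2 * pi / real d) = 1" by (simp add: complex_eq_iff)
      then obtain n :: int where "2 * pi / real d = real_of_int n * 2 * pi" using cos_one_2pi_int by blast
      then have "1 = real_of_int n * real d" using False by (simp add: field_simps)
      then have "1 = n * int d" by (metis of_int_1 of_int_eq_iff of_int_mult of_int_of_nat_eq)
      then show False using d1 by (metis dvd_triv_right int_dvd_int_iff nat_dvd_1_iff_1 of_nat_1)
    qed
    moreover have "cis (2 * pi / real d) ^ d = 1" using False by (simp add: Complex.DeMoivre)
    ultimately show thesis by (intro that[of "cis (2 * pi / real d)"]) auto
  qed (auto intro: that[of "-1"])
  have "w = z powi k" if kw: "(zmul k g, w) \<in> {(0, 1)}" for k w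
  proof -
    obtain q where "k = int d * q" using kw d[of k] by (auto simp: dvd_def)
    then show ?thesis using kw z(2) by (simp add: power_int_mult)
  qed
  from partial_character_extend[OF G z(1), of g, OF this]
  obtain H where H: "partial_character H" "(g, z) \<in> H" by blast
  obtain \<xi> where \<xi>: "\<xi> \<in> characters" "\<And>a w. (a, w) \<in> H \<Longrightarrow> \<xi> a = w"
    using partial_character_total_extension[OF H(1)] by blast
  show thesis by (rule that[OF \<xi>(1)]) (use \<xi>(2)[OF H(2)] z(3) in simp)
qed

section \<open>Fourier analysis on the dual group\<close>

lemma characterD:
  assumes "\<alpha> \<in> characters"
  shows character_add: "\<alpha> (a + b) = \<alpha> a * \<alpha> b" and character_norm: "cmod (\<alpha> a) = 1"
    and character_zero: "\<alpha> 0 = 1" and character_uminus: "\<alpha> (- a) = cnj (\<alpha> a)"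
    and character_cnj_mult: "cnj (\<alpha> a) * \<alpha> a = 1"
proof -
  show add: "\<alpha> (a + b) = \<alpha> a * \<alpha> b" and norm: "cmod (\<alpha> a) = 1" for a b
    using assms by (auto simp: characters_def)
  have "\<alpha> 0 \<noteq> 0" using norm[of 0] by auto
  then show zero: "\<alpha> 0 = 1" using add[of 0 0] by simp
  show cm: "cnj (\<alpha> a) * \<alpha> a = 1"
    using norm[of a] complex_norm_square[of "\<alpha> a"] by (simp add: mult.commute)
  have "\<alpha> a * \<alpha> (- a) = 1" using add[of a "- a"] zero by simp
  then have "cnj (\<alpha> a) * \<alpha> a * \<alpha> (- a) = cnj (\<alpha> a)" by (simp add: mult.assoc)
  then show "\<alpha> (- a) = cnj (\<alpha> a)" using cm by simp
qed

lemma continuous_on_eval: "continuous_on S (\<lambda>\<alpha>::'a \<Rightarrow> 'b::topological_space. \<alpha> a)"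
  by (rule continuous_on_subset[OF continuous_on_product_coordinates subset_UNIV])

text \<open>Tychonoff: the characters form a closed subset of a product of circles.\<close>

lemma compact_characters: "compact (characters :: ('g::{ab_group_add,countable} \<Rightarrow> complex) set)"
proof -
  have "compactin (product_topology (\<lambda>_. euclidean) UNIV) (Pi\<^sub>E UNIV (\<lambda>_::'g. sphere (0::complex) 1))"
    unfolding compactin_PiE by (auto simp: compactin_euclidean_iff)
  then have c: "compact (Pi\<^sub>E UNIV (\<lambda>_::'g. sphere (0::complex) 1))"
    unfolding euclidean_product_topology compactin_euclidean_iff .
  have "closed {\<xi> :: 'g \<Rightarrow> complex. \<forall>a b. \<xi> (a + b) = \<xi> a * \<xi> b}"
    by (intro closed_Collect_all closed_Collect_eq continuous_intros continuous_on_eval)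
  then have "compact (Pi\<^sub>E UNIV (\<lambda>_::'g. sphere (0::complex) 1) \<inter> {\<xi>. \<forall>a b. \<xi> (a + b) = \<xi> a * \<xi> b})"
    by (rule compact_Int_closed[OF c])
  also have "Pi\<^sub>E UNIV (\<lambda>_::'g. sphere (0::complex) 1) \<inter> {\<xi>. \<forall>a b. \<xi> (a + b) = \<xi> a * \<xi> b} = characters"
    by (auto simp: characters_def PiE_def Pi_def)
  finally show ?thesis .
qed

section \<open>Trigonometric polynomials and their density\<close>

inductive_set trig_polynomials :: "(('g::ab_group_add \<Rightarrow> complex) \<Rightarrow> complex) set" where
  eval: "(\<lambda>\<alpha>. \<alpha> a) \<in> trig_polynomials"
| add: "p \<in> trig_polynomials \<Longrightarrow> q \<in> trig_polynomials \<Longrightarrow> (\<lambda>\<alpha>. p \<alpha> + q \<alpha>) \<in> trig_polynomials"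
| scale: "p \<in> trig_polynomials \<Longrightarrow> (\<lambda>\<alpha>. c * p \<alpha>) \<in> trig_polynomials"

text \<open>Evaluations multiply to evaluations only at multiplicative arguments, so agreement is
  claimed on \<open>characters\<close> and not as an identity of functions.\<close>

lemma trig_polynomials_mult:
  assumes "p \<in> trig_polynomials" "q \<in> trig_polynomials"
  shows "\<exists>r\<in>trig_polynomials. \<forall>\<alpha>\<in>characters. r \<alpha> = p \<alpha> * q \<alpha>"
  using assms(1)
proof induction
  case (eval a)
  show ?case using assms(2)
  proof induction
    case (eval b)
    show ?case by (rule bexI[OF _ trig_polynomials.eval[of "a + b"]]) (auto simp: character_add)
  next
    case (add p q)
    then obtain r s where "r \<in> trig_polynomials" "\<forall>\<alpha>\<in>characters. r \<alpha> = \<alpha> a * p \<alpha>"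
      "s \<in> trig_polynomials" "\<forall>\<alpha>\<in>characters. s \<alpha> = \<alpha> a * q \<alpha>" by blast
    then show ?case
      by (intro bexI[OF _ trig_polynomials.add[of r s]]) (auto simp: distrib_left)
  next
    case (scale p c)
    then obtain r where "r \<in> trig_polynomials" "\<forall>\<alpha>\<in>characters. r \<alpha> = \<alpha> a * p \<alpha>" by blast
    then show ?case
      by (intro bexI[OF _ trig_polynomials.scale[of r c]]) auto
  qed
next
  case (add p p')
  then obtain r s where "r \<in> trig_polynomials" "\<forall>\<alpha>\<in>characters. r \<alpha> = p \<alpha> * q \<alpha>"
    "s \<in> trig_polynomials" "\<forall>\<alpha>\<in>characters. s \<alpha> = p' \<alpha> * q \<alpha>" by blast
  then show ?case
    by (intro bexI[OF _ trig_polynomials.add[of r s]]) (auto simp: distrib_right)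
next
  case (scale p c)
  then obtain r where "r \<in> trig_polynomials" "\<forall>\<alpha>\<in>characters. r \<alpha> = p \<alpha> * q \<alpha>" by blast
  then show ?case
    by (intro bexI[OF _ trig_polynomials.scale[of r c]]) auto
qed

lemma trig_polynomials_dense:
  fixes \<phi> :: "('g::{ab_group_add,countable} \<Rightarrow> complex) \<Rightarrow> real"
  assumes "continuous_on characters \<phi>" "e > 0"
  shows "\<exists>p\<in>trig_polynomials. \<forall>\<alpha>\<in>characters. cmod (of_real (\<phi> \<alpha>) - p \<alpha>) < e"
proof -
  \<comment> \<open>The real Stone-Weierstrass theorem is applied to the real functions that
    coincide on the dual with a trigonometric polynomial. Conjugating \<alpha> a gives \<alpha> (-
    a), so the real and imaginary parts of evaluations qualify, and they separate points.\<close>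
  define P where "P f \<longleftrightarrow> continuous_on characters f \<and>
    (\<exists>p\<in>trig_polynomials. \<forall>\<alpha>\<in>characters. p \<alpha> = complex_of_real (f \<alpha>))"
    for f :: "('g \<Rightarrow> complex) \<Rightarrow> real"
  have "\<exists>g. P g \<and> (\<forall>x\<in>characters. \<bar>\<phi> x - g x\<bar> < e)"
  proof (rule Stone_Weierstrass_HOL[where P=P])
    show "compact (characters :: ('g \<Rightarrow> complex) set)" by (rule compact_characters)
    show "P (\<lambda>x. c)" for c
      unfolding P_def
      by (intro conjI bexI[OF _ trig_polynomials.scale[OF trig_polynomials.eval[of 0], of "of_real c"]])
        (auto simp: character_zero)
    show "continuous_on characters f" if "P f" for f using that by (simp add: P_def)
  next
    fix f g assume "P f \<and> P g"
    then obtain p q where pq: "p \<in> trig_polynomials" "\<forall>\<alpha>\<in>characters. p \<alpha> = complex_of_real (f \<alpha>)"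
      "q \<in> trig_polynomials" "\<forall>\<alpha>\<in>characters. q \<alpha> = complex_of_real (g \<alpha>)"
      "continuous_on characters f" "continuous_on characters g"
      by (auto simp: P_def)
    show "P (\<lambda>x. f x + g x)"
      unfolding P_def using pq
      by (intro conjI bexI[OF _ trig_polynomials.add[of p q]] continuous_intros) auto
    obtain r where r: "r \<in> trig_polynomials" "\<forall>\<alpha>\<in>characters. r \<alpha> = p \<alpha> * q \<alpha>"
      using trig_polynomials_mult[OF pq(1,3)] by blast
    show "P (\<lambda>x. f x * g x)"
      unfolding P_def using pq r
      by (intro conjI bexI[OF _ r(1)] continuous_intros) auto
  next
    fix x y :: "'g \<Rightarrow> complex" assume xy: "x \<in> characters \<and> y \<in> characters \<and> x \<noteq> y"
    then obtain a where a: "x a \<noteq> y a" by blast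
    have "P (\<lambda>\<alpha>. Re (\<alpha> a))"
      unfolding P_def
    proof (intro conjI bexI)
      show "(\<lambda>\<alpha>. (1/2) * (\<alpha> a + \<alpha> (- a))) \<in> trig_polynomials"
        by (intro trig_polynomials.intros)
      show "\<forall>\<alpha>\<in>characters. (1/2) * (\<alpha> a + \<alpha> (- a)) = complex_of_real (Re (\<alpha> a))"
        by (auto simp: character_uminus complex_add_cnj)
    qed (intro continuous_intros continuous_on_eval)
    moreover have "P (\<lambda>\<alpha>. Im (\<alpha> a))"
      unfolding P_def
    proof (intro conjI bexI)
      show "(\<lambda>\<alpha>. (- \<i>/2) * (\<alpha> a + (-1) * \<alpha> (- a))) \<in> trig_polynomials"
        by (intro trig_polynomials.intros)
      show "\<forall>\<alpha>\<in>characters. (- \<i>/2) * (\<alpha> a + (-1) * \<alpha> (- a)) = complex_of_real (Im (\<alpha> a))"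
        by (auto simp: character_uminus complex_eq_iff)
    qed (intro continuous_intros continuous_on_eval)
    moreover have "Re (x a) \<noteq> Re (y a) \<or> Im (x a) \<noteq> Im (y a)" using a by (simp add: complex_eq_iff)
    ultimately show "\<exists>f. P f \<and> f x \<noteq> f y" by blast
  qed (use assms in auto)
  then obtain g p where g: "\<forall>x\<in>characters. \<bar>\<phi> x - g x\<bar> < e" and p: "p \<in> trig_polynomials"
    and pg: "\<forall>\<alpha>\<in>characters. p \<alpha> = complex_of_real (g \<alpha>)" unfolding P_def by blast
  have "cmod (of_real (\<phi> \<alpha>) - p \<alpha>) < e" if "\<alpha> \<in> characters" for \<alpha>
  proof -
    have "of_real (\<phi> \<alpha>) - p \<alpha> = complex_of_real (\<phi> \<alpha> - g \<alpha>)" using pg that by simp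
    then show ?thesis using g that by (simp only: norm_of_real)
  qed
  then show ?thesis using p by blast
qed

section \<open>Haar measure: orthogonality and uniqueness of Fourier coefficients\<close>

locale haar =
  fixes m :: "('g::{ab_group_add,countable} \<Rightarrow> complex) measure"
  assumes haar: "normalized_haar m"
begin

lemma sets_m: "sets m = sets (restrict_space borel characters)"
  using haar by (simp add: normalized_haar_def)

lemma space_m: "space m = characters"
  using sets_eq_imp_space_eq[OF sets_m] by (simp add: space_restrict_space)

lemma emeasure_space_m: "emeasure m (space m) = 1"
  using haar by (simp add: normalized_haar_def space_m)

lemma finite_measure_m: "finite_measure m"
  by (rule finite_measureI) (simp add: emeasure_space_m)

sublocale finite_measure m
  by (rule finite_measure_m)

lemma measure_space_m [simp]: "measure m characters = 1"
  using emeasure_space_m by (simp add: measure_def space_m)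

lemma borel_measurable_continuous_m:
  assumes "continuous_on characters (f :: ('g \<Rightarrow> complex) \<Rightarrow> 'b::topological_space)"
  shows "f \<in> borel_measurable m"
  unfolding measurable_cong_sets[OF sets_m refl] by (rule borel_measurable_continuous_on_restrict[OF assms])

lemma measurable_eval [measurable]: "(\<lambda>\<alpha>. \<alpha> a) \<in> borel_measurable m"
  by (rule borel_measurable_continuous_m[OF continuous_on_eval])

lemma translation_invariant:
  assumes \<xi>: "\<xi> \<in> characters"
  shows "(\<lambda>\<eta>. \<xi> * \<eta>) \<in> m \<rightarrow>\<^sub>M m" "distr m m (\<lambda>\<eta>. \<xi> * \<eta>) = m"
proof -
  have closed: "\<zeta> * \<eta> \<in> characters" if "\<zeta> \<in> characters" "\<eta> \<in> characters" for \<zeta> \<eta> :: "'g \<Rightarrow> complex"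
    using that by (auto simp: characters_def norm_mult)
  have cont: "continuous_on characters (\<lambda>\<eta>::'g \<Rightarrow> complex. \<xi> * \<eta>)"
    by (rule continuous_on_coordinatewise_then_product) (auto intro!: continuous_intros continuous_on_eval)
  show meas: "(\<lambda>\<eta>. \<xi> * \<eta>) \<in> m \<rightarrow>\<^sub>M m"
    unfolding measurable_cong_sets[OF refl sets_m]
    by (rule measurable_restrict_space2[OF _ borel_measurable_continuous_m[OF cont]])
      (use closed \<xi> in \<open>auto simp: space_m\<close>)
  \<comment> \<open>Invariance is given for images, whereas \<open>distr\<close> asks for preimages.
    The preimage under multiplication by \<xi> is the image under multiplication by the inverse
    character, its conjugate.\<close>
  define \<zeta> where "\<zeta> a = cnj (\<xi> a)" for a
  have \<zeta>: "\<zeta> \<in> characters" using \<xi> by (auto simp: \<zeta>_def characters_def)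
  have "\<zeta> * \<xi> = 1"
    by (rule ext) (simp add: \<zeta>_def character_cnj_mult[OF \<xi>])
  then have inv: "\<zeta> * (\<xi> * \<eta>) = \<eta>" "\<xi> * (\<zeta> * \<eta>) = \<eta>" for \<eta>
    by (simp_all only: mult.assoc[symmetric] mult.commute[of \<xi> \<zeta>] mult_1)
  show "distr m m (\<lambda>\<eta>. \<xi> * \<eta>) = m"
  proof (rule measure_eqI)
    fix E assume "E \<in> sets (distr m m (\<lambda>\<eta>. \<xi> * \<eta>))"
    then have E: "E \<in> sets m" by simp
    then have Esub: "E \<subseteq> characters" using sets.sets_into_space space_m by blast
    have "(\<lambda>\<eta>. \<xi> * \<eta>) -` E \<inter> space m = (\<lambda>\<eta>. \<zeta> * \<eta>) ` E"
    proof (intro equalityI subsetI)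
      fix \<eta> assume "\<eta> \<in> (\<lambda>\<eta>. \<xi> * \<eta>) -` E \<inter> space m"
      then show "\<eta> \<in> (\<lambda>\<eta>. \<zeta> * \<eta>) ` E" using inv(1)[of \<eta>] by (metis IntE image_eqI vimageE)
    next
      fix \<eta> assume "\<eta> \<in> (\<lambda>\<eta>. \<zeta> * \<eta>) ` E"
      then show "\<eta> \<in> (\<lambda>\<eta>. \<xi> * \<eta>) -` E \<inter> space m"
        using inv(2) closed[OF \<zeta>] Esub by (auto simp: space_m)
    qed
    then have "emeasure (distr m m (\<lambda>\<eta>. \<xi> * \<eta>)) E = emeasure m ((\<lambda>\<eta>. \<zeta> * \<eta>) ` E)"
      by (simp add: emeasure_distr[OF meas E])
    also have "\<dots> = emeasure m E" using haar \<zeta> E by (simp add: normalized_haar_def)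
    finally show "emeasure (distr m m (\<lambda>\<eta>. \<xi> * \<eta>)) E = emeasure m E" .
  qed simp
qed

text \<open>Translation by a character \<xi> multiplies the integral by \<xi> a, so the integral
  vanishes as soon as some \<xi> takes a value other than 1 at \<open>a\<close>. This is where the
  separation of points by characters enters.\<close>

lemma integral_eval: "(\<integral>\<alpha>. \<alpha> a \<partial>m) = (if a = 0 then 1 else 0)"
proof (cases "a = 0")
  case True
  have "(\<integral>\<alpha>. \<alpha> a \<partial>m) = (\<integral>\<alpha>. 1 \<partial>m)"
    by (rule Bochner_Integration.integral_cong) (auto simp: True space_m character_zero)
  then show ?thesis using True by (simp add: space_m)
next
  case False
  obtain \<xi> :: "'g \<Rightarrow> complex" where \<xi>: "\<xi> \<in> characters" "\<xi> a \<noteq> 1" using characters_separate[OF False] by blast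
  have "(\<integral>\<alpha>. \<alpha> a \<partial>m) = (\<integral>\<alpha>. \<alpha> a \<partial>distr m m (\<lambda>\<eta>. \<xi> * \<eta>))"
    by (simp add: translation_invariant[OF \<xi>(1)])
  also have "\<dots> = (\<integral>\<alpha>. \<xi> a * \<alpha> a \<partial>m)"
    by (subst integral_distr[OF translation_invariant(1)[OF \<xi>(1)]]) auto
  also have "\<dots> = \<xi> a * (\<integral>\<alpha>. \<alpha> a \<partial>m)" by simp
  finally have "(1 - \<xi> a) * (\<integral>\<alpha>. \<alpha> a \<partial>m) = 0" by (simp add: algebra_simps)
  then show ?thesis using \<xi>(2) False by simp
qed

lemma integral_eval_cnj: "(\<integral>\<alpha>. \<alpha> a * cnj (\<alpha> b) \<partial>m) = (if a = b then 1 else 0)"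
proof -
  have "(\<integral>\<alpha>. \<alpha> a * cnj (\<alpha> b) \<partial>m) = (\<integral>\<alpha>. \<alpha> (a - b) \<partial>m)"
    by (rule Bochner_Integration.integral_cong)
      (auto simp: space_m character_uminus[symmetric] character_add[symmetric])
  then show ?thesis by (simp add: integral_eval)
qed

lemma integrable_mult_bounded:
  assumes f: "integrable m f" and g: "g \<in> borel_measurable m" "\<And>\<alpha>. \<alpha> \<in> characters \<Longrightarrow> cmod (g \<alpha>) \<le> B"
  shows "integrable m (\<lambda>\<alpha>. f \<alpha> * (g \<alpha> :: complex))"
proof (rule Bochner_Integration.integrable_bound)
  show "integrable m (\<lambda>\<alpha>. B * norm (f \<alpha>))" using f by simp
  show "(\<lambda>\<alpha>. f \<alpha> * g \<alpha>) \<in> borel_measurable m" using f g(1) by measurable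
  show "AE \<alpha> in m. norm (f \<alpha> * g \<alpha>) \<le> norm (B * norm (f \<alpha>))"
  proof (rule AE_I2)
    fix \<alpha> assume "\<alpha> \<in> space m"
    then have "norm (f \<alpha> * g \<alpha>) \<le> B * norm (f \<alpha>)"
      using g(2) by (auto simp: space_m norm_mult mult.commute[of B] intro!: mult_left_mono)
    also have "\<dots> \<le> norm (B * norm (f \<alpha>))" unfolding real_norm_def by (rule abs_ge_self)
    finally show "norm (f \<alpha> * g \<alpha>) \<le> norm (B * norm (f \<alpha>))" .
  qed
qed

lemma trig_polynomials_props:
  assumes "p \<in> trig_polynomials"
  shows "p \<in> borel_measurable m \<and> (\<exists>B. \<forall>\<alpha>\<in>characters. cmod (p \<alpha>) \<le> B)"
  using assms
proof induction
  case (eval a)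
  then show ?case by (auto simp: character_norm intro!: exI[of _ 1])
next
  case (add p q)
  then obtain B B' where B: "\<forall>\<alpha>\<in>characters. cmod (p \<alpha>) \<le> B" "\<forall>\<alpha>\<in>characters. cmod (q \<alpha>) \<le> B'" by blast
  have "\<forall>\<alpha>\<in>characters. cmod (p \<alpha> + q \<alpha>) \<le> B + B'"
    using B by (auto intro!: order_trans[OF norm_triangle_ineq] add_mono)
  then show ?case using add by auto
next
  case (scale p c)
  then obtain B where B: "\<forall>\<alpha>\<in>characters. cmod (p \<alpha>) \<le> B" by blast
  have "\<forall>\<alpha>\<in>characters. cmod (c * p \<alpha>) \<le> cmod c * B"
    using B by (auto simp: norm_mult intro!: mult_left_mono)
  then show ?case using scale by auto
qed

lemma integral_mult_trig_polynomial_eq_0: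
  assumes f: "integrable m f" and 0: "\<And>a. (\<integral>\<alpha>. f \<alpha> * \<alpha> a \<partial>m) = 0" and p: "p \<in> trig_polynomials"
  shows "(\<integral>\<alpha>. f \<alpha> * p \<alpha> \<partial>m) = 0"
  using p
proof induction
  case (add p q)
  have "integrable m (\<lambda>\<alpha>. f \<alpha> * p \<alpha>)" if "p \<in> trig_polynomials" for p
    using integrable_mult_bounded[OF f] trig_polynomials_props[OF that] by blast
  then show ?case using add by (simp add: distrib_left)
next
  case (scale p c)
  have "(\<integral>\<alpha>. f \<alpha> * (c * p \<alpha>) \<partial>m) = c * (\<integral>\<alpha>. f \<alpha> * p \<alpha> \<partial>m)"
    by (subst integral_mult_right_zero[symmetric]) (simp add: mult_ac)
  then show ?case using scale by simp
qed (rule 0)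

lemma integral_mult_continuous_eq_0:
  assumes f: "integrable m f" and 0: "\<And>a. (\<integral>\<alpha>. f \<alpha> * \<alpha> a \<partial>m) = 0"
    and \<phi>: "continuous_on characters \<phi>"
  shows "(\<integral>\<alpha>. f \<alpha> * complex_of_real (\<phi> \<alpha>) \<partial>m) = 0"
proof -
  \<comment> \<open>A uniform error e/K in approximating \<phi> costs at most e/K times the L1 norm
    of \<open>f\<close>, hence at most e. The added 1 keeps \<open>K\<close> positive when
    \<open>f\<close> vanishes almost everywhere.\<close>
  define K where "K = (\<integral>\<alpha>. norm (f \<alpha>) \<partial>m) + 1"
  have K: "K > 0" unfolding K_def by (intro add_nonneg_pos) auto
  have [measurable]: "\<phi> \<in> borel_measurable m" by (rule borel_measurable_continuous_m[OF \<phi>])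
  have "bounded (\<phi> ` characters)"
    by (intro compact_imp_bounded compact_continuous_image \<phi> compact_characters)
  then obtain B where B: "\<And>\<alpha>. \<alpha> \<in> characters \<Longrightarrow> \<bar>\<phi> \<alpha>\<bar> \<le> B" by (auto simp: bounded_iff)
  have int\<phi>: "integrable m (\<lambda>\<alpha>. f \<alpha> * complex_of_real (\<phi> \<alpha>))"
    by (rule integrable_mult_bounded[OF f, of _ B]) (use B in auto)
  have "cmod (\<integral>\<alpha>. f \<alpha> * complex_of_real (\<phi> \<alpha>) \<partial>m) \<le> 0 + e" if e: "e > 0" for e
  proof -
    obtain p where p: "p \<in> trig_polynomials" "\<forall>\<alpha>\<in>characters. cmod (of_real (\<phi> \<alpha>) - p \<alpha>) < e / K"
      using trig_polynomials_dense[OF \<phi> divide_pos_pos[OF e K]] by blast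
    have intp: "integrable m (\<lambda>\<alpha>. f \<alpha> * p \<alpha>)"
      using integrable_mult_bounded[OF f] trig_polynomials_props[OF p(1)] by blast
    have "(\<integral>\<alpha>. f \<alpha> * complex_of_real (\<phi> \<alpha>) \<partial>m)
        = (\<integral>\<alpha>. f \<alpha> * complex_of_real (\<phi> \<alpha>) - f \<alpha> * p \<alpha> \<partial>m)"
      using int\<phi> intp integral_mult_trig_polynomial_eq_0[OF f 0 p(1)] by simp
    also have "cmod \<dots> \<le> (\<integral>\<alpha>. e / K * norm (f \<alpha>) \<partial>m)"
    proof (rule order_trans[OF Bochner_Integration.integral_norm_bound Bochner_Integration.integral_mono])
      show "integrable m (\<lambda>\<alpha>. norm (f \<alpha> * complex_of_real (\<phi> \<alpha>) - f \<alpha> * p \<alpha>))"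
        using int\<phi> intp by simp
      show "integrable m (\<lambda>\<alpha>. e / K * norm (f \<alpha>))" using f by simp
      fix \<alpha> assume "\<alpha> \<in> space m"
      then have "norm (f \<alpha>) * norm (of_real (\<phi> \<alpha>) - p \<alpha>) \<le> norm (f \<alpha>) * (e / K)"
        using p(2) by (intro mult_left_mono) (auto simp: space_m less_imp_le)
      then show "norm (f \<alpha> * complex_of_real (\<phi> \<alpha>) - f \<alpha> * p \<alpha>) \<le> e / K * norm (f \<alpha>)"
        by (simp add: norm_mult[symmetric] right_diff_distrib mult.commute)
    qed
    also have "\<dots> = e / K * (K - 1)" by (simp add: K_def)
    also have "\<dots> \<le> e / K * K" using e K by (intro mult_left_mono) auto
    finally show ?thesis using K by simp
  qed
  then have "cmod (\<integral>\<alpha>. f \<alpha> * complex_of_real (\<phi> \<alpha>) \<partial>m) \<le> 0" by (rule field_le_epsilon)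
  then show ?thesis by simp
qed

lemma set_integral_closed_eq_0:
  assumes f: "integrable m f" and 0: "\<And>a. (\<integral>\<alpha>. f \<alpha> * \<alpha> a \<partial>m) = 0" and K: "closed K"
  shows "(\<integral>\<alpha>. f \<alpha> * indicator K \<alpha> \<partial>m) = (0::complex)"
proof (cases "K = {}")
  case False
  \<comment> \<open>These functions are 1 on \<open>K\<close> and vanish where n times the distance
    to \<open>K\<close> is at least 1, so closedness of \<open>K\<close> makes them converge
    pointwise to its indicator. The empty set is treated apart because \<open>infdist\<close> to it
    is 0.\<close>
  define \<phi> where "\<phi> n \<alpha> = max 0 (1 - real n * infdist \<alpha> K)" for n \<alpha>
  have cont: "continuous_on characters (\<phi> n)" for n
    unfolding \<phi>_def by (intro continuous_intros continuous_on_infdist)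
  have [measurable]: "\<phi> n \<in> borel_measurable m" for n by (rule borel_measurable_continuous_m[OF cont])
  have [measurable]: "K \<inter> characters \<in> sets m"
    unfolding sets_m sets_restrict_space using K by auto
  have ind: "(\<lambda>\<alpha>. indicator K \<alpha> :: complex) \<in> borel_measurable m"
  proof -
    have "(\<lambda>\<alpha>. indicator (K \<inter> characters) \<alpha> :: complex) \<in> borel_measurable m" by measurable
    then show ?thesis by (rule measurable_cong[THEN iffD1, rotated]) (auto simp: space_m indicator_def)
  qed
  have "(\<lambda>n. \<integral>\<alpha>. f \<alpha> * complex_of_real (\<phi> n \<alpha>) \<partial>m) \<longlonglongrightarrow> (\<integral>\<alpha>. f \<alpha> * indicator K \<alpha> \<partial>m)"
  proof (rule integral_dominated_convergence[where w="\<lambda>\<alpha>. norm (f \<alpha>)"])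
    show "(\<lambda>\<alpha>. f \<alpha> * indicator K \<alpha>) \<in> borel_measurable m" using f ind by measurable
    show "(\<lambda>\<alpha>. f \<alpha> * complex_of_real (\<phi> n \<alpha>)) \<in> borel_measurable m" for n using f by measurable
    show "integrable m (\<lambda>\<alpha>. norm (f \<alpha>))" using f by simp
    show "AE \<alpha> in m. norm (f \<alpha> * complex_of_real (\<phi> n \<alpha>)) \<le> norm (f \<alpha>)" for n
    proof (rule AE_I2)
      fix \<alpha>
      have "\<bar>\<phi> n \<alpha>\<bar> \<le> 1" using infdist_nonneg[of \<alpha> K] by (auto simp: \<phi>_def)
      then show "norm (f \<alpha> * complex_of_real (\<phi> n \<alpha>)) \<le> norm (f \<alpha>)"
        by (auto simp: norm_mult intro: mult_left_le)
    qed
    show "AE \<alpha> in m. (\<lambda>n. f \<alpha> * complex_of_real (\<phi> n \<alpha>)) \<longlonglongrightarrow> f \<alpha> * indicator K \<alpha>"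
    proof (rule AE_I2)
      fix \<alpha>
      have "(\<lambda>n. complex_of_real (\<phi> n \<alpha>)) \<longlonglongrightarrow> indicator K \<alpha>"
      proof (cases "\<alpha> \<in> K")
        case True
        then show ?thesis by (simp add: \<phi>_def)
      next
        case notin: False
        then have pos: "infdist \<alpha> K > 0"
          using in_closed_iff_infdist_zero[OF K False, of \<alpha>] infdist_nonneg[of \<alpha> K] by linarith
        obtain N where N: "1 < real N * infdist \<alpha> K" using reals_Archimedean3[OF pos] by blast
        have "\<phi> n \<alpha> = 0" if "n \<ge> N" for n
        proof -
          have "real N * infdist \<alpha> K \<le> real n * infdist \<alpha> K" using that pos by (intro mult_right_mono) auto
          then show ?thesis using N by (simp add: \<phi>_def)
        qed
        then have "eventually (\<lambda>n. complex_of_real (\<phi> n \<alpha>) = indicator K \<alpha>) sequentially"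
          using notin by (auto simp: eventually_sequentially)
        then show ?thesis by (rule tendsto_eventually)
      qed
      then show "(\<lambda>n. f \<alpha> * complex_of_real (\<phi> n \<alpha>)) \<longlonglongrightarrow> f \<alpha> * indicator K \<alpha>"
        by (intro tendsto_intros)
    qed
  qed
  then show ?thesis
    using integral_mult_continuous_eq_0[OF f 0 cont] by (simp add: LIMSEQ_const_iff)
qed simp

text \<open>Provides a generator stable under intersection, as required by the induction over
  disjoint unions that follows.\<close>

lemma sets_m_closed: "sets m = sigma_sets characters {K \<inter> characters | K. closed K}"
proof -
  have "characters \<in> sigma_sets UNIV {S :: ('g \<Rightarrow> complex) set. closed S}"
    using compact_imp_closed[OF compact_characters] by blast
  from sigma_sets_Int[OF this]
  have "(\<inter>) characters ` sigma_sets UNIV {S :: ('g \<Rightarrow> complex) set. closed S}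
      = sigma_sets characters ((\<inter>) characters ` {S. closed S})" by simp
  moreover have "(\<inter>) characters ` {S :: ('g \<Rightarrow> complex) set. closed S} = {K \<inter> characters | K. closed K}"
    by blast
  ultimately show ?thesis
    unfolding sets_m sets_restrict_space by (simp add: borel_eq_closed)
qed

text \<open>Vanishing coefficients give vanishing integrals against trigonometric polynomials, then
  continuous functions, then closed sets, and by the Dynkin argument over all measurable sets; an
  integrable function with this property is zero almost everywhere.\<close>

theorem fourier_unique:
  assumes f: "integrable m f" and 0: "\<And>a. (\<integral>\<alpha>. f \<alpha> * \<alpha> a \<partial>m) = 0"
  shows "AE \<alpha> in m. f \<alpha> = (0::complex)"
proof -
  have ind: "integrable m (\<lambda>\<alpha>. f \<alpha> * indicator E \<alpha>)" if "E \<in> sets m" for E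
  proof -
    have "(\<lambda>\<alpha>. f \<alpha> * indicator E \<alpha>) = (\<lambda>\<alpha>. indicator E \<alpha> *\<^sub>R f \<alpha>)"
      by (auto simp: indicator_def fun_eq_iff)
    then show ?thesis using integrable_mult_indicator[OF that f] by simp
  qed
  have set0: "(\<integral>\<alpha>. f \<alpha> * indicator E \<alpha> \<partial>m) = 0" if E: "E \<in> sets m" for E
  proof -
    have mem: "E \<in> sigma_sets characters {K \<inter> characters | K. closed K}" using E sets_m_closed by simp
    have stab: "Int_stable {K \<inter> characters | K :: ('g \<Rightarrow> complex) set. closed K}"
    proof (rule Int_stableI)
      fix A B assume "A \<in> {K \<inter> characters | K :: ('g \<Rightarrow> complex) set. closed K}" "B \<in> {K \<inter> characters | K :: ('g \<Rightarrow> complex) set. closed K}"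
      then obtain K L where "A = K \<inter> characters" "closed K" "B = L \<inter> characters" "closed L" by blast
      then show "A \<inter> B \<in> {K \<inter> characters | K :: ('g \<Rightarrow> complex) set. closed K}"
        by (intro CollectI exI[of _ "K \<inter> L"]) auto
    qed
    have sub: "{K \<inter> characters | K :: ('g \<Rightarrow> complex) set. closed K} \<subseteq> Pow characters" by auto
    show ?thesis
      using stab sub mem
    proof (induction rule: sigma_sets_induct_disjoint)
      case (basic A)
      then obtain K where K: "A = K \<inter> characters" "closed K" by blast
      have "(\<integral>\<alpha>. f \<alpha> * indicator A \<alpha> \<partial>m) = (\<integral>\<alpha>. f \<alpha> * indicator K \<alpha> \<partial>m)"
        by (rule Bochner_Integration.integral_cong) (auto simp: K space_m indicator_def)
      then show ?case using set_integral_closed_eq_0[OF f 0 K(2)] by simp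
    next
      case empty
      then show ?case by simp
    next
      case (compl A)
      then have A: "A \<in> sets m" by (simp add: sets_m_closed)
      \<comment> \<open>The factor \<alpha> 0 is 1 on the dual: the integral over the whole space is
        the Fourier coefficient at 0.\<close>
      have "(\<integral>\<alpha>. f \<alpha> * indicator (characters - A) \<alpha> \<partial>m) = (\<integral>\<alpha>. f \<alpha> * \<alpha> 0 - f \<alpha> * indicator A \<alpha> \<partial>m)"
        by (rule Bochner_Integration.integral_cong) (auto simp: space_m indicator_def character_zero)
      also have "\<dots> = (\<integral>\<alpha>. f \<alpha> * \<alpha> 0 \<partial>m) - (\<integral>\<alpha>. f \<alpha> * indicator A \<alpha> \<partial>m)"
        by (intro Bochner_Integration.integral_diff ind A integrable_mult_bounded[OF f measurable_eval, of _ 1])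
          (simp add: character_norm)
      also have "\<dots> = 0" using compl 0 by simp
      finally show ?case .
    next
      case (union A)
      have A: "A i \<in> sets m" for i using union by (auto simp: sets_m_closed)
      have eq: "(\<integral>\<alpha>. f \<alpha> * indicator E \<alpha> \<partial>m) = (\<integral>\<alpha>\<in>E. f \<alpha> \<partial>m)" for E
        unfolding set_lebesgue_integral_def by (rule Bochner_Integration.integral_cong) (auto simp: indicator_def)
      have "(\<integral>\<alpha>\<in>(\<Union>i. A i). f \<alpha> \<partial>m) = (\<Sum>i. (\<integral>\<alpha>\<in>A i. f \<alpha> \<partial>m))"
      proof (rule lebesgue_integral_countable_add)
        show "set_integrable m (\<Union>i. A i) f"
          unfolding set_integrable_def by (rule integrable_mult_indicator[OF _ f]) (use A in auto)
        show "A i \<inter> A j = {}" if "i \<noteq> j" for i j using union(1) that by (auto simp: disjoint_family_on_def)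
      qed (rule A)
      then show ?case using union(3) by (simp add: eq)
    qed
  qed
  have part: "(\<integral>\<alpha>\<in>E. h (f \<alpha>) \<partial>m) = 0" if "E \<in> sets m" "h = Re \<or> h = Im" for E h
  proof -
    have "(\<integral>\<alpha>\<in>E. h (f \<alpha>) \<partial>m) = (\<integral>\<alpha>. h (f \<alpha> * indicator E \<alpha>) \<partial>m)"
      unfolding set_lebesgue_integral_def using that(2)
      by (intro Bochner_Integration.integral_cong) (auto simp: indicator_def)
    also have "\<dots> = h (\<integral>\<alpha>. f \<alpha> * indicator E \<alpha> \<partial>m)"
      using that(2) Bochner_Integration.integral_Re[OF ind[OF that(1)]]
        Bochner_Integration.integral_Im[OF ind[OF that(1)]] by (elim disjE) (simp_all only:)
    finally show ?thesis using set0[OF that(1)] that(2) by auto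
  qed
  have "AE \<alpha> in m. Re (f \<alpha>) = 0"
    by (rule density_unique_real) (use f part in \<open>auto simp: set_lebesgue_integral_def\<close>)
  moreover have "AE \<alpha> in m. Im (f \<alpha>) = 0"
    by (rule density_unique_real) (use f part in \<open>auto simp: set_lebesgue_integral_def\<close>)
  ultimately show ?thesis by eventually_elim (simp add: complex_eq_iff)
qed

end

section \<open>Square-integrable vector fields and measurable range functions\<close>

lemma case_prod_diff: "case_prod F - case_prod G = (case_prod (F - G) :: 'a \<times> 'b \<Rightarrow> complex)"
  by (auto simp: fun_eq_iff)

lemma case_prod_add: "case_prod F + case_prod G = (case_prod (F + G) :: 'a \<times> 'b \<Rightarrow> complex)"
  by (auto simp: fun_eq_iff)

locale pair_L2 = pair_sigma_finite m N for m :: "'a measure" and N :: "'x measure"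
begin

lemma L2_vecD:
  assumes "F \<in> L2_vec m N"
  shows L2_vec_measurable: "case_prod F \<in> borel_measurable (m \<Otimes>\<^sub>M N)"
    and L2_vec_fiber: "\<alpha> \<in> space m \<Longrightarrow> F \<alpha> \<in> L2 N"
    and L2_vec_integrable: "integrable m (\<lambda>\<alpha>. (l2_norm N (F \<alpha>))\<^sup>2)"
  using assms by (auto simp: L2_vec_def)

lemma nn_integral_L2_vec:
  assumes F: "case_prod F \<in> borel_measurable (m \<Otimes>\<^sub>M N)" and L: "\<And>\<alpha>. \<alpha> \<in> space m \<Longrightarrow> F \<alpha> \<in> L2 N"
  shows "(\<integral>\<^sup>+p. ennreal ((cmod (case_prod F p))\<^sup>2) \<partial>(m \<Otimes>\<^sub>M N)) = (\<integral>\<^sup>+\<alpha>. ennreal ((l2_norm N (F \<alpha>))\<^sup>2) \<partial>m)"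
proof -
  have "(\<integral>\<^sup>+p. ennreal ((cmod (case_prod F p))\<^sup>2) \<partial>(m \<Otimes>\<^sub>M N))
      = (\<integral>\<^sup>+\<alpha>. \<integral>\<^sup>+x. ennreal ((cmod (F \<alpha> x))\<^sup>2) \<partial>N \<partial>m)"
    using F by (subst M2.nn_integral_fst[symmetric]) (auto simp: case_prod_beta')
  also have "\<dots> = (\<integral>\<^sup>+\<alpha>. ennreal ((l2_norm N (F \<alpha>))\<^sup>2) \<partial>m)"
    by (intro nn_integral_cong) (simp add: l2_norm_nn[OF L])
  finally show ?thesis .
qed

lemma measurable_l2_norm_fiber:
  assumes "case_prod F \<in> borel_measurable (m \<Otimes>\<^sub>M N)"
  shows "(\<lambda>\<alpha>. l2_norm N (F \<alpha>)) \<in> borel_measurable m"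
proof -
  have [measurable]: "case_prod F \<in> borel_measurable (m \<Otimes>\<^sub>M N)" by fact
  show ?thesis unfolding l2_norm_def by measurable
qed

text \<open>By Tonelli, so that the fields inherit their algebra and completeness from the product
  space. The fibre condition has to stay: square-integrability on the product controls only almost
  every fibre.\<close>

lemma L2_vec_iff:
  "F \<in> L2_vec m N \<longleftrightarrow> case_prod F \<in> L2 (m \<Otimes>\<^sub>M N) \<and> (\<forall>\<alpha>\<in>space m. F \<alpha> \<in> L2 N)"
proof -
  have "integrable m (\<lambda>\<alpha>. (l2_norm N (F \<alpha>))\<^sup>2) \<longleftrightarrow>
      (\<integral>\<^sup>+p. ennreal ((cmod (case_prod F p))\<^sup>2) \<partial>(m \<Otimes>\<^sub>M N)) < \<infinity>"
    if F: "case_prod F \<in> borel_measurable (m \<Otimes>\<^sub>M N)" "\<forall>\<alpha>\<in>space m. F \<alpha> \<in> L2 N"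
    using nn_integral_L2_vec[of F] measurable_l2_norm_fiber[OF F(1)] F
    by (simp add: integrable_iff_bounded)
  then show ?thesis by (auto simp: L2_vec_def L2_iff_nn)
qed

lemma L2_vec_L2: "F \<in> L2_vec m N \<Longrightarrow> case_prod F \<in> L2 (m \<Otimes>\<^sub>M N)"
  by (simp add: L2_vec_iff)

lemma L2_vec_norm:
  assumes "F \<in> L2_vec m N"
  shows "(l2_norm (m \<Otimes>\<^sub>M N) (case_prod F))\<^sup>2 = (\<integral>\<alpha>. (l2_norm N (F \<alpha>))\<^sup>2 \<partial>m)"
proof -
  have "ennreal ((l2_norm (m \<Otimes>\<^sub>M N) (case_prod F))\<^sup>2) = (\<integral>\<^sup>+\<alpha>. ennreal ((l2_norm N (F \<alpha>))\<^sup>2) \<partial>m)"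
    unfolding l2_norm_nn[OF L2_vec_L2[OF assms]]
    by (rule nn_integral_L2_vec) (use L2_vecD[OF assms] in auto)
  also have "\<dots> = ennreal (\<integral>\<alpha>. (l2_norm N (F \<alpha>))\<^sup>2 \<partial>m)"
    by (rule nn_integral_eq_integral[OF L2_vec_integrable[OF assms]]) simp
  finally show ?thesis by (simp add: ennreal_inj integral_nonneg_AE)
qed

lemma L2_vec_diff: "F \<in> L2_vec m N \<Longrightarrow> G \<in> L2_vec m N \<Longrightarrow> F - G \<in> L2_vec m N"
  unfolding L2_vec_iff case_prod_diff[symmetric] by auto

lemma L2_vec_add: "F \<in> L2_vec m N \<Longrightarrow> G \<in> L2_vec m N \<Longrightarrow> F + G \<in> L2_vec m N"
  unfolding L2_vec_iff case_prod_add[symmetric] by auto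

lemma L2_vec_scale:
  assumes F: "F \<in> L2_vec m N" and c: "c \<in> borel_measurable m" "\<And>\<alpha>. \<alpha> \<in> space m \<Longrightarrow> cmod (c \<alpha>) \<le> B"
  shows "(\<lambda>\<alpha> x. c \<alpha> * F \<alpha> x) \<in> L2_vec m N"
proof -
  have [measurable]: "case_prod F \<in> borel_measurable (m \<Otimes>\<^sub>M N)" by (rule L2_vec_measurable[OF F])
  note c(1)[measurable]
  have "integrable m (\<lambda>\<alpha>. (l2_norm N (\<lambda>x. c \<alpha> * F \<alpha> x))\<^sup>2)"
    unfolding l2_norm_cmult
  proof (rule Bochner_Integration.integrable_bound)
    show "integrable m (\<lambda>\<alpha>. B\<^sup>2 * (l2_norm N (F \<alpha>))\<^sup>2)" using L2_vec_integrable[OF F] by simp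
    show "(\<lambda>\<alpha>. (cmod (c \<alpha>) * l2_norm N (F \<alpha>))\<^sup>2) \<in> borel_measurable m"
      using measurable_l2_norm_fiber[OF L2_vec_measurable[OF F]] by measurable
    show "AE \<alpha> in m. norm ((cmod (c \<alpha>) * l2_norm N (F \<alpha>))\<^sup>2) \<le> norm (B\<^sup>2 * (l2_norm N (F \<alpha>))\<^sup>2)"
      using c(2) by (intro AE_I2) (auto simp: power_mult_distrib intro!: mult_right_mono power_mono)
  qed
  moreover have "(\<lambda>(\<alpha>, x). c \<alpha> * F \<alpha> x) \<in> borel_measurable (m \<Otimes>\<^sub>M N)" by measurable
  ultimately show ?thesis using L2_vec_fiber[OF F] by (auto simp: L2_vec_def)
qed

lemma L2_vec_inner:
  assumes F: "F \<in> L2_vec m N" and G: "G \<in> L2_vec m N"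
  shows "integrable m (\<lambda>\<alpha>. l2_inner N (F \<alpha>) (G \<alpha>))"
    and "l2_inner (m \<Otimes>\<^sub>M N) (case_prod F) (case_prod G) = (\<integral>\<alpha>. l2_inner N (F \<alpha>) (G \<alpha>) \<partial>m)"
proof -
  have int: "integrable (m \<Otimes>\<^sub>M N) (\<lambda>p. case_prod F p * cnj (case_prod G p))"
    by (rule integrable_l2_inner[OF L2_vec_L2[OF F] L2_vec_L2[OF G]])
  show "integrable m (\<lambda>\<alpha>. l2_inner N (F \<alpha>) (G \<alpha>))"
    using integrable_fst'[OF int] by (simp add: l2_inner_def)
  show "l2_inner (m \<Otimes>\<^sub>M N) (case_prod F) (case_prod G) = (\<integral>\<alpha>. l2_inner N (F \<alpha>) (G \<alpha>) \<partial>m)"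
    using integral_fst'[OF int] by (simp add: l2_inner_def)
qed

lemma L2_vec_representative:
  assumes G: "G \<in> L2 (m \<Otimes>\<^sub>M N)"
  obtains F where "F \<in> L2_vec m N" "AE \<alpha> in m. \<forall>x. F \<alpha> x = G (\<alpha>, x)" "AE p in m \<Otimes>\<^sub>M N. case_prod F p = G p"
proof -
  have G'[measurable]: "G \<in> borel_measurable (m \<Otimes>\<^sub>M N)" using G by (simp add: L2_def)
  define h where "h \<alpha> = (\<integral>\<^sup>+x. ennreal ((cmod (G (\<alpha>, x)))\<^sup>2) \<partial>N)" for \<alpha>
  have h[measurable]: "h \<in> borel_measurable m" unfolding h_def by measurable
  have "(\<integral>\<^sup>+\<alpha>. h \<alpha> \<partial>m) = (\<integral>\<^sup>+p. ennreal ((cmod (G p))\<^sup>2) \<partial>(m \<Otimes>\<^sub>M N))"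
    unfolding h_def by (rule M2.nn_integral_fst) measurable
  also have "\<dots> < \<infinity>" using G by (simp add: L2_iff_nn)
  finally have fin: "AE \<alpha> in m. h \<alpha> \<noteq> \<infinity>" by (intro nn_integral_PInf_AE) auto
  \<comment> \<open>Fibres that are not square-integrable are reset to 0. They are indexed by a
    measurable null set, so joint measurability and the class of \<open>G\<close> are kept.\<close>
  define F where "F \<alpha> x = (if h \<alpha> = \<infinity> then 0 else G (\<alpha>, x))" for \<alpha> x
  have meas[measurable]: "case_prod F \<in> borel_measurable (m \<Otimes>\<^sub>M N)"
    unfolding F_def by measurable
  have AE1: "AE \<alpha> in m. \<forall>x. F \<alpha> x = G (\<alpha>, x)"
    using fin by eventually_elim (simp add: F_def)
  have AE2: "AE p in m \<Otimes>\<^sub>M N. case_prod F p = G p"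
  proof (rule AE_pair_measure)
    show "{p \<in> space (m \<Otimes>\<^sub>M N). case_prod F p = G p} \<in> sets (m \<Otimes>\<^sub>M N)" by measurable
    show "AE \<alpha> in m. AE x in N. case_prod F (\<alpha>, x) = G (\<alpha>, x)" using AE1 by auto
  qed
  have fib: "F \<alpha> \<in> L2 N" if \<alpha>: "\<alpha> \<in> space m" for \<alpha>
  proof (cases "h \<alpha> = \<infinity>")
    case True
    then have "F \<alpha> = 0" by (auto simp: F_def fun_eq_iff)
    then show ?thesis by (simp only: L2_zero)
  next
    case False
    have "(\<lambda>x. G (\<alpha>, x)) \<in> borel_measurable N" using \<alpha> by measurable
    moreover have "F \<alpha> = (\<lambda>x. G (\<alpha>, x))" using False by (auto simp: F_def fun_eq_iff)
    ultimately show ?thesis using False by (simp add: L2_iff_nn h_def top.not_eq_extremum)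
  qed
  have "case_prod F \<in> L2 (m \<Otimes>\<^sub>M N)"
    by (rule L2_cong_AE[OF G meas]) (use AE2 in auto)
  then have "F \<in> L2_vec m N" using fib by (simp add: L2_vec_iff)
  then show thesis using AE1 AE2 by (rule that)
qed

text \<open>Convergence in norm is convergence in L1 of the squared fibre norms, which yields
  convergence almost everywhere along a subsequence.\<close>

lemma L2_vec_limit_fiberwise:
  assumes F: "\<And>n::nat. F n \<in> L2_vec m N" and G: "G \<in> L2_vec m N"
    and lim: "(\<lambda>n. l2_norm (m \<Otimes>\<^sub>M N) (case_prod (F n) - case_prod G)) \<longlonglongrightarrow> 0"
  obtains r where "strict_mono r" "AE \<alpha> in m. (\<lambda>n. l2_norm N (F (r n) \<alpha> - G \<alpha>)) \<longlonglongrightarrow> 0"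
proof -
  have FG: "F n - G \<in> L2_vec m N" for n by (rule L2_vec_diff[OF F G])
  have "(\<lambda>n. \<integral>\<alpha>. norm ((l2_norm N ((F n - G) \<alpha>))\<^sup>2) \<partial>m) \<longlonglongrightarrow> 0"
    using tendsto_power[OF lim, of 2] by (simp add: case_prod_diff L2_vec_norm[OF FG])
  from tendsto_L1_AE_subseq[OF L2_vec_integrable[OF FG] this]
  obtain r where r: "strict_mono r" "AE \<alpha> in m. (\<lambda>n. (l2_norm N ((F (r n) - G) \<alpha>))\<^sup>2) \<longlonglongrightarrow> 0"
    by blast
  from r(2) have "AE \<alpha> in m. (\<lambda>n. l2_norm N (F (r n) \<alpha> - G \<alpha>)) \<longlonglongrightarrow> 0"
  proof eventually_elim
    case (elim \<alpha>)
    then have "(\<lambda>n. sqrt ((l2_norm N ((F (r n) - G) \<alpha>))\<^sup>2)) \<longlonglongrightarrow> sqrt 0" by (intro tendsto_intros)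
    then show ?case by simp
  qed
  with r(1) show thesis by (rule that)
qed

lemma L2_vec_closed_in_range:
  assumes J: "\<And>\<alpha>. \<alpha> \<in> space m \<Longrightarrow> closed_subspace N (J \<alpha>)"
    and F: "\<And>n::nat. F n \<in> L2_vec m N" and G: "G \<in> L2_vec m N"
    and lim: "(\<lambda>n. l2_norm (m \<Otimes>\<^sub>M N) (case_prod (F n) - case_prod G)) \<longlonglongrightarrow> 0"
    and FJ: "\<And>n. AE \<alpha> in m. F n \<alpha> \<in> J \<alpha>"
  shows "AE \<alpha> in m. G \<alpha> \<in> J \<alpha>"
proof -
  obtain r where r: "strict_mono r" "AE \<alpha> in m. (\<lambda>n. l2_norm N (F (r n) \<alpha> - G \<alpha>)) \<longlonglongrightarrow> 0"
    using L2_vec_limit_fiberwise[OF F G lim] by blast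
  have "AE \<alpha> in m. \<forall>n. F n \<alpha> \<in> J \<alpha>" unfolding AE_all_countable using FJ by blast
  with r(2) AE_space show ?thesis
  proof eventually_elim
    case (elim \<alpha>)
    then show ?case
      using closed_subspace_limit[OF J L2_vec_fiber[OF G], of \<alpha> \<alpha> "\<lambda>n. F (r n) \<alpha>"] by blast
  qed
qed

section \<open>Measurability of range functions\<close>

text \<open>Polarization. Pythagoras gets |P b|^2 from the distance of \<open>b\<close> to the
  subspace. Expanding |P a - d|^2 leaves the real part of <P a, d> = <P a, P d>, which is recovered
  from the norms of P a, P d and P (a + d). So measurable distances are enough.\<close>

lemma measurable_range_functionI:
  assumes sep: "l2_separable N" and J: "\<And>\<alpha>. \<alpha> \<in> space m \<Longrightarrow> closed_subspace N (J \<alpha>)"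
    and dist: "\<And>a. a \<in> L2 N \<Longrightarrow> (\<lambda>\<alpha>. l2_norm N (a - l2_proj N (J \<alpha>) a)) \<in> borel_measurable m"
  shows "measurable_range_function m N J"
  unfolding measurable_range_function_def
proof (intro conjI ballI J)
  fix a assume a: "a \<in> L2 N"
  define n where "n b \<alpha> = (l2_norm N b)\<^sup>2 - (l2_norm N (b - l2_proj N (J \<alpha>) b))\<^sup>2" for b \<alpha>
  have n_meas: "n b \<in> borel_measurable m" if "b \<in> L2 N" for b
    unfolding n_def using dist[OF that] by measurable
  have n_eq: "n b \<alpha> = (l2_norm N (l2_proj N (J \<alpha>) b))\<^sup>2" if "b \<in> L2 N" "\<alpha> \<in> space m" for b \<alpha>
    using l2_proj_pythagoras[OF J[OF that(2)] that(1) cfun.subspace_0[OF closed_subspaceD(2)[OF J[OF that(2)]]]]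
    by (simp add: n_def)
  show "(\<lambda>\<alpha>. l2_proj N (J \<alpha>) a) \<in> m \<rightarrow>\<^sub>M l2_borel N"
  proof (rule measurable_l2_borelI[OF sep])
    show "l2_proj N (J \<alpha>) a \<in> L2 N" if "\<alpha> \<in> space m" for \<alpha> by (rule l2_proj_L2[OF J[OF that] a])
    fix d assume d: "d \<in> L2 N"
    have sq: "(l2_norm N (l2_proj N (J \<alpha>) a - d))\<^sup>2 = 2 * n a \<alpha> + n d \<alpha> + (l2_norm N d)\<^sup>2 - n (a + d) \<alpha>"
      if \<alpha>: "\<alpha> \<in> space m" for \<alpha>
    proof -
      note J\<alpha> = J[OF \<alpha>]
      let ?p = "l2_proj N (J \<alpha>) a" and ?q = "l2_proj N (J \<alpha>) d" and ?s = "l2_proj N (J \<alpha>) (a + d)"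
      note L = l2_proj_L2[OF J\<alpha> a] l2_proj_L2[OF J\<alpha> d] l2_proj_L2[OF J\<alpha> L2_add[OF a d]]
      note V = l2_proj_in[OF J\<alpha> a] l2_proj_in[OF J\<alpha> d] l2_proj_in[OF J\<alpha> L2_add[OF a d]]
      \<comment> \<open>Projections are chosen representatives, so P (a + d) = P a + P d holds only
        up to norm zero. The defect \<open>e\<close> lies in the subspace and is a combination of
        residuals orthogonal to it, hence is orthogonal to itself.\<close>
      define e where "e = ?s - (?p + ?q)"
      have e: "e \<in> J \<alpha>" "e \<in> L2 N"
        using closed_subspace_diff[OF J\<alpha>] closed_subspace_add[OF J\<alpha>] V L by (auto simp: e_def)
      have eq: "e = (a - ?p) + (d - ?q) - (a + d - ?s)" by (simp add: e_def)
      have "l2_inner N e e = l2_inner N (a - ?p) e + l2_inner N (d - ?q) e - l2_inner N (a + d - ?s) e"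
        by (subst (1) eq, subst l2_inner_diff_left, auto intro!: L2_diff L2_add a d L e,
            subst l2_inner_add_left, auto intro!: L2_diff L2_add a d L e)
      also have "\<dots> = 0"
        using l2_proj_orthogonal[OF J\<alpha> a e(1)] l2_proj_orthogonal[OF J\<alpha> d e(1)]
          l2_proj_orthogonal[OF J\<alpha> L2_add[OF a d] e(1)] by simp
      finally have "l2_norm N e = 0" by (simp add: l2_inner_self)
      then have "l2_norm N ?s = l2_norm N (?p + ?q)"
        using l2_norm_triangle_rev[OF L(3) L2_add[OF L(1,2)]] by (simp add: e_def)
      then have "n (a + d) \<alpha> = n a \<alpha> + n d \<alpha> + 2 * Re (l2_inner N ?p ?q)"
        unfolding n_eq[OF a \<alpha>] n_eq[OF d \<alpha>] n_eq[OF L2_add[OF a d] \<alpha>] using l2_norm_add_sq[OF L(1,2)] by simp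
      moreover have "l2_inner N ?p ?q = l2_inner N ?p d"
      proof -
        have "l2_inner N (d - ?q) ?p = 0" by (rule l2_proj_orthogonal[OF J\<alpha> d V(1)])
        then have "l2_inner N ?p (d - ?q) = 0" by (subst l2_inner_commute) simp
        then show ?thesis by (simp add: l2_inner_diff_right L d)
      qed
      ultimately show ?thesis
        using l2_norm_diff_sq[OF L(1) d] n_eq[OF a \<alpha>] by simp
    qed
    have "(\<lambda>\<alpha>. sqrt (2 * n a \<alpha> + n d \<alpha> + (l2_norm N d)\<^sup>2 - n (a + d) \<alpha>)) \<in> borel_measurable m"
      using n_meas[OF a] n_meas[OF d] n_meas[OF L2_add[OF a d]] by measurable
    then show "(\<lambda>\<alpha>. l2_norm N (l2_proj N (J \<alpha>) a - d)) \<in> borel_measurable m"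
    proof (rule measurable_cong[THEN iffD1, rotated])
      fix \<alpha> assume \<alpha>: "\<alpha> \<in> space m"
      show "sqrt (2 * n a \<alpha> + n d \<alpha> + (l2_norm N d)\<^sup>2 - n (a + d) \<alpha>) = l2_norm N (l2_proj N (J \<alpha>) a - d)"
        unfolding sq[OF \<alpha>, symmetric] by simp
    qed
  qed
qed

lemma countable_dense_complex:
  obtains Q :: "complex set" where "countable Q" "\<And>z e. e > 0 \<Longrightarrow> \<exists>q\<in>Q. cmod (z - q) < e"
proof -
  obtain Q :: "complex set" where Q: "countable Q" "\<And>X. open X \<Longrightarrow> X \<noteq> {} \<Longrightarrow> \<exists>d\<in>Q. d \<in> X"
    using countable_dense_setE by metis
  have "\<exists>q\<in>Q. cmod (z - q) < e" if "e > 0" for z e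
    using Q(2)[of "ball z e"] that by (auto simp: dist_norm)
  with Q(1) show thesis by (rule that)
qed

lemma measurable_range_function_closed_span:
  assumes sep: "l2_separable N" and A: "countable A"
    and meas: "\<And>i. i \<in> A \<Longrightarrow> case_prod (F i) \<in> borel_measurable (m \<Otimes>\<^sub>M N)"
    and L: "\<And>i \<alpha>. i \<in> A \<Longrightarrow> \<alpha> \<in> space m \<Longrightarrow> F i \<alpha> \<in> L2 N"
  shows "measurable_range_function m N (\<lambda>\<alpha>. closed_span N ((\<lambda>i. F i \<alpha>) ` A))"
proof (rule measurable_range_functionI[OF sep])
  show "closed_subspace N (closed_span N ((\<lambda>i. F i \<alpha>) ` A))" if "\<alpha> \<in> space m" for \<alpha>
    using L[OF _ that] by (intro closed_subspace_closed_span) auto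
  fix a assume a: "a \<in> L2 N"
  obtain Q :: "complex set" where Q: "countable Q" "\<And>z e. e > 0 \<Longrightarrow> \<exists>q\<in>Q. cmod (z - q) < e"
    using countable_dense_complex by blast
  have [measurable]: "a \<in> borel_measurable N" using a by (simp add: L2_def)
  have lin: "(\<lambda>(\<alpha>, x). lincomb (\<lambda>i. F i \<alpha>) ys x) \<in> borel_measurable (m \<Otimes>\<^sub>M N)" if "ys \<in> lists (Q \<times> A)" for ys
    using that
  proof (induction ys rule: list.induct)
    case Nil
    then show ?case by (simp add: lincomb_def)
  next
    case (Cons p ys)
    obtain c i where p: "p = (c, i)" by force
    then have [measurable]: "case_prod (F i) \<in> borel_measurable (m \<Otimes>\<^sub>M N)" using Cons meas by auto
    have [measurable]: "(\<lambda>(\<alpha>, x). lincomb (\<lambda>i. F i \<alpha>) ys x) \<in> borel_measurable (m \<Otimes>\<^sub>M N)" using Cons by auto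
    have "(\<lambda>(\<alpha>, x). c * F i \<alpha> x + lincomb (\<lambda>i. F i \<alpha>) ys x) \<in> borel_measurable (m \<Otimes>\<^sub>M N)" by measurable
    then show ?case by (simp add: p lincomb_Cons)
  qed
  show "(\<lambda>\<alpha>. l2_norm N (a - l2_proj N (closed_span N ((\<lambda>i. F i \<alpha>) ` A)) a)) \<in> borel_measurable m"
  proof (rule borel_measurableI_less)
    fix r
    have iff: "l2_norm N (a - l2_proj N (closed_span N ((\<lambda>i. F i \<alpha>) ` A)) a) < r \<longleftrightarrow>
        (\<exists>ys\<in>lists (Q \<times> A). l2_norm N (a - lincomb (\<lambda>i. F i \<alpha>) ys) < r)" if "\<alpha> \<in> space m" for \<alpha>
      by (rule dist_closed_span_less_iff[OF L[OF _ that] a Q(2)])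
    have "{\<alpha> \<in> space m. l2_norm N (a - l2_proj N (closed_span N ((\<lambda>i. F i \<alpha>) ` A)) a) < r}
        = (\<Union>ys\<in>lists (Q \<times> A). {\<alpha> \<in> space m. l2_norm N (a - lincomb (\<lambda>i. F i \<alpha>) ys) < r})"
      by (intro set_eqI) (simp add: iff cong: conj_cong)
    also have "\<dots> \<in> sets m"
    proof (rule sets.countable_UN'')
      show "countable (lists (Q \<times> A))" using Q(1) A by auto
      fix ys assume ys: "ys \<in> lists (Q \<times> A)"
      have [measurable]: "(\<lambda>(\<alpha>, x). lincomb (\<lambda>i. F i \<alpha>) ys x) \<in> borel_measurable (m \<Otimes>\<^sub>M N)" by (rule lin[OF ys])
      have "(\<lambda>\<alpha>. l2_norm N ((\<lambda>\<alpha>. a - lincomb (\<lambda>i. F i \<alpha>) ys) \<alpha>)) \<in> borel_measurable m"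
        by (rule measurable_l2_norm_fiber) (simp add: case_prod_beta')
      then show "{\<alpha> \<in> space m. l2_norm N (a - lincomb (\<lambda>i. F i \<alpha>) ys) < r} \<in> sets m" by measurable
    qed
    finally show "{\<alpha> \<in> space m. l2_norm N (a - l2_proj N (closed_span N ((\<lambda>i. F i \<alpha>) ` A)) a) < r} \<in> sets m" .
  qed
qed

section \<open>Completeness of the fields, and jointly measurable representatives\<close>

lemma L2_vec_complete:
  assumes F: "\<And>n::nat. F n \<in> L2_vec m N"
    and cauchy: "\<And>\<epsilon>. \<epsilon> > 0 \<Longrightarrow> \<exists>K. \<forall>i\<ge>K. \<forall>j\<ge>K. l2_norm (m \<Otimes>\<^sub>M N) (case_prod (F i) - case_prod (F j)) < \<epsilon>"
  obtains G where "G \<in> L2_vec m N" "(\<lambda>n. l2_norm (m \<Otimes>\<^sub>M N) (case_prod (F n) - case_prod G)) \<longlonglongrightarrow> 0"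
proof -
  obtain H where H: "H \<in> L2 (m \<Otimes>\<^sub>M N)" "(\<lambda>n. l2_norm (m \<Otimes>\<^sub>M N) (case_prod (F n) - H)) \<longlonglongrightarrow> 0"
    using L2_complete[of "\<lambda>n. case_prod (F n)" "m \<Otimes>\<^sub>M N", OF L2_vec_L2[OF F] cauchy] by blast
  obtain G where G: "G \<in> L2_vec m N" "AE p in m \<Otimes>\<^sub>M N. case_prod G p = H p"
    using L2_vec_representative[OF H(1)] by blast
  have "l2_norm (m \<Otimes>\<^sub>M N) (case_prod (F n) - case_prod G) = l2_norm (m \<Otimes>\<^sub>M N) (case_prod (F n) - H)" for n
  proof (rule l2_norm_cong_AE)
    show "case_prod (F n) - case_prod G \<in> borel_measurable (m \<Otimes>\<^sub>M N)"
      by (rule L2_measurable[OF L2_diff[OF L2_vec_L2[OF F] L2_vec_L2[OF G(1)]]])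
    show "case_prod (F n) - H \<in> borel_measurable (m \<Otimes>\<^sub>M N)"
      by (rule L2_measurable[OF L2_diff[OF L2_vec_L2[OF F] H(1)]])
    show "AE p in m \<Otimes>\<^sub>M N. (case_prod (F n) - case_prod G) p = (case_prod (F n) - H) p"
      using G(2) by eventually_elim (simp only: minus_apply)
  qed
  then show thesis using that[OF G(1)] H(2) by simp
qed

text \<open>A strongly measurable field is the uniform limit of fields taking countably many values,
  which have jointly measurable representatives.\<close>
lemma measurable_field_representative:
  assumes fin: "finite_measure m" and sep: "l2_separable N"
    and G: "G \<in> m \<rightarrow>\<^sub>M l2_borel N" and B: "\<And>\<alpha>. \<alpha> \<in> space m \<Longrightarrow> l2_norm N (G \<alpha>) \<le> B"
  obtains F where "F \<in> L2_vec m N" "AE \<alpha> in m. l2_norm N (F \<alpha> - G \<alpha>) = 0"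
proof -
  interpret finite_measure m by fact
  have GL: "G \<alpha> \<in> L2 N" if "\<alpha> \<in> space m" for \<alpha> using measurable_space[OF G that] by (simp add: space_l2_borel)
  obtain D where D: "countable D" "D \<subseteq> L2 N"
    "\<And>f \<epsilon>. f \<in> L2 N \<Longrightarrow> \<epsilon> > 0 \<Longrightarrow> \<exists>d\<in>D. l2_norm N (f - d) < \<epsilon>"
    using l2_separableE[OF sep] by metis
  have "D \<noteq> {}" using D(3)[OF L2_zero, of 1] by auto
  define d where "d = from_nat_into D"
  have d: "d k \<in> D" "d k \<in> L2 N" for k
    using from_nat_into[OF \<open>D \<noteq> {}\<close>] D(2) by (auto simp: d_def)
  have dense: "\<exists>k. l2_norm N (f - d k) < \<epsilon>" if f: "f \<in> L2 N" and e: "\<epsilon> > 0" for f \<epsilon>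
  proof -
    obtain g where "g \<in> D" "l2_norm N (f - g) < \<epsilon>" using D(3)[OF f e] by blast
    then show ?thesis using from_nat_into_surj[OF D(1), of g] by (auto simp: d_def)
  qed
  have [measurable]: "(\<lambda>\<alpha>. l2_norm N (G \<alpha> - d k)) \<in> borel_measurable m" for k
    by (rule measurable_l2_norm_diff[OF G d(2)])
  have [measurable]: "d k \<in> borel_measurable N" for k using d(2) by (simp add: L2_def)
  define e :: "nat \<Rightarrow> real" where "e n = inverse (real (Suc n))" for n
  have e: "e n > 0" "e n \<le> 1" for n by (auto simp: e_def inverse_le_1_iff)
  \<comment> \<open>The first dense vector within \<open>e n\<close> of \<open>G \<alpha>\<close>.
    Taking the least index makes the selection measurable.\<close>
  define k where "k n \<alpha> = (LEAST k. l2_norm N (G \<alpha> - d k) < e n)" for n \<alpha>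
  have k[measurable]: "k n \<in> m \<rightarrow>\<^sub>M count_space UNIV" for n
    unfolding k_def by measurable
  have kd: "l2_norm N (G \<alpha> - d (k n \<alpha>)) < e n" if "\<alpha> \<in> space m" for n \<alpha>
    unfolding k_def by (rule LeastI_ex[OF dense[OF GL[OF that] e(1)]])
  define F where "F n \<alpha> = d (k n \<alpha>)" for n \<alpha>
  have Fm[measurable]: "case_prod (F n) \<in> borel_measurable (m \<Otimes>\<^sub>M N)" for n
  proof -
    have "(\<lambda>p. (\<lambda>j p. d j (snd p)) (k n (fst p)) p) \<in> borel_measurable (m \<Otimes>\<^sub>M N)"
      by (rule measurable_compose_countable) measurable
    then show ?thesis by (simp add: F_def case_prod_beta')
  qed
  have F: "F n \<in> L2_vec m N" for n
    unfolding L2_vec_def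
  proof (intro CollectI conjI ballI)
    show "(\<lambda>(\<alpha>, x). F n \<alpha> x) \<in> borel_measurable (m \<Otimes>\<^sub>M N)" by (rule Fm)
    show "F n \<alpha> \<in> L2 N" for \<alpha> using d by (simp add: F_def)
    show "integrable m (\<lambda>\<alpha>. (l2_norm N (F n \<alpha>))\<^sup>2)"
    proof (rule integrable_const_bound[where B="(B + 1)\<^sup>2"])
      show "AE \<alpha> in m. norm ((l2_norm N (F n \<alpha>))\<^sup>2) \<le> (B + 1)\<^sup>2"
      proof (rule AE_I2)
        fix \<alpha> assume \<alpha>: "\<alpha> \<in> space m"
        have "l2_norm N (d (k n \<alpha>)) \<le> l2_norm N (G \<alpha>) + l2_norm N (G \<alpha> - d (k n \<alpha>))"
          using l2_norm_triangle_rev[OF GL[OF \<alpha>] d(2)[of "k n \<alpha>"]] by linarith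
        then have "l2_norm N (F n \<alpha>) \<le> B + 1" unfolding F_def using B[OF \<alpha>] kd[OF \<alpha>, of n] e(2)[of n] by linarith
        then show "norm ((l2_norm N (F n \<alpha>))\<^sup>2) \<le> (B + 1)\<^sup>2" by (simp add: power_mono)
      qed
      show "(\<lambda>\<alpha>. (l2_norm N (F n \<alpha>))\<^sup>2) \<in> borel_measurable m"
        using measurable_l2_norm_fiber[OF Fm[of n]] by measurable
    qed
  qed
  have close: "l2_norm N (F i \<alpha> - F j \<alpha>) \<le> e i + e j" if \<alpha>: "\<alpha> \<in> space m" for i j \<alpha>
  proof -
    have "l2_norm N (F i \<alpha> - F j \<alpha>) \<le> l2_norm N (F i \<alpha> - G \<alpha>) + l2_norm N (G \<alpha> - F j \<alpha>)"
      by (rule l2_norm_triangle_diff) (auto simp: F_def d GL[OF \<alpha>])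
    moreover have "l2_norm N (F i \<alpha> - G \<alpha>) = l2_norm N (G \<alpha> - d (k i \<alpha>))"
      unfolding F_def by (rule l2_norm_diff_commute)
    moreover have "l2_norm N (G \<alpha> - F j \<alpha>) = l2_norm N (G \<alpha> - d (k j \<alpha>))" unfolding F_def ..
    ultimately show ?thesis using kd[OF \<alpha>, of i] kd[OF \<alpha>, of j] by linarith
  qed
  obtain H where H: "H \<in> L2_vec m N" "(\<lambda>n. l2_norm (m \<Otimes>\<^sub>M N) (case_prod (F n) - case_prod H)) \<longlonglongrightarrow> 0"
  proof (rule L2_vec_complete[of F, OF F])
    fix \<epsilon> :: real assume \<epsilon>: "\<epsilon> > 0"
    \<comment> \<open>A field bounded by 2 \<delta> in every fibre has squared norm at most 4
      \<delta>^2 times the total mass, so \<delta> is chosen with 4 \<delta>^2 = \<epsilon>^2 / M.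
      Exceeding the total mass by 1 keeps \<open>M\<close> positive and the estimate strict.\<close>
    define M where "M = measure m (space m) + 1"
    have M: "M > 0" unfolding M_def by (intro add_nonneg_pos) auto
    define \<delta> where "\<delta> = \<epsilon> / (2 * sqrt M)"
    have \<delta>: "\<delta> > 0" using \<epsilon> M by (simp add: \<delta>_def)
    obtain K where K: "e K < \<delta>" using reals_Archimedean[OF \<delta>] by (auto simp: e_def)
    have eK: "e i < \<delta>" if "i \<ge> K" for i
    proof -
      have "e i \<le> e K" unfolding e_def using that by (intro le_imp_inverse_le) auto
      then show ?thesis using K by linarith
    qed
    have "l2_norm (m \<Otimes>\<^sub>M N) (case_prod (F i) - case_prod (F j)) < \<epsilon>" if "i \<ge> K" "j \<ge> K" for i j
    proof (rule power2_less_imp_less)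
      have FF: "F i - F j \<in> L2_vec m N" by (rule L2_vec_diff[OF F F])
      have "(l2_norm (m \<Otimes>\<^sub>M N) (case_prod (F i) - case_prod (F j)))\<^sup>2 = (\<integral>\<alpha>. (l2_norm N ((F i - F j) \<alpha>))\<^sup>2 \<partial>m)"
        unfolding case_prod_diff by (rule L2_vec_norm[OF FF])
      also have "\<dots> \<le> (\<integral>\<alpha>. (2 * \<delta>)\<^sup>2 \<partial>m)"
      proof (rule Bochner_Integration.integral_mono[OF L2_vec_integrable[OF FF]])
        fix \<alpha> assume "\<alpha> \<in> space m"
        then have "l2_norm N ((F i - F j) \<alpha>) \<le> 2 * \<delta>"
          using close[of \<alpha> i j] eK[OF that(1)] eK[OF that(2)] unfolding minus_apply by linarith
        then show "(l2_norm N ((F i - F j) \<alpha>))\<^sup>2 \<le> (2 * \<delta>)\<^sup>2" by (intro power_mono) auto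
      qed simp
      also have "\<dots> = measure m (space m) * (\<epsilon>\<^sup>2 / M)"
        using M by (simp add: \<delta>_def power_divide power_mult_distrib)
      also have "\<dots> < M * (\<epsilon>\<^sup>2 / M)"
        using \<epsilon> M by (intro mult_strict_right_mono) (auto simp: M_def)
      finally show "(l2_norm (m \<Otimes>\<^sub>M N) (case_prod (F i) - case_prod (F j)))\<^sup>2 < \<epsilon>\<^sup>2" using M by simp
    qed (use \<epsilon> in simp)
    then show "\<exists>K. \<forall>i\<ge>K. \<forall>j\<ge>K. l2_norm (m \<Otimes>\<^sub>M N) (case_prod (F i) - case_prod (F j)) < \<epsilon>" by blast
  qed blast
  obtain r where r: "strict_mono r" "AE \<alpha> in m. (\<lambda>n. l2_norm N (F (r n) \<alpha> - H \<alpha>)) \<longlonglongrightarrow> 0"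
    using L2_vec_limit_fiberwise[OF F H] by blast
  from r(2) AE_space have "AE \<alpha> in m. l2_norm N (H \<alpha> - G \<alpha>) = 0"
  proof eventually_elim
    case (elim \<alpha>)
    \<comment> \<open>The approximants tend to \<open>G\<close> uniformly with error
      \<open>e\<close>, and to \<open>H\<close> in this fibre along the subsequence, so the two
      limits are at distance zero.\<close>
    have "(\<lambda>n. e (r n)) \<longlonglongrightarrow> 0"
      using LIMSEQ_subseq_LIMSEQ[OF LIMSEQ_inverse_real_of_nat r(1)] by (simp add: e_def comp_def)
    then have "(\<lambda>n. l2_norm N (F (r n) \<alpha> - H \<alpha>) + e (r n)) \<longlonglongrightarrow> 0 + 0" using elim(1) by (intro tendsto_add)
    moreover have "l2_norm N (H \<alpha> - G \<alpha>) \<le> l2_norm N (F (r n) \<alpha> - H \<alpha>) + e (r n)" for n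
    proof -
      have "l2_norm N (H \<alpha> - G \<alpha>) \<le> l2_norm N (H \<alpha> - F (r n) \<alpha>) + l2_norm N (F (r n) \<alpha> - G \<alpha>)"
        by (rule l2_norm_triangle_diff) (auto simp: F_def d GL[OF elim(2)] L2_vec_fiber[OF H(1) elim(2)])
      moreover have "l2_norm N (F (r n) \<alpha> - G \<alpha>) = l2_norm N (G \<alpha> - d (k (r n) \<alpha>))"
        unfolding F_def by (rule l2_norm_diff_commute)
      ultimately show ?thesis using kd[OF elim(2), of "r n"] l2_norm_diff_commute[of N "H \<alpha>" "F (r n) \<alpha>"] by linarith
    qed
    ultimately have "l2_norm N (H \<alpha> - G \<alpha>) \<le> 0 + 0" by (intro LIMSEQ_le_const) auto
    then show ?case using l2_norm_nonneg[of N "H \<alpha> - G \<alpha>"] by linarith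
  qed
  with H(1) show thesis by (rule that)
qed

end

section \<open>Quasi-invariant actions with a tiling set\<close>

locale tiling_action = sigma_finite_measure M
  for M :: "'x measure" +
  fixes \<sigma> :: "'g::{ab_group_add,countable} \<Rightarrow> 'x \<Rightarrow> 'x" and Jac :: "'g \<Rightarrow> 'x \<Rightarrow> real" and C :: "'x set"
  assumes act: "measurable_action M \<sigma>" and jac: "is_jacobian M \<sigma> Jac" and tile: "tiling_set M \<sigma> C"
begin

lemma measurable_act [measurable]: "\<sigma> a \<in> M \<rightarrow>\<^sub>M M"
  using act by (simp add: measurable_action_def)

lemma act_space: "x \<in> space M \<Longrightarrow> \<sigma> a x \<in> space M"
  using measurable_space[OF measurable_act] by blast

lemma act_act: "x \<in> space M \<Longrightarrow> \<sigma> a (\<sigma> b x) = \<sigma> (a + b) x"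
  using act by (simp add: measurable_action_def)

lemma act_zero: "x \<in> space M \<Longrightarrow> \<sigma> 0 x = x"
  using act by (simp add: measurable_action_def)

lemma C_sets [measurable]: "C \<in> sets M"
  using tile by (simp add: tiling_set_def)

lemma Jac_pos: "x \<in> space M \<Longrightarrow> 0 < Jac a x"
  using jac by (simp add: is_jacobian_def)

lemma measurable_Jac [measurable]: "Jac a \<in> borel_measurable M"
proof -
  have "(\<lambda>(a, x). Jac a x) \<in> borel_measurable (count_space UNIV \<Otimes>\<^sub>M M)"
    using jac by (simp add: is_jacobian_def)
  from measurable_compose[OF measurable_Pair1'[of a "count_space UNIV" M] this]
  show ?thesis by simp
qed

lemma act_image_eq:
  assumes "E \<subseteq> space M" shows "\<sigma> a ` E = \<sigma> (- a) -` E \<inter> space M"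
proof (intro equalityI subsetI)
  fix y assume "y \<in> \<sigma> a ` E"
  then obtain x where x: "x \<in> E" "y = \<sigma> a x" by blast
  then have "x \<in> space M" using assms by blast
  then show "y \<in> \<sigma> (- a) -` E \<inter> space M" using x by (simp add: act_act act_zero act_space)
next
  fix y assume y: "y \<in> \<sigma> (- a) -` E \<inter> space M"
  then have "y = \<sigma> a (\<sigma> (- a) y)" by (simp add: act_act act_zero)
  then show "y \<in> \<sigma> a ` E" using y by blast
qed

lemma act_image_sets: "E \<in> sets M \<Longrightarrow> \<sigma> a ` E \<in> sets M"
  using act_image_eq[OF sets.sets_into_space] measurable_sets[OF measurable_act] by metis

text \<open>The Jacobian describes images under \<sigma> a, which are preimages under \<sigma> (-
  a); hence the sign.\<close>

lemma distr_act: "distr M M (\<sigma> (- a)) = density M (\<lambda>x. ennreal (Jac a x))"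
proof (rule measure_eqI)
  fix E assume "E \<in> sets (distr M M (\<sigma> (- a)))"
  then have E: "E \<in> sets M" by simp
  have "emeasure (distr M M (\<sigma> (- a))) E = emeasure M (\<sigma> a ` E)"
    unfolding act_image_eq[OF sets.sets_into_space[OF E]] by (rule emeasure_distr[OF measurable_act E])
  also have "\<dots> = emeasure (density M (\<lambda>x. ennreal (Jac a x))) E"
    using jac E by (simp add: is_jacobian_def emeasure_density)
  finally show "emeasure (distr M M (\<sigma> (- a))) E = emeasure (density M (\<lambda>x. ennreal (Jac a x))) E" .
qed simp

lemma nn_integral_act:
  assumes [measurable]: "f \<in> borel_measurable M"
  shows "(\<integral>\<^sup>+x. f (\<sigma> (- a) x) \<partial>M) = (\<integral>\<^sup>+x. ennreal (Jac a x) * f x \<partial>M)"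
proof -
  have "(\<integral>\<^sup>+x. f (\<sigma> (- a) x) \<partial>M) = (\<integral>\<^sup>+x. f x \<partial>distr M M (\<sigma> (- a)))"
    by (rule nn_integral_distr[symmetric]) auto
  also have "\<dots> = (\<integral>\<^sup>+x. ennreal (Jac a x) * f x \<partial>M)"
    unfolding distr_act by (rule nn_integral_density) auto
  finally show ?thesis .
qed

lemma nn_integral_act':
  assumes "f \<in> borel_measurable M"
  shows "(\<integral>\<^sup>+x. f (\<sigma> a x) \<partial>M) = (\<integral>\<^sup>+x. ennreal (Jac (- a) x) * f x \<partial>M)"
  using nn_integral_act[OF assms, of "- a"] by simp

lemma Jac_zero: "AE x in M. Jac 0 x = 1"
proof -
  have "AE x in M. ennreal (Jac 0 x) = 1"
  proof (rule density_unique2)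
    fix A assume [measurable]: "A \<in> sets M"
    have "(\<integral>\<^sup>+x\<in>A. ennreal (Jac 0 x) \<partial>M) = (\<integral>\<^sup>+x. indicator A (\<sigma> (- 0) x) \<partial>M)"
      by (subst nn_integral_act) auto
    also have "\<dots> = (\<integral>\<^sup>+x\<in>A. 1 \<partial>M)"
      by (intro nn_integral_cong) (simp add: act_zero)
    finally show "(\<integral>\<^sup>+x\<in>A. ennreal (Jac 0 x) \<partial>M) = (\<integral>\<^sup>+x\<in>A. 1 \<partial>M)" .
  qed simp_all
  with AE_space show ?thesis
    by eventually_elim (use Jac_pos in \<open>auto simp: ennreal_eq_1\<close>)
qed

text \<open>The chain rule. Both sides are densities of one image measure, and these are unique
  almost everywhere on a sigma-finite space. The Jacobian being given only through integrals, the
  identity holds off a null set depending on the pair; countability of the group later allows one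
  null set for all pairs.\<close>

lemma Jac_cocycle: "AE x in M. Jac (a + b) x = Jac a (\<sigma> b x) * Jac b x"
proof -
  have "AE x in M. ennreal (Jac (a + b) x) = ennreal (Jac a (\<sigma> b x)) * ennreal (Jac b x)"
  proof (rule density_unique2)
    fix A assume [measurable]: "A \<in> sets M"
    have "(\<integral>\<^sup>+x\<in>A. ennreal (Jac (a + b) x) \<partial>M) = (\<integral>\<^sup>+x. indicator A (\<sigma> (- (a + b)) x) \<partial>M)"
      by (subst nn_integral_act) auto
    also have "\<dots> = (\<integral>\<^sup>+x. indicator A (\<sigma> (- b) (\<sigma> (- a) x)) \<partial>M)"
      by (intro nn_integral_cong) (simp add: act_act add.commute)
    also have "\<dots> = (\<integral>\<^sup>+x. ennreal (Jac a x) * indicator A (\<sigma> (- b) x) \<partial>M)"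
      by (rule nn_integral_act) measurable
    \<comment> \<open>Writing x as \<sigma> b (\<sigma> (- b) x) makes the integrand a function of
      \<sigma> (- b) x, ready for the change of variables by \<open>b\<close>.\<close>
    also have "\<dots> = (\<integral>\<^sup>+x. (\<lambda>y. ennreal (Jac a (\<sigma> b y)) * indicator A y) (\<sigma> (- b) x) \<partial>M)"
      by (intro nn_integral_cong) (simp add: act_act act_zero)
    also have "\<dots> = (\<integral>\<^sup>+x. ennreal (Jac b x) * (ennreal (Jac a (\<sigma> b x)) * indicator A x) \<partial>M)"
      by (rule nn_integral_act) measurable
    finally show "(\<integral>\<^sup>+x\<in>A. ennreal (Jac (a + b) x) \<partial>M) = (\<integral>\<^sup>+x\<in>A. ennreal (Jac a (\<sigma> b x)) * ennreal (Jac b x) \<partial>M)"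
      by (simp add: mult_ac)
  qed simp_all
  with AE_space show ?thesis
  proof eventually_elim
    case (elim x)
    then show ?case
      using Jac_pos[of x "a + b"] Jac_pos[of x b] Jac_pos[of "\<sigma> b x" a] act_space
      by (simp add: ennreal_mult[symmetric] ennreal_inj)
  qed
qed

section \<open>The representation and the tiles\<close>

abbreviation R :: "'g \<Rightarrow> ('x \<Rightarrow> complex) \<Rightarrow> 'x \<Rightarrow> complex" where
  "R \<equiv> rep \<sigma> Jac"

lemma rep_add: "R a (f + g) = R a f + R a g"
  by (auto simp: rep_def fun_eq_iff algebra_simps)

lemma rep_scale: "R a (\<lambda>x. c * f x) = (\<lambda>x. c * R a f x)"
  by (auto simp: rep_def fun_eq_iff algebra_simps)

lemma rep_measurable [measurable]:
  assumes f: "f \<in> borel_measurable M" shows "R a f \<in> borel_measurable M"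
proof -
  have [measurable]: "(\<lambda>x. f (\<sigma> (- a) x)) \<in> borel_measurable M"
    by (rule measurable_compose[OF measurable_act f])
  show ?thesis unfolding rep_def[abs_def] by measurable
qed

lemma cmod_rep_sq:
  "x \<in> space M \<Longrightarrow> ennreal ((cmod (R a f x))\<^sup>2) = ennreal (Jac (- a) x) * ennreal ((cmod (f (\<sigma> (- a) x)))\<^sup>2)"
  using Jac_pos[of x "- a"] by (simp add: rep_def norm_mult power_mult_distrib ennreal_mult)

text \<open>The square root of the Jacobian, once squared, absorbs the change of variables. Taking
  \<open>E\<close> to be the whole space shows that translation preserves the norm; taking the tile
  identifies the mass of \<open>R a f\<close> on \<open>C\<close> with the mass of \<open>f\<close>
  on the translate of \<open>C\<close> by - a.\<close>

lemma nn_integral_rep_indicator: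
  assumes [measurable]: "f \<in> borel_measurable M" "E \<in> sets M"
  shows "(\<integral>\<^sup>+x. ennreal ((cmod (R a f x))\<^sup>2) * indicator E x \<partial>M)
    = (\<integral>\<^sup>+x. ennreal ((cmod (f x))\<^sup>2) * indicator E (\<sigma> a x) \<partial>M)"
proof -
  have "(\<integral>\<^sup>+x. ennreal ((cmod (f x))\<^sup>2) * indicator E (\<sigma> a x) \<partial>M)
      = (\<integral>\<^sup>+x. (\<lambda>y. ennreal ((cmod (f (\<sigma> (- a) y)))\<^sup>2) * indicator E y) (\<sigma> a x) \<partial>M)"
    by (intro nn_integral_cong) (simp add: act_act act_zero)
  also have "\<dots> = (\<integral>\<^sup>+x. ennreal (Jac (- a) x) * (ennreal ((cmod (f (\<sigma> (- a) x)))\<^sup>2) * indicator E x) \<partial>M)"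
    by (rule nn_integral_act') measurable
  also have "\<dots> = (\<integral>\<^sup>+x. ennreal ((cmod (R a f x))\<^sup>2) * indicator E x \<partial>M)"
    by (intro nn_integral_cong) (simp add: cmod_rep_sq mult.assoc)
  finally show ?thesis ..
qed

lemma rep_L2:
  assumes "f \<in> L2 M" shows "R a f \<in> L2 M"
proof -
  have [measurable]: "f \<in> borel_measurable M" using assms by (simp add: L2_def)
  have "(\<integral>\<^sup>+x. ennreal ((cmod (R a f x))\<^sup>2) \<partial>M) = (\<integral>\<^sup>+x. ennreal ((cmod (R a f x))\<^sup>2) * indicator (space M) x \<partial>M)"
    by (intro nn_integral_cong) simp
  also have "\<dots> = (\<integral>\<^sup>+x. ennreal ((cmod (f x))\<^sup>2) * indicator (space M) (\<sigma> a x) \<partial>M)"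
    by (rule nn_integral_rep_indicator) auto
  also have "\<dots> = (\<integral>\<^sup>+x. ennreal ((cmod (f x))\<^sup>2) \<partial>M)"
    by (intro nn_integral_cong) (simp add: act_space)
  finally show ?thesis using assms by (simp add: L2_iff_nn)
qed

lemma rep_rep: "AE x in M. R b (R a f) x = R (a + b) f x"
  using Jac_cocycle[of "- a" "- b"] AE_space
proof eventually_elim
  case (elim x)
  then have "sqrt (Jac (- (a + b)) x) = sqrt (Jac (- b) x) * sqrt (Jac (- a) (\<sigma> (- b) x))"
    by (simp add: real_sqrt_mult[symmetric] mult.commute)
  then show ?case using elim(2) by (simp add: rep_def act_act mult.assoc)
qed

lemma rep_zero: "AE x in M. R 0 f x = f x"
  using Jac_zero AE_space by eventually_elim (simp add: rep_def act_zero)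

text \<open>The null overlaps and the null gap are countably many, so they can be discarded
  together; what remains is that the orbit of almost every point meets the tile exactly
  once.\<close>

lemma AE_unique_tile: "AE x in M. \<exists>a. \<forall>b. \<sigma> b x \<in> C \<longleftrightarrow> b = a"
proof -
  have CM: "C \<subseteq> space M" using sets.sets_into_space[OF C_sets] .
  have mem: "x \<in> \<sigma> a ` C \<longleftrightarrow> \<sigma> (- a) x \<in> C" if "x \<in> space M" for x a
    using act_image_eq[OF CM, of a] that by auto
  have "AE x in M. x \<notin> space M - (\<Union>a. \<sigma> a ` C)"
    by (rule AE_not_in) (use tile in \<open>auto simp: tiling_set_def null_sets_def intro!: act_image_sets sets.Diff sets.countable_UN''\<close>)
  moreover have "AE x in M. \<forall>a. \<forall>b. a \<noteq> b \<longrightarrow> x \<notin> \<sigma> a ` C \<inter> \<sigma> b ` C"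
    unfolding AE_all_countable
  proof (intro allI)
    fix a b
    show "AE x in M. a \<noteq> b \<longrightarrow> x \<notin> \<sigma> a ` C \<inter> \<sigma> b ` C"
    proof (cases "a = b")
      case False
      have "AE x in M. x \<notin> \<sigma> a ` C \<inter> \<sigma> b ` C"
        by (rule AE_not_in)
          (use tile False in \<open>auto simp: tiling_set_def null_sets_def intro!: act_image_sets sets.Int\<close>)
      then show ?thesis by eventually_elim blast
    qed simp
  qed
  ultimately show ?thesis using AE_space
  proof eventually_elim
    case (elim x)
    then obtain a where a: "\<sigma> (- a) x \<in> C" using mem by auto
    have "\<sigma> b x \<in> C \<longleftrightarrow> b = - a" for b
    proof
      assume "\<sigma> b x \<in> C"
      then have "\<sigma> (- (- b)) x \<in> C" by simp
      then show "b = - a"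
        using elim(2) mem[OF elim(3)] a by (metis IntI minus_minus)
    qed (use a in simp)
    then show ?case by blast
  qed
qed

abbreviation N :: "'x measure" where "N \<equiv> restrict_space M C"

lemma C_Int_space: "C \<inter> space M = C"
  using sets.sets_into_space[OF C_sets] by blast

lemma space_N: "space N = C"
  using C_Int_space by (simp add: space_restrict_space)

lemma AE_N: "AE x in M. P x \<Longrightarrow> AE x in N. P x"
  using C_sets C_Int_space by (subst AE_restrict_space_iff) auto

lemma L2_N: "f \<in> L2 M \<Longrightarrow> f \<in> L2 N"
  by (rule L2_restrict_spaceI[OF C_sets])

lemma nn_integral_N: "(\<integral>\<^sup>+x. f x \<partial>N) = (\<integral>\<^sup>+x. f x * indicator C x \<partial>M)"
  by (rule nn_integral_restrict_space) (simp add: C_Int_space)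

lemma sigma_finite_N: "sigma_finite_measure N"
  by (rule sigma_finite_measure_restrict_space[OF sigma_finite_measure_axioms]) simp

text \<open>The translates of \<open>f\<close>, restricted to the tile, account for \<open>f\<close>
  on all tiles. After exchanging sum and integral, exactly one summand survives at almost every
  point.\<close>

lemma nn_integral_tiles:
  assumes [measurable]: "f \<in> borel_measurable M"
  shows "(\<integral>\<^sup>+a. \<integral>\<^sup>+x. ennreal ((cmod (R a f x))\<^sup>2) \<partial>N \<partial>count_space UNIV) = (\<integral>\<^sup>+x. ennreal ((cmod (f x))\<^sup>2) \<partial>M)"
proof -
  have "(\<integral>\<^sup>+a. \<integral>\<^sup>+x. ennreal ((cmod (R a f x))\<^sup>2) \<partial>N \<partial>count_space UNIV)
      = (\<integral>\<^sup>+a. \<integral>\<^sup>+x. ennreal ((cmod (f x))\<^sup>2) * indicator C (\<sigma> a x) \<partial>M \<partial>count_space UNIV)"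
    unfolding nn_integral_N by (intro nn_integral_cong nn_integral_rep_indicator) auto
  also have "\<dots> = (\<integral>\<^sup>+x. \<integral>\<^sup>+a. ennreal ((cmod (f x))\<^sup>2) * indicator C (\<sigma> a x) \<partial>count_space UNIV \<partial>M)"
    by (rule nn_integral_count_space_nn_integral[symmetric]) auto
  also have "\<dots> = (\<integral>\<^sup>+x. ennreal ((cmod (f x))\<^sup>2) \<partial>M)"
    using AE_unique_tile
  proof (intro nn_integral_cong_AE, eventually_elim)
    case (elim x)
    then obtain a where "\<And>b. \<sigma> b x \<in> C \<longleftrightarrow> b = a" by blast
    then have "(\<lambda>b. ennreal ((cmod (f x))\<^sup>2) * indicator C (\<sigma> b x)) = (\<lambda>b. ennreal ((cmod (f x))\<^sup>2) * indicator {a} b)"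
      by (auto simp: indicator_def fun_eq_iff)
    then show ?case by simp
  qed
  finally show ?thesis .
qed

lemma nn_integral_N_tiles:
  assumes [measurable]: "f \<in> borel_measurable M"
  shows "(\<integral>\<^sup>+x. \<integral>\<^sup>+a. ennreal ((cmod (R a f x))\<^sup>2) \<partial>count_space UNIV \<partial>N) = (\<integral>\<^sup>+x. ennreal ((cmod (f x))\<^sup>2) \<partial>M)"
  unfolding nn_integral_tiles[OF assms, symmetric]
  by (rule nn_integral_count_space_nn_integral) (auto intro!: measurable_restrict_space1)

end

section \<open>The Fourier transform of square-summable sequences\<close>

text \<open>An increasing exhaustion by finite sets, used to replace nets over finite subsets by
  sequences and so to reach dominated and monotone convergence and subsequences.\<close>

definition first_elements :: "nat \<Rightarrow> 'g::countable set" where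
  "first_elements n = {a. to_nat a < n}"

lemma finite_first_elements [simp]: "finite (first_elements n)"
  unfolding first_elements_def
  by (rule inj_on_finite[of to_nat _ "{..<n}"]) (auto intro: inj_onI)

lemma first_elements_mono: "i \<le> j \<Longrightarrow> first_elements i \<subseteq> first_elements j"
  by (auto simp: first_elements_def)

lemma first_elements_superset:
  assumes "finite X" obtains n where "X \<subseteq> first_elements n"
proof -
  have "X \<subseteq> first_elements (Suc (\<Sum>a\<in>X. to_nat a))"
  proof
    fix a assume "a \<in> X"
    then have "to_nat a \<le> (\<Sum>a\<in>X. to_nat a)" using assms by (intro member_le_sum) auto
    then show "a \<in> first_elements (Suc (\<Sum>a\<in>X. to_nat a))" by (simp add: first_elements_def)
  qed
  then show thesis by (rule that)
qed

lemma filterlim_first_elements: "filterlim first_elements (finite_subsets_at_top UNIV) sequentially"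
  unfolding filterlim_finite_subsets_at_top
proof (intro allI impI)
  fix X :: "'a set" assume "finite X \<and> X \<subseteq> UNIV"
  then have X: "finite X" by simp
  obtain n where n: "X \<subseteq> first_elements n" by (rule first_elements_superset[OF X])
  then show "\<forall>\<^sub>F i in sequentially. finite (first_elements i :: 'a set) \<and> X \<subseteq> first_elements i \<and> first_elements i \<subseteq> (UNIV :: 'a set)"
    unfolding eventually_sequentially
    by (intro exI[of _ n] allI impI conjI order_trans[OF n first_elements_mono]) auto
qed

lemma nn_integral_count_space_first_elements:
  fixes f :: "'g::countable \<Rightarrow> real"
  assumes "\<And>a. f a \<ge> 0"
  shows "(\<lambda>n. ennreal (\<Sum>a\<in>first_elements n. f a)) \<longlonglongrightarrow> (\<integral>\<^sup>+a. ennreal (f a) \<partial>count_space UNIV)"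
proof -
  have eq: "ennreal (\<Sum>a\<in>first_elements n. f a)
      = (\<integral>\<^sup>+a. ennreal (f a) * indicator (first_elements n) a \<partial>count_space UNIV)" for n
  proof -
    have "ennreal (\<Sum>a\<in>first_elements n. f a) = (\<Sum>a\<in>first_elements n. ennreal (f a))"
      using assms by (simp add: sum_ennreal)
    also have "\<dots> = (\<integral>\<^sup>+a. ennreal (f a) \<partial>count_space (first_elements n))"
      by (simp add: nn_integral_count_space_finite)
    finally show ?thesis by (simp add: nn_integral_count_space_indicator)
  qed
  have inc: "incseq (\<lambda>n. \<lambda>a. ennreal (f a) * indicator (first_elements n) a)"
    using first_elements_mono by (auto simp: incseq_def le_fun_def indicator_def)
  have "(\<integral>\<^sup>+a. ennreal (f a) \<partial>count_space UNIV)
      = (\<integral>\<^sup>+a. (SUP n. ennreal (f a) * indicator (first_elements n) a) \<partial>count_space UNIV)"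
  proof (rule nn_integral_cong)
    fix a
    show "ennreal (f a) = (SUP n. ennreal (f a) * indicator (first_elements n) a)"
    proof (rule antisym)
      have "ennreal (f a) = ennreal (f a) * indicator (first_elements (Suc (to_nat a))) a"
        by (simp add: first_elements_def)
      also have "\<dots> \<le> (SUP n. ennreal (f a) * indicator (first_elements n) a)" by (rule SUP_upper) simp
      finally show "ennreal (f a) \<le> (SUP n. ennreal (f a) * indicator (first_elements n) a)" .
      show "(SUP n. ennreal (f a) * indicator (first_elements n) a) \<le> ennreal (f a)"
        by (rule SUP_least) (auto simp: indicator_def)
    qed
  qed
  also have "\<dots> = (SUP n. \<integral>\<^sup>+a. ennreal (f a) * indicator (first_elements n) a \<partial>count_space UNIV)"
    by (rule nn_integral_monotone_convergence_SUP[OF inc]) simp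
  finally show ?thesis
    unfolding eq
    using LIMSEQ_SUP[of "\<lambda>n. \<integral>\<^sup>+a. ennreal (f a) * indicator (first_elements n) a \<partial>count_space UNIV"] inc
    by (simp add: incseq_def le_fun_def nn_integral_mono)
qed

text \<open>Here \<open>T\<close> is the sum of the family \<open>f\<close>.\<close>
lemma finite_total_sum:
  fixes f :: "'g::countable \<Rightarrow> real"
  assumes f: "\<And>a. f a \<ge> 0" and fin: "(\<integral>\<^sup>+a. ennreal (f a) \<partial>count_space UNIV) < \<infinity>"
  obtains T where "\<And>X. finite X \<Longrightarrow> (\<Sum>a\<in>X. f a) \<le> T" "(\<lambda>n. \<Sum>a\<in>first_elements n. f a) \<longlonglongrightarrow> T"
proof -
  obtain T where T: "T \<ge> 0" "(\<integral>\<^sup>+a. ennreal (f a) \<partial>count_space UNIV) = ennreal T"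
    using fin by (cases "\<integral>\<^sup>+a. ennreal (f a) \<partial>count_space UNIV") auto
  have lim: "(\<lambda>n. \<Sum>a\<in>first_elements n. f a) \<longlonglongrightarrow> T"
    using nn_integral_count_space_first_elements[of f] f T by (simp add: sum_nonneg)
  have "(\<Sum>a\<in>X. f a) \<le> T" if X: "finite X" for X
  proof -
    obtain n where n: "X \<subseteq> first_elements n" by (rule first_elements_superset[OF X])
    have "(\<Sum>a\<in>X. f a) \<le> (\<Sum>a\<in>first_elements i. f a)" if "i \<ge> n" for i
      using n first_elements_mono[OF that] f by (intro sum_mono2) auto
    then show ?thesis by (intro LIMSEQ_le_const[OF lim]) blast
  qed
  then show thesis using lim by (rule that)
qed

section \<open>Orthonormal sums and the rules for the Fourier transform\<close>

context haar
begin

definition trig_sum :: "('g \<Rightarrow> complex) \<Rightarrow> 'g set \<Rightarrow> ('g \<Rightarrow> complex) \<Rightarrow> complex" where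
  "trig_sum c X = (\<lambda>\<alpha>. \<Sum>a\<in>X. c a * \<alpha> (- a))"

lemma eval_L2: "(\<lambda>\<alpha>. \<alpha> a) \<in> L2 m"
  unfolding L2_def
  by (auto intro!: integrable_const_bound[where B=1] AE_I2 simp: space_m character_norm)

lemma l2_inner_eval: "l2_inner m (\<lambda>\<alpha>. \<alpha> a) (\<lambda>\<alpha>. \<alpha> b) = (if a = b then 1 else 0)"
  unfolding l2_inner_def by (rule integral_eval_cnj)

lemma trig_sum_insert:
  "finite X \<Longrightarrow> a \<notin> X \<Longrightarrow> trig_sum c (insert a X) = (\<lambda>\<alpha>. c a * \<alpha> (- a)) + trig_sum c X"
  by (auto simp: trig_sum_def fun_eq_iff)

lemma trig_sum_empty: "trig_sum c {} = 0"
  by (auto simp: trig_sum_def fun_eq_iff)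

lemma trig_sum_L2: "finite X \<Longrightarrow> trig_sum c X \<in> L2 m"
proof (induction X rule: finite_induct)
  case empty
  show ?case unfolding trig_sum_empty by (rule L2_zero)
next
  case (insert a X)
  show ?case unfolding trig_sum_insert[OF insert(1,2)]
    by (intro L2_add L2_cmult eval_L2 insert(3))
qed

lemma l2_inner_eval_trig_sum:
  "finite X \<Longrightarrow> a \<notin> X \<Longrightarrow> l2_inner m (\<lambda>\<alpha>. \<alpha> (- a)) (trig_sum c X) = 0"
proof (induction X rule: finite_induct)
  case empty
  show ?case unfolding trig_sum_empty by (rule l2_inner_zero)
next
  case (insert b X)
  then show ?case unfolding trig_sum_insert[OF insert(1,2)]
    by (subst l2_inner_add_right) (auto intro!: L2_cmult eval_L2 trig_sum_L2 simp: l2_inner_cmult_right l2_inner_eval)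
qed

lemma l2_norm_trig_sum: "finite X \<Longrightarrow> (l2_norm m (trig_sum c X))\<^sup>2 = (\<Sum>a\<in>X. (cmod (c a))\<^sup>2)"
proof (induction X rule: finite_induct)
  case empty
  show ?case unfolding trig_sum_empty by (simp only: l2_norm_zero sum.empty zero_power2)
next
  case (insert a X)
  have "(l2_norm m (\<lambda>\<alpha>. \<alpha> (- a)))\<^sup>2 = 1"
    using l2_inner_self[of m "\<lambda>\<alpha>. \<alpha> (- a)"] l2_inner_eval[of "- a" "- a"] of_real_eq_1_iff by metis
  then show ?case unfolding trig_sum_insert[OF insert(1,2)]
    by (subst l2_norm_add_sq) (auto intro!: L2_cmult eval_L2 trig_sum_L2
      simp: insert l2_inner_cmult_left l2_inner_eval_trig_sum l2_norm_cmult power_mult_distrib)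
qed

lemma trig_sum_diff: "finite X \<Longrightarrow> Y \<subseteq> X \<Longrightarrow> trig_sum c X - trig_sum c Y = trig_sum c (X - Y)"
  by (auto simp: trig_sum_def fun_eq_iff sum_diff)

lemma is_fourier_iff:
  "is_fourier m c g \<longleftrightarrow> g \<in> L2 m \<and> ((\<lambda>X. l2_norm m (trig_sum c X - g)) \<longlongrightarrow> 0) (finite_subsets_at_top UNIV)"
  unfolding is_fourier_def trig_sum_def fun_diff_def ..

text \<open>Parseval for finite sums survives the limit along \<open>first_elements\<close>. In
  particular a sequence that has a transform is square-summable.\<close>

lemma is_fourier_norm:
  assumes "is_fourier m c g"
  shows "(\<integral>\<^sup>+a. ennreal ((cmod (c a))\<^sup>2) \<partial>count_space UNIV) = ennreal ((l2_norm m g)\<^sup>2)"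
proof -
  have g: "g \<in> L2 m" and lim: "((\<lambda>X. l2_norm m (trig_sum c X - g)) \<longlongrightarrow> 0) (finite_subsets_at_top UNIV)"
    using assms by (auto simp: is_fourier_iff)
  have "(\<lambda>n. l2_norm m (trig_sum c (first_elements n) - g)) \<longlonglongrightarrow> 0"
    by (rule filterlim_compose[OF lim filterlim_first_elements])
  then have "(\<lambda>n. l2_norm m (trig_sum c (first_elements n)) - l2_norm m g) \<longlonglongrightarrow> 0"
    by (rule Lim_null_comparison[rotated])
      (auto intro!: always_eventually l2_norm_triangle_rev trig_sum_L2 g)
  then have "(\<lambda>n. l2_norm m (trig_sum c (first_elements n))) \<longlonglongrightarrow> l2_norm m g"
    by (rule LIM_zero_cancel)
  then have "(\<lambda>n. ennreal ((l2_norm m (trig_sum c (first_elements n)))\<^sup>2)) \<longlonglongrightarrow> ennreal ((l2_norm m g)\<^sup>2)"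
    by (intro tendsto_ennrealI tendsto_power)
  then have "(\<lambda>n. ennreal (\<Sum>a\<in>first_elements n. (cmod (c a))\<^sup>2)) \<longlonglongrightarrow> ennreal ((l2_norm m g)\<^sup>2)"
    by (simp add: l2_norm_trig_sum)
  moreover have "(\<lambda>n. ennreal (\<Sum>a\<in>first_elements n. (cmod (c a))\<^sup>2)) \<longlonglongrightarrow> (\<integral>\<^sup>+a. ennreal ((cmod (c a))\<^sup>2) \<partial>count_space UNIV)"
    by (rule nn_integral_count_space_first_elements) simp
  ultimately show ?thesis by (metis LIMSEQ_unique)
qed

text \<open>The transform on an orbit will be obtained only along a subsequence of partial sums.
  Orthonormality restores unconditional convergence: adding terms to a finite set that already
  carries nearly all of the total square sum \<open>T\<close> changes the norm little.\<close>

lemma is_fourierI_subseq: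
  assumes fin: "(\<integral>\<^sup>+a. ennreal ((cmod (c a))\<^sup>2) \<partial>count_space UNIV) < \<infinity>" and g: "g \<in> L2 m"
    and r: "strict_mono r" and lim: "(\<lambda>n. l2_norm m (trig_sum c (first_elements (r n)) - g)) \<longlonglongrightarrow> 0"
  shows "is_fourier m c g"
  unfolding is_fourier_iff
proof (intro conjI g tendstoI)
  obtain T where T: "\<And>X. finite X \<Longrightarrow> (\<Sum>a\<in>X. (cmod (c a))\<^sup>2) \<le> T"
    "(\<lambda>n. \<Sum>a\<in>first_elements n. (cmod (c a))\<^sup>2) \<longlonglongrightarrow> T"
    using finite_total_sum[OF zero_le_power2 fin] by blast
  fix e :: real assume e: "e > 0"
  have "(\<lambda>n. \<Sum>a\<in>first_elements (r n). (cmod (c a))\<^sup>2) \<longlonglongrightarrow> T"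
    using LIMSEQ_subseq_LIMSEQ[OF T(2) r] by (simp add: comp_def)
  then have "\<forall>\<^sub>F n in sequentially. (\<Sum>a\<in>first_elements (r n). (cmod (c a))\<^sup>2) > T - (e/2)\<^sup>2"
    using e by (intro order_tendstoD(1)) auto
  moreover have "\<forall>\<^sub>F n in sequentially. l2_norm m (trig_sum c (first_elements (r n)) - g) < e/2"
    using e by (intro order_tendstoD(2)[OF lim]) auto
  ultimately have "\<forall>\<^sub>F n in sequentially. (\<Sum>a\<in>first_elements (r n). (cmod (c a))\<^sup>2) > T - (e/2)\<^sup>2 \<and>
      l2_norm m (trig_sum c (first_elements (r n)) - g) < e/2"
    by eventually_elim simp
  then obtain n where n: "(\<Sum>a\<in>first_elements (r n). (cmod (c a))\<^sup>2) > T - (e/2)\<^sup>2"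
    "l2_norm m (trig_sum c (first_elements (r n)) - g) < e/2"
    by (auto simp: eventually_sequentially)
  define Y :: "'g set" where "Y = first_elements (r n)"
  have "dist (l2_norm m (trig_sum c X - g)) 0 < e" if X: "finite X" "Y \<subseteq> X" for X
  proof -
    have "(l2_norm m (trig_sum c X - trig_sum c Y))\<^sup>2 = (\<Sum>a\<in>X - Y. (cmod (c a))\<^sup>2)"
      unfolding trig_sum_diff[OF X] using X by (intro l2_norm_trig_sum) auto
    also have "\<dots> = (\<Sum>a\<in>X. (cmod (c a))\<^sup>2) - (\<Sum>a\<in>Y. (cmod (c a))\<^sup>2)"
      by (rule sum_diff[OF X])
    also have "\<dots> < (e/2)\<^sup>2" using T(1)[OF X(1)] n(1) unfolding Y_def by linarith
    finally have "l2_norm m (trig_sum c X - trig_sum c Y) < e/2"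
      by (rule power2_less_imp_less) (use e in simp)
    moreover have "l2_norm m (trig_sum c X - g) \<le> l2_norm m (trig_sum c X - trig_sum c Y) + l2_norm m (trig_sum c Y - g)"
      using X by (intro l2_norm_triangle_diff trig_sum_L2 g) (auto simp: Y_def)
    ultimately show ?thesis using n(2) unfolding Y_def by simp
  qed
  then show "\<forall>\<^sub>F X in finite_subsets_at_top UNIV. dist (l2_norm m (trig_sum c X - g)) 0 < e"
    unfolding eventually_finite_subsets_at_top by (intro exI[of _ Y]) (auto simp: Y_def)
qed

lemma is_fourier_add:
  assumes "is_fourier m c g" "is_fourier m d h"
  shows "is_fourier m (\<lambda>a. c a + d a) (\<lambda>\<alpha>. g \<alpha> + h \<alpha>)"
proof -
  have gh: "g \<in> L2 m" "h \<in> L2 m" using assms by (auto simp: is_fourier_iff)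
  have "((\<lambda>X. l2_norm m (trig_sum c X - g) + l2_norm m (trig_sum d X - h)) \<longlongrightarrow> 0 + 0) (finite_subsets_at_top UNIV)"
    using assms by (intro tendsto_add) (auto simp: is_fourier_iff)
  then have lim: "((\<lambda>X. l2_norm m (trig_sum c X - g) + l2_norm m (trig_sum d X - h)) \<longlongrightarrow> 0) (finite_subsets_at_top UNIV)"
    by simp
  have "((\<lambda>X. l2_norm m (trig_sum (\<lambda>a. c a + d a) X - (g + h))) \<longlongrightarrow> 0) (finite_subsets_at_top UNIV)"
  proof (rule Lim_null_comparison[OF _ lim])
    have "norm (l2_norm m (trig_sum (\<lambda>a. c a + d a) X - (g + h))) \<le>
        l2_norm m (trig_sum c X - g) + l2_norm m (trig_sum d X - h)" if X: "finite X" for X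
    proof -
      have "trig_sum (\<lambda>a. c a + d a) X - (g + h) = (trig_sum c X - g) + (trig_sum d X - h)"
        by (auto simp: trig_sum_def fun_eq_iff sum.distrib algebra_simps)
      then show ?thesis
        using l2_norm_triangle[OF L2_diff[OF trig_sum_L2[OF X] gh(1)] L2_diff[OF trig_sum_L2[OF X] gh(2)]]
        by (simp only: real_norm_def abs_of_nonneg[OF l2_norm_nonneg])
    qed
    then show "\<forall>\<^sub>F X in finite_subsets_at_top UNIV. norm (l2_norm m (trig_sum (\<lambda>a. c a + d a) X - (g + h))) \<le>
        l2_norm m (trig_sum c X - g) + l2_norm m (trig_sum d X - h)"
      by (intro eventually_finite_subsets_at_top_weakI) auto
  qed
  then show ?thesis using L2_add[OF gh] by (simp add: is_fourier_iff plus_fun_def)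
qed

lemma is_fourier_scale:
  assumes "is_fourier m c g" shows "is_fourier m (\<lambda>a. z * c a) (\<lambda>\<alpha>. z * g \<alpha>)"
proof -
  have g: "g \<in> L2 m" using assms by (auto simp: is_fourier_iff)
  have "trig_sum (\<lambda>a. z * c a) X - (\<lambda>\<alpha>. z * g \<alpha>) = (\<lambda>\<alpha>. z * (trig_sum c X - g) \<alpha>)" for X
    by (auto simp: trig_sum_def fun_eq_iff sum_distrib_left algebra_simps)
  then have "l2_norm m (trig_sum (\<lambda>a. z * c a) X - (\<lambda>\<alpha>. z * g \<alpha>)) = cmod z * l2_norm m (trig_sum c X - g)" for X
    by (simp only: l2_norm_cmult)
  moreover have "((\<lambda>X. cmod z * l2_norm m (trig_sum c X - g)) \<longlongrightarrow> cmod z * 0) (finite_subsets_at_top UNIV)"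
    using assms by (intro tendsto_mult_left) (auto simp: is_fourier_iff)
  ultimately show ?thesis using L2_cmult[OF g] by (simp add: is_fourier_iff)
qed

text \<open>On characters \<alpha> (- a) = \<alpha> b * \<alpha> (- (a + b)), and multiplication by
  \<alpha> b preserves the norm. Reindexing by translation carries finite sets to finite sets
  cofinally, so the limits over the two nets agree.\<close>

lemma is_fourier_shift:
  assumes "is_fourier m c g" shows "is_fourier m (\<lambda>a. c (a + b)) (\<lambda>\<alpha>. \<alpha> b * g \<alpha>)"
proof -
  have g: "g \<in> L2 m" and lim: "((\<lambda>X. l2_norm m (trig_sum c X - g)) \<longlongrightarrow> 0) (finite_subsets_at_top UNIV)"
    using assms by (auto simp: is_fourier_iff)
  have [measurable]: "g \<in> borel_measurable m" using g by (simp add: L2_def)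
  have norm_eq: "l2_norm m (\<lambda>\<alpha>. \<alpha> b * h \<alpha>) = l2_norm m h" for h
    unfolding l2_norm_def
    by (intro arg_cong[where f=sqrt] Bochner_Integration.integral_cong)
      (auto simp: space_m norm_mult character_norm)
  have "integrable m (\<lambda>\<alpha>. (cmod (\<alpha> b * g \<alpha>))\<^sup>2)"
    using L2_integrable[OF g]
    by (rule Bochner_Integration.integrable_cong[THEN iffD1, rotated 2])
      (auto simp: space_m norm_mult character_norm)
  then have bg: "(\<lambda>\<alpha>. \<alpha> b * g \<alpha>) \<in> L2 m" by (auto simp: L2_def)
  have fl: "filterlim (\<lambda>X. (\<lambda>a. a + b) ` X) (finite_subsets_at_top UNIV) (finite_subsets_at_top UNIV)"
    unfolding filterlim_finite_subsets_at_top eventually_finite_subsets_at_top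
  proof (intro allI impI)
    fix X :: "'g set" assume X: "finite X \<and> X \<subseteq> UNIV"
    show "\<exists>Y. finite Y \<and> Y \<subseteq> UNIV \<and> (\<forall>Z. finite Z \<and> Y \<subseteq> Z \<and> Z \<subseteq> UNIV \<longrightarrow>
        finite ((\<lambda>a. a + b) ` Z) \<and> X \<subseteq> (\<lambda>a. a + b) ` Z \<and> (\<lambda>a. a + b) ` Z \<subseteq> UNIV)"
    proof (intro exI[of _ "(\<lambda>a. a - b) ` X"] conjI allI impI subsetI)
      fix Z x assume Z: "finite Z \<and> (\<lambda>a. a - b) ` X \<subseteq> Z \<and> Z \<subseteq> UNIV" and "x \<in> X"
      then have "x - b \<in> Z" by blast
      then show "x \<in> (\<lambda>a. a + b) ` Z" by (intro image_eqI[of _ _ "x - b"]) auto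
    qed (use X in auto)
  qed
  have "l2_norm m (trig_sum (\<lambda>a. c (a + b)) X - (\<lambda>\<alpha>. \<alpha> b * g \<alpha>))
      = l2_norm m (trig_sum c ((\<lambda>a. a + b) ` X) - g)" if "finite X" for X
  proof -
    have "l2_norm m (trig_sum (\<lambda>a. c (a + b)) X - (\<lambda>\<alpha>. \<alpha> b * g \<alpha>))
        = l2_norm m (\<lambda>\<alpha>. \<alpha> b * (trig_sum c ((\<lambda>a. a + b) ` X) - g) \<alpha>)"
      unfolding l2_norm_def
    proof (intro arg_cong[where f=sqrt] Bochner_Integration.integral_cong refl)
      fix \<alpha> assume "\<alpha> \<in> space m"
      then have \<alpha>: "\<alpha> \<in> characters" by (simp add: space_m)
      have "\<alpha> b * \<alpha> (- (a + b)) = \<alpha> (- a)" for a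
        using character_add[OF \<alpha>, of b "- (a + b)"] by simp
      then have eq: "c (a + b) * \<alpha> (- a) = \<alpha> b * (c (a + b) * \<alpha> (- (a + b)))" for a
        by (metis mult.left_commute)
      have "\<alpha> b * (\<Sum>a\<in>X. c (a + b) * \<alpha> (- (a + b))) = (\<Sum>a\<in>X. c (a + b) * \<alpha> (- a))"
        unfolding sum_distrib_left by (intro sum.cong refl eq[symmetric])
      then have "\<alpha> b * trig_sum c ((\<lambda>a. a + b) ` X) \<alpha> = trig_sum (\<lambda>a. c (a + b)) X \<alpha>"
        unfolding trig_sum_def by (subst sum.reindex) (auto simp: inj_on_def simp del: minus_add_distrib)
      then show "(cmod ((trig_sum (\<lambda>a. c (a + b)) X - (\<lambda>\<alpha>. \<alpha> b * g \<alpha>)) \<alpha>))\<^sup>2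
          = (cmod (\<alpha> b * (trig_sum c ((\<lambda>a. a + b) ` X) - g) \<alpha>))\<^sup>2"
        by (simp add: right_diff_distrib)
    qed
    then show ?thesis unfolding norm_eq .
  qed
  then have "\<forall>\<^sub>F X in finite_subsets_at_top UNIV.
      l2_norm m (trig_sum c ((\<lambda>a. a + b) ` X) - g) = l2_norm m (trig_sum (\<lambda>a. c (a + b)) X - (\<lambda>\<alpha>. \<alpha> b * g \<alpha>))"
    by (intro eventually_finite_subsets_at_top_weakI) auto
  from tendsto_cong[OF this] filterlim_compose[OF lim fl] bg
  show ?thesis by (auto simp: is_fourier_iff)
qed

lemma is_fourier_single:
  assumes "\<And>a. a \<noteq> 0 \<Longrightarrow> c a = 0" shows "is_fourier m c (\<lambda>\<alpha>. c 0)"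
proof -
  have "(\<lambda>\<alpha>. c 0) \<in> L2 m" by (simp add: L2_def)
  moreover have "\<forall>\<^sub>F X in finite_subsets_at_top UNIV. l2_norm m (trig_sum c X - (\<lambda>\<alpha>. c 0)) = 0"
    unfolding eventually_finite_subsets_at_top
  proof (intro exI[of _ "{0}"] conjI allI impI)
    fix X :: "'g set" assume X: "finite X \<and> {0} \<subseteq> X \<and> X \<subseteq> UNIV"
    have "trig_sum c X \<alpha> = c 0" if "\<alpha> \<in> characters" for \<alpha>
    proof -
      have "trig_sum c X \<alpha> = (\<Sum>a\<in>{0}. c a * \<alpha> (- a))"
        unfolding trig_sum_def using X assms by (intro sum.mono_neutral_right) auto
      then show ?thesis using character_zero[OF that] by simp
    qed
    then have "l2_norm m (trig_sum c X - (\<lambda>\<alpha>. c 0)) = l2_norm m 0"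
      unfolding l2_norm_def
      by (intro arg_cong[where f=sqrt] Bochner_Integration.integral_cong) (auto simp: space_m)
    then show "l2_norm m (trig_sum c X - (\<lambda>\<alpha>. c 0)) = 0" by simp
  qed auto
  ultimately show ?thesis by (auto simp: is_fourier_iff tendsto_eventually)
qed

end

section \<open>The Zak transform\<close>

lemma closed_subspace_norm_zero:
  assumes "closed_subspace M V" "f \<in> V" "g \<in> L2 M" "l2_norm M (f - g) = 0"
  shows "g \<in> V"
  by (rule closed_subspace_limit[OF assms(1,3), of "\<lambda>_. f"]) (use assms in auto)

lemma (in pair_L2) L2_vec_norm_zero:
  assumes "F \<in> L2_vec m N" "l2_norm (m \<Otimes>\<^sub>M N) (case_prod F) = 0"
  shows "AE \<alpha> in m. l2_norm N (F \<alpha>) = 0"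
proof -
  have "(\<integral>\<alpha>. (l2_norm N (F \<alpha>))\<^sup>2 \<partial>m) = 0" using L2_vec_norm[OF assms(1)] assms(2) by simp
  then have "AE \<alpha> in m. (l2_norm N (F \<alpha>))\<^sup>2 = 0"
    by (subst (asm) integral_nonneg_eq_0_iff_AE) (auto intro: L2_vec_integrable[OF assms(1)])
  then show ?thesis by simp
qed

lemma (in pair_L2) const_L2_vec:
  assumes "finite_measure m" "f \<in> L2 N" shows "(\<lambda>_. f) \<in> L2_vec m N"
proof -
  interpret finite_measure m by fact
  have [measurable]: "f \<in> borel_measurable N" using assms by (simp add: L2_def)
  have "(\<lambda>(\<alpha>, x). f x) \<in> borel_measurable (m \<Otimes>\<^sub>M N)" by measurable
  then show ?thesis using assms(2) by (simp add: L2_vec_def)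
qed

locale zak_setting = tiling_action M \<sigma> Jac C + dual: haar m
  for M :: "'x measure" and \<sigma> :: "'g::{ab_group_add,countable} \<Rightarrow> 'x \<Rightarrow> 'x" and Jac C
    and m :: "('g \<Rightarrow> complex) measure" +
  assumes sep: "l2_separable M"
begin

sublocale vec: pair_L2 m N
proof (rule pair_L2.intro)
  interpret N: sigma_finite_measure N by (rule sigma_finite_N)
  show "pair_sigma_finite m N" ..
qed

lemma sep_N: "l2_separable N"
  by (rule l2_separable_restrict[OF C_sets sep])

text \<open>Relates a function to every admissible representative of its transform. Sums, multiples
  and translates can then be computed with explicit fields, which the single choice \<open>Z\<close>
  need not respect pointwise.\<close>

definition is_zak :: "('x \<Rightarrow> complex) \<Rightarrow> (('g \<Rightarrow> complex) \<Rightarrow> 'x \<Rightarrow> complex) \<Rightarrow> bool" where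
  "is_zak \<psi> F \<longleftrightarrow> F \<in> L2_vec m N \<and> (AE x in N. is_fourier m (\<lambda>a. R a \<psi> x) (\<lambda>\<alpha>. F \<alpha> x))"

abbreviation Z :: "('x \<Rightarrow> complex) \<Rightarrow> ('g \<Rightarrow> complex) \<Rightarrow> 'x \<Rightarrow> complex" where
  "Z \<equiv> zak M \<sigma> Jac C m"

lemma is_zakD: "is_zak \<psi> F \<Longrightarrow> F \<in> L2_vec m N"
  "is_zak \<psi> F \<Longrightarrow> AE x in N. is_fourier m (\<lambda>a. R a \<psi> x) (\<lambda>\<alpha>. F \<alpha> x)"
  by (auto simp: is_zak_def)

lemma L2_vec_eval_scale:
  assumes "F \<in> L2_vec m N" shows "(\<lambda>\<alpha> x. \<alpha> a * F \<alpha> x) \<in> L2_vec m N"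
  by (rule vec.L2_vec_scale[OF assms, of _ 1]) (simp_all add: dual.space_m character_norm)

section \<open>Existence of the transform\<close>

definition partial_zak :: "('x \<Rightarrow> complex) \<Rightarrow> 'g set \<Rightarrow> ('g \<Rightarrow> complex) \<Rightarrow> 'x \<Rightarrow> complex" where
  "partial_zak \<psi> X = (\<lambda>\<alpha> x. dual.trig_sum (\<lambda>a. R a \<psi> x) X \<alpha>)"

lemma partial_zak_L2_vec:
  assumes \<psi>: "\<psi> \<in> L2 M" and X: "finite X" shows "partial_zak \<psi> X \<in> L2_vec m N"
  using X
proof (induction X rule: finite_induct)
  case empty
  have "partial_zak \<psi> {} = (\<lambda>_. 0)"
    by (auto simp: partial_zak_def dual.trig_sum_def fun_eq_iff)
  then show ?case using vec.const_L2_vec[OF dual.finite_measure_m L2_zero] by (simp only:)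
next
  case (insert a X)
  have "partial_zak \<psi> (insert a X) = (\<lambda>\<alpha> x. \<alpha> (- a) * R a \<psi> x) + partial_zak \<psi> X"
    using insert(1,2) by (auto simp: partial_zak_def dual.trig_sum_def fun_eq_iff mult.commute)
  moreover have "(\<lambda>\<alpha> x. \<alpha> (- a) * R a \<psi> x) \<in> L2_vec m N"
    by (rule L2_vec_eval_scale[OF vec.const_L2_vec[OF dual.finite_measure_m L2_N[OF rep_L2[OF \<psi>]]]])
  ultimately show ?case using vec.L2_vec_add insert(3) by metis
qed

lemma partial_zak_norm:
  assumes \<psi>: "\<psi> \<in> L2 M" and X: "finite X"
  shows "(l2_norm (m \<Otimes>\<^sub>M N) (case_prod (partial_zak \<psi> X)))\<^sup>2 = (\<Sum>a\<in>X. (l2_norm N (R a \<psi>))\<^sup>2)"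
proof -
  have [measurable]: "R a \<psi> \<in> borel_measurable N" for a
    using L2_N[OF rep_L2[OF \<psi>]] by (simp add: L2_def)
  note pz = vec.L2_vec_L2[OF partial_zak_L2_vec[OF \<psi> X]]
  have [measurable]: "case_prod (partial_zak \<psi> X) \<in> borel_measurable (m \<Otimes>\<^sub>M N)" using pz by (simp add: L2_def)
  have "ennreal ((l2_norm (m \<Otimes>\<^sub>M N) (case_prod (partial_zak \<psi> X)))\<^sup>2)
      = (\<integral>\<^sup>+p. ennreal ((cmod (case_prod (partial_zak \<psi> X) p))\<^sup>2) \<partial>(m \<Otimes>\<^sub>M N))"
    by (rule l2_norm_nn[OF pz])
  also have "\<dots> = (\<integral>\<^sup>+x. \<integral>\<^sup>+\<alpha>. ennreal ((cmod (case_prod (partial_zak \<psi> X) (\<alpha>, x)))\<^sup>2) \<partial>m \<partial>N)"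
    by (rule vec.nn_integral_snd[symmetric]) measurable
  also have "\<dots> = (\<integral>\<^sup>+x. (\<Sum>a\<in>X. ennreal ((cmod (R a \<psi> x))\<^sup>2)) \<partial>N)"
    by (intro nn_integral_cong)
      (simp add: partial_zak_def l2_norm_nn[OF dual.trig_sum_L2[OF X], symmetric] dual.l2_norm_trig_sum[OF X] sum_ennreal)
  also have "\<dots> = (\<Sum>a\<in>X. \<integral>\<^sup>+x. ennreal ((cmod (R a \<psi> x))\<^sup>2) \<partial>N)"
    by (rule nn_integral_sum) measurable
  also have "\<dots> = (\<Sum>a\<in>X. ennreal ((l2_norm N (R a \<psi>))\<^sup>2))"
    by (intro sum.cong refl l2_norm_nn[symmetric] L2_N rep_L2 \<psi>)
  also have "\<dots> = ennreal (\<Sum>a\<in>X. (l2_norm N (R a \<psi>))\<^sup>2)" by (simp add: sum_ennreal)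
  finally show ?thesis by (simp add: ennreal_inj sum_nonneg)
qed

lemma AE_rep_summable:
  assumes \<psi>: "\<psi> \<in> L2 M"
  shows "AE x in N. (\<integral>\<^sup>+a. ennreal ((cmod (R a \<psi> x))\<^sup>2) \<partial>count_space UNIV) < \<infinity>"
proof -
  have \<psi>m: "\<psi> \<in> borel_measurable M" using \<psi> by (simp add: L2_def)
  have [measurable]: "R a \<psi> \<in> borel_measurable N" for a
    using L2_N[OF rep_L2[OF \<psi>]] by (simp add: L2_def)
  have "(\<lambda>x. \<integral>\<^sup>+a. ennreal ((cmod (R a \<psi> x))\<^sup>2) \<partial>count_space UNIV) \<in> borel_measurable N"
  proof -
    \<comment> \<open>Written as a lower limit of finite sums, the sum over the group is measurable
      in x.\<close>
    have eq: "(\<integral>\<^sup>+a. ennreal ((cmod (R a \<psi> x))\<^sup>2) \<partial>count_space UNIV)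
        = liminf (\<lambda>n. ennreal (\<Sum>a\<in>first_elements n. (cmod (R a \<psi> x))\<^sup>2))" for x
      by (rule lim_imp_Liminf[symmetric, OF sequentially_bot nn_integral_count_space_first_elements]) simp
    show ?thesis unfolding eq by measurable
  qed
  moreover have "(\<integral>\<^sup>+x. \<integral>\<^sup>+a. ennreal ((cmod (R a \<psi> x))\<^sup>2) \<partial>count_space UNIV \<partial>N) \<noteq> \<infinity>"
    unfolding nn_integral_N_tiles[OF \<psi>m] using \<psi> by (simp add: L2_iff_nn less_top)
  ultimately have "AE x in N. (\<integral>\<^sup>+a. ennreal ((cmod (R a \<psi> x))\<^sup>2) \<partial>count_space UNIV) \<noteq> \<infinity>"
    by (intro nn_integral_PInf_AE)
  then show ?thesis by (simp add: less_top)
qed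

lemma AE_section_L2:
  assumes F: "F \<in> L2_vec m N" shows "AE x in N. (\<lambda>\<alpha>. F \<alpha> x) \<in> L2 m"
proof -
  have [measurable]: "case_prod F \<in> borel_measurable (m \<Otimes>\<^sub>M N)" by (rule vec.L2_vec_measurable[OF F])
  have "integrable (m \<Otimes>\<^sub>M N) (\<lambda>(\<alpha>, x). (cmod (F \<alpha> x))\<^sup>2)"
    using L2_integrable[OF vec.L2_vec_L2[OF F]] by (simp add: case_prod_beta')
  from vec.AE_integrable_snd[OF this] AE_space show ?thesis
  proof eventually_elim
    case (elim x)
    then have "(\<lambda>\<alpha>. F \<alpha> x) \<in> borel_measurable m" by measurable
    then show ?case using elim by (simp add: L2_def)
  qed
qed

text \<open>The partial sums converge as fields, hence in norm over both variables at once. The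
  definition asks for convergence in the dual variable at almost every point of the tile; this is
  extracted along a subsequence and then upgraded by \<open>is_fourierI_subseq\<close>.\<close>

lemma is_zak_exists:
  assumes \<psi>: "\<psi> \<in> L2 M" shows "\<exists>F. is_zak \<psi> F"
proof -
  have \<psi>m: "\<psi> \<in> borel_measurable M" using \<psi> by (simp add: L2_def)
  define S where "S n = (\<Sum>a\<in>first_elements n. (l2_norm N (R a \<psi>))\<^sup>2)" for n
  define F where "F n = partial_zak \<psi> (first_elements n)" for n
  have F: "F n \<in> L2_vec m N" for n unfolding F_def by (rule partial_zak_L2_vec[OF \<psi>]) simp
  have "(\<integral>\<^sup>+a. ennreal ((l2_norm N (R a \<psi>))\<^sup>2) \<partial>count_space UNIV) = (\<integral>\<^sup>+x. ennreal ((cmod (\<psi> x))\<^sup>2) \<partial>M)"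
    unfolding nn_integral_tiles[OF \<psi>m, symmetric]
    by (intro nn_integral_cong l2_norm_nn L2_N rep_L2 \<psi>)
  also have "\<dots> < \<infinity>" using \<psi> by (simp add: L2_iff_nn)
  finally have fin: "(\<integral>\<^sup>+a. ennreal ((l2_norm N (R a \<psi>))\<^sup>2) \<partial>count_space UNIV) < \<infinity>" .
  obtain T where "S \<longlonglongrightarrow> T"
    unfolding S_def using finite_total_sum[OF zero_le_power2 fin] by blast
  then have "Cauchy S" by (rule LIMSEQ_imp_Cauchy)
  \<comment> \<open>By orthonormality at each point of the tile, the squared norm of an increment is
    the mass of \<psi> on the tiles that it adds.\<close>
  have diff: "(l2_norm (m \<Otimes>\<^sub>M N) (case_prod (F i) - case_prod (F j)))\<^sup>2 = S i - S j" if "j \<le> i" for i j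
  proof -
    have sub: "first_elements j \<subseteq> (first_elements i :: 'g set)" by (rule first_elements_mono[OF that])
    have "case_prod (F i) - case_prod (F j) = case_prod (partial_zak \<psi> (first_elements i - first_elements j))"
      using sub by (auto simp: F_def partial_zak_def dual.trig_sum_def fun_eq_iff sum_diff)
    then show ?thesis
      by (simp add: partial_zak_norm[OF \<psi>] S_def sum_diff[OF _ sub])
  qed
  obtain G where G: "G \<in> L2_vec m N" "(\<lambda>n. l2_norm (m \<Otimes>\<^sub>M N) (case_prod (F n) - case_prod G)) \<longlonglongrightarrow> 0"
  proof (rule vec.L2_vec_complete[of F, OF F])
    fix e :: real assume e: "e > 0"
    obtain K where K: "\<And>i j. i \<ge> K \<Longrightarrow> j \<ge> K \<Longrightarrow> dist (S i) (S j) < e\<^sup>2"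
      using metric_CauchyD[OF \<open>Cauchy S\<close>, of "e\<^sup>2"] e by auto
    have lt: "l2_norm (m \<Otimes>\<^sub>M N) (case_prod (F i) - case_prod (F j)) < e" if "K \<le> j" "j \<le> i" for i j
      using diff[OF that(2)] K[of i j] that e
      by (intro power2_less_imp_less[of _ e]) (auto simp: dist_real_def)
    have "l2_norm (m \<Otimes>\<^sub>M N) (case_prod (F i) - case_prod (F j)) < e" if "K \<le> i" "K \<le> j" for i j
      using lt[of j i] lt[of i j] that l2_norm_diff_commute[of "m \<Otimes>\<^sub>M N" "case_prod (F i)" "case_prod (F j)"]
      by (cases "i \<le> j") auto
    then show "\<exists>K. \<forall>i\<ge>K. \<forall>j\<ge>K. l2_norm (m \<Otimes>\<^sub>M N) (case_prod (F i) - case_prod (F j)) < e" by blast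
  qed blast
  have D: "F n - G \<in> L2_vec m N" for n by (rule vec.L2_vec_diff[OF F G(1)])
  \<comment> \<open>The squared distance in the dual variable at the point x. Its integral over the
    tile is the squared norm of the error, so a subsequence tends to 0 for almost every x.\<close>
  define u where "u n x = (\<integral>\<alpha>. (cmod ((F n - G) \<alpha> x))\<^sup>2 \<partial>m)" for n x
  have int: "integrable (m \<Otimes>\<^sub>M N) (\<lambda>(\<alpha>, x). (cmod ((F n - G) \<alpha> x))\<^sup>2)" for n
    using L2_integrable[OF vec.L2_vec_L2[OF D]] by (simp add: case_prod_beta')
  have int_u: "integrable N (u n)" for n unfolding u_def[abs_def] by (rule vec.integrable_snd[OF int])
  have u_norm: "(\<integral>x. norm (u n x) \<partial>N) = (l2_norm (m \<Otimes>\<^sub>M N) (case_prod (F n) - case_prod G))\<^sup>2" for n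
  proof -
    have "(\<integral>x. norm (u n x) \<partial>N) = (\<integral>x. u n x \<partial>N)"
      by (intro Bochner_Integration.integral_cong) (auto simp: u_def integral_nonneg_AE)
    also have "\<dots> = (\<integral>p. (case p of (\<alpha>, x) \<Rightarrow> (cmod ((F n - G) \<alpha> x))\<^sup>2) \<partial>(m \<Otimes>\<^sub>M N))"
      unfolding u_def by (rule vec.integral_snd[OF int])
    also have "\<dots> = (l2_norm (m \<Otimes>\<^sub>M N) (case_prod (F n - G)))\<^sup>2"
      unfolding l2_norm_sq by (intro Bochner_Integration.integral_cong) auto
    finally show ?thesis unfolding case_prod_diff .
  qed
  have "(\<lambda>n. \<integral>x. norm (u n x) \<partial>N) \<longlonglongrightarrow> 0"
    unfolding u_norm using tendsto_power[OF G(2), of 2] by simp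
  from tendsto_L1_AE_subseq[OF int_u this]
  obtain r where r: "strict_mono r" "AE x in N. (\<lambda>n. u (r n) x) \<longlonglongrightarrow> 0" by blast
  have "AE x in N. is_fourier m (\<lambda>a. R a \<psi> x) (\<lambda>\<alpha>. G \<alpha> x)"
    using r(2) AE_rep_summable[OF \<psi>] AE_section_L2[OF G(1)]
  proof eventually_elim
    case (elim x)
    have "u n x = (l2_norm m (dual.trig_sum (\<lambda>a. R a \<psi> x) (first_elements n) - (\<lambda>\<alpha>. G \<alpha> x)))\<^sup>2" for n
      by (simp add: u_def l2_norm_sq F_def partial_zak_def)
    then have "(\<lambda>n. sqrt ((l2_norm m (dual.trig_sum (\<lambda>a. R a \<psi> x) (first_elements (r n)) - (\<lambda>\<alpha>. G \<alpha> x)))\<^sup>2)) \<longlonglongrightarrow> sqrt 0"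
      using elim(1) by (intro tendsto_real_sqrt) (simp only:)
    then show ?case
      by (intro dual.is_fourierI_subseq[OF elim(2,3) r(1)]) simp
  qed
  with G(1) show ?thesis by (auto simp: is_zak_def)
qed

lemma is_zak_Z: "\<psi> \<in> L2 M \<Longrightarrow> is_zak \<psi> (Z \<psi>)"
  using someI_ex[OF is_zak_exists] by (simp add: zak_def is_zak_def)

section \<open>Isometry, algebra and equivariance\<close>

text \<open>Parseval at almost every point of the tile, integrated over the tile; the integrated
  square sums add up to the norm over all tiles.\<close>

lemma is_zak_norm:
  assumes \<psi>: "\<psi> \<in> L2 M" and F: "is_zak \<psi> F"
  shows "l2_norm (m \<Otimes>\<^sub>M N) (case_prod F) = l2_norm M \<psi>"
proof -
  note FL = is_zakD(1)[OF F]
  have \<psi>m: "\<psi> \<in> borel_measurable M" using \<psi> by (simp add: L2_def)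
  have [measurable]: "case_prod F \<in> borel_measurable (m \<Otimes>\<^sub>M N)" by (rule vec.L2_vec_measurable[OF FL])
  have "ennreal ((l2_norm (m \<Otimes>\<^sub>M N) (case_prod F))\<^sup>2)
      = (\<integral>\<^sup>+x. \<integral>\<^sup>+\<alpha>. ennreal ((cmod (case_prod F (\<alpha>, x)))\<^sup>2) \<partial>m \<partial>N)"
    unfolding l2_norm_nn[OF vec.L2_vec_L2[OF FL]] by (rule vec.nn_integral_snd[symmetric]) measurable
  also have "\<dots> = (\<integral>\<^sup>+x. \<integral>\<^sup>+a. ennreal ((cmod (R a \<psi> x))\<^sup>2) \<partial>count_space UNIV \<partial>N)"
  proof (rule nn_integral_cong_AE)
    show "AE x in N. (\<integral>\<^sup>+\<alpha>. ennreal ((cmod (case_prod F (\<alpha>, x)))\<^sup>2) \<partial>m)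
        = (\<integral>\<^sup>+a. ennreal ((cmod (R a \<psi> x))\<^sup>2) \<partial>count_space UNIV)"
      using is_zakD(2)[OF F]
    proof eventually_elim
      case (elim x)
      then have "(\<lambda>\<alpha>. F \<alpha> x) \<in> L2 m" by (simp add: dual.is_fourier_iff)
      then show ?case using dual.is_fourier_norm[OF elim] by (simp add: l2_norm_nn)
    qed
  qed
  also have "\<dots> = ennreal ((l2_norm M \<psi>)\<^sup>2)"
    unfolding nn_integral_N_tiles[OF \<psi>m] l2_norm_nn[OF \<psi>] ..
  finally show ?thesis by (simp add: power2_eq_iff_nonneg)
qed

lemma is_zak_add:
  assumes "is_zak f F" "is_zak g G" shows "is_zak (f + g) (F + G)"
proof -
  have "AE x in N. is_fourier m (\<lambda>a. R a (f + g) x) (\<lambda>\<alpha>. (F + G) \<alpha> x)"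
    using is_zakD(2)[OF assms(1)] is_zakD(2)[OF assms(2)]
    by eventually_elim (simp add: rep_add dual.is_fourier_add)
  then show ?thesis using vec.L2_vec_add[OF is_zakD(1)[OF assms(1)] is_zakD(1)[OF assms(2)]]
    by (simp add: is_zak_def)
qed

lemma is_zak_scale:
  assumes "is_zak f F" shows "is_zak (\<lambda>x. c * f x) (\<lambda>\<alpha> x. c * F \<alpha> x)"
proof -
  have "AE x in N. is_fourier m (\<lambda>a. R a (\<lambda>x. c * f x) x) (\<lambda>\<alpha>. c * F \<alpha> x)"
    using is_zakD(2)[OF assms]
    by eventually_elim (simp add: rep_scale dual.is_fourier_scale)
  moreover have "(\<lambda>\<alpha> x. c * F \<alpha> x) \<in> L2_vec m N"
    by (rule vec.L2_vec_scale[OF is_zakD(1)[OF assms], of _ "cmod c"]) auto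
  ultimately show ?thesis by (simp add: is_zak_def)
qed

lemma is_zak_diff:
  assumes "is_zak f F" "is_zak g G" shows "is_zak (f - g) (F - G)"
proof -
  have "is_zak (f + (\<lambda>x. (-1) * g x)) (F + (\<lambda>\<alpha> x. (-1) * G \<alpha> x))"
    by (intro is_zak_add is_zak_scale assms)
  moreover have "f + (\<lambda>x. (-1) * g x) = f - g" "F + (\<lambda>\<alpha> x. (-1) * G \<alpha> x) = F - G"
    by (auto simp: fun_eq_iff)
  ultimately show ?thesis by (simp only:)
qed

lemma is_zak_zero: "is_zak 0 0"
proof -
  have "is_zak (\<lambda>x. 0 * (0 :: 'x \<Rightarrow> complex) x) (\<lambda>\<alpha> x. 0 * Z 0 \<alpha> x)"
    by (intro is_zak_scale is_zak_Z L2_zero)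
  moreover have "(\<lambda>x. 0 * (0 :: 'x \<Rightarrow> complex) x) = 0" "(\<lambda>\<alpha> x. 0 * Z 0 \<alpha> x) = 0"
    by (auto simp: fun_eq_iff)
  ultimately show ?thesis by (simp only:)
qed

text \<open>At almost every point the sequence of \<open>R b f\<close> is that of \<open>f\<close>
  shifted by \<open>b\<close>. One null set serves all group elements because the group is
  countable.\<close>

lemma is_zak_rep:
  assumes "is_zak f F" shows "is_zak (R b f) (\<lambda>\<alpha> x. \<alpha> b * F \<alpha> x)"
proof -
  have "AE x in M. \<forall>a. R a (R b f) x = R (b + a) f x"
    unfolding AE_all_countable by (intro allI rep_rep)
  then have "AE x in N. \<forall>a. R a (R b f) x = R (b + a) f x" by (rule AE_N)
  with is_zakD(2)[OF assms] have "AE x in N. is_fourier m (\<lambda>a. R a (R b f) x) (\<lambda>\<alpha>. \<alpha> b * F \<alpha> x)"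
  proof eventually_elim
    case (elim x)
    then have "(\<lambda>a. R a (R b f) x) = (\<lambda>a. R (a + b) f x)" by (simp add: add.commute)
    then show ?case using dual.is_fourier_shift[OF elim(1), of b] by (simp only:)
  qed
  then show ?thesis using L2_vec_eval_scale[OF is_zakD(1)[OF assms]] by (simp add: is_zak_def)
qed

text \<open>At almost every point of the tile, only the identity keeps the point in the tile, so the
  sequence to be transformed is supported at 0. These constant fields are the explicit transforms
  from which surjectivity is derived.\<close>

lemma is_zak_tile:
  assumes f: "f \<in> L2 M" and off: "\<And>x. x \<notin> C \<Longrightarrow> f x = 0" shows "is_zak f (\<lambda>_. f)"
proof -
  have "AE x in N. is_fourier m (\<lambda>a. R a f x) (\<lambda>\<alpha>. f x)"
    using AE_N[OF AE_unique_tile] AE_N[OF rep_zero[of f]] AE_space[of N]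
  proof eventually_elim
    case (elim x)
    then have x: "x \<in> C" by (simp add: space_N)
    then have xM: "x \<in> space M" using sets.sets_into_space[OF C_sets] by blast
    obtain b where b: "\<And>a. \<sigma> a x \<in> C \<longleftrightarrow> a = b" using elim(1) by blast
    have "b = 0" using b[of 0] act_zero[OF xM] x by simp
    then have "R a f x = 0" if "a \<noteq> 0" for a
      using b[of "- a"] off that by (simp add: rep_def)
    then show ?case using dual.is_fourier_single[of "\<lambda>a. R a f x"] elim(2) by simp
  qed
  then show ?thesis using vec.const_L2_vec[OF dual.finite_measure_m L2_N[OF f]] by (simp add: is_zak_def)
qed

section \<open>Inner products, uniqueness and surjectivity\<close>

lemma is_zak_inner:
  assumes f: "f \<in> L2 M" "is_zak f F" and g: "g \<in> L2 M" "is_zak g G"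
  shows "l2_inner (m \<Otimes>\<^sub>M N) (case_prod F) (case_prod G) = l2_inner M f g"
proof -
  have re: "Re (l2_inner (m \<Otimes>\<^sub>M N) (case_prod F) (case_prod G)) = Re (l2_inner M f g)"
    if g: "g \<in> L2 M" "is_zak g G" for g G
  proof -
    have "l2_norm (m \<Otimes>\<^sub>M N) (case_prod F + case_prod G) = l2_norm M (f + g)"
      unfolding case_prod_add by (rule is_zak_norm[OF L2_add[OF f(1) g(1)] is_zak_add[OF f(2) g(2)]])
    then show ?thesis
      using l2_norm_add_sq[OF f(1) g(1)] is_zak_norm[OF f] is_zak_norm[OF g]
        l2_norm_add_sq[OF vec.L2_vec_L2[OF is_zakD(1)[OF f(2)]] vec.L2_vec_L2[OF is_zakD(1)[OF g(2)]]]
      by simp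
  qed
  \<comment> \<open>Norms determine real parts of inner products. Replacing \<open>g\<close> by i g
    turns the real part into the imaginary part.\<close>
  have "(case_prod (\<lambda>\<alpha> x. \<i> * G \<alpha> x)) = (\<lambda>p. \<i> * case_prod G p)" by (auto simp: fun_eq_iff)
  then have "Im (l2_inner (m \<Otimes>\<^sub>M N) (case_prod F) (case_prod G)) = Im (l2_inner M f g)"
    using re[OF L2_cmult[OF g(1), of \<i>] is_zak_scale[OF g(2), of \<i>]]
    by (simp only: l2_inner_cmult_right complex_cnj_i mult_minus_left uminus_complex.sel(1) Re_i_times minus_minus)
  with re[OF g] show ?thesis by (simp add: complex_eq_iff)
qed

lemma is_zak_AE_unique:
  assumes f: "f \<in> L2 M" and F: "is_zak f F" and G: "is_zak f G"
  shows "AE \<alpha> in m. l2_norm N (F \<alpha> - G \<alpha>) = 0"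
proof -
  have z: "is_zak (f - f) (F - G)" by (rule is_zak_diff[OF F G])
  have "l2_norm (m \<Otimes>\<^sub>M N) (case_prod (F - G)) = l2_norm M (f - f)"
    by (rule is_zak_norm[OF L2_diff[OF f f] z])
  then have "l2_norm (m \<Otimes>\<^sub>M N) (case_prod (F - G)) = 0" by (simp only: diff_self l2_norm_zero)
  from vec.L2_vec_norm_zero[OF is_zakD(1)[OF z] this] show ?thesis by simp
qed

text \<open>The hypothesis says that the fiberwise inner products have vanishing Fourier coefficients.\<close>
lemma fiberwise_orthogonal:
  assumes H: "H \<in> L2_vec m N" and G: "G \<in> L2_vec m N"
    and orth: "\<And>a. l2_inner (m \<Otimes>\<^sub>M N) (case_prod H) (case_prod (\<lambda>\<alpha> x. \<alpha> a * G \<alpha> x)) = 0"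
  shows "AE \<alpha> in m. l2_inner N (H \<alpha>) (G \<alpha>) = 0"
proof (rule dual.fourier_unique[OF vec.L2_vec_inner(1)[OF H G]])
  fix a
  have "(\<integral>\<alpha>. l2_inner N (H \<alpha>) (G \<alpha>) * \<alpha> a \<partial>m) = (\<integral>\<alpha>. l2_inner N (H \<alpha>) (\<lambda>x. \<alpha> (- a) * G \<alpha> x) \<partial>m)"
    by (intro Bochner_Integration.integral_cong)
      (auto simp: dual.space_m l2_inner_cmult_right character_uminus mult.commute)
  also have "\<dots> = l2_inner (m \<Otimes>\<^sub>M N) (case_prod H) (case_prod (\<lambda>\<alpha> x. \<alpha> (- a) * G \<alpha> x))"
    by (rule vec.L2_vec_inner(2)[symmetric, OF H L2_vec_eval_scale[OF G]])
  finally show "(\<integral>\<alpha>. l2_inner N (H \<alpha>) (G \<alpha>) * \<alpha> a \<partial>m) = 0" using orth by simp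
qed

text \<open>The range of an isometry on a complete space is closed, so the residual of
  \<open>F\<close> can be taken orthogonal to it. Being orthogonal to the transforms of all
  translates of a function on the tile, the residual has fibres orthogonal to that function almost
  everywhere; a countable dense set of such functions makes almost every fibre vanish.\<close>

lemma zak_surjective:
  assumes F: "F \<in> L2_vec m N"
  obtains \<psi> where "\<psi> \<in> L2 M" "AE \<alpha> in m. l2_norm N (Z \<psi> \<alpha> - F \<alpha>) = 0"
proof -
  let ?P = "m \<Otimes>\<^sub>M N"
  \<comment> \<open>The range of the transform, enlarged to everything at distance zero from it: as
    a set of functions on the product, only a saturated set can be a closed subspace.\<close>
  define V where "V = {g \<in> L2 ?P. \<exists>\<psi>\<in>L2 M. l2_norm ?P (case_prod (Z \<psi>) - g) = 0}"
  note ZP = vec.L2_vec_L2[OF is_zakD(1)[OF is_zak_Z]]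
  have close: "l2_norm ?P (case_prod G - g) = l2_norm ?P (case_prod (Z \<psi>) - g)"
    if \<psi>: "\<psi> \<in> L2 M" and G: "is_zak \<psi> G" and g: "g \<in> L2 ?P" for \<psi> G g
  proof -
    note GP = vec.L2_vec_L2[OF is_zakD(1)[OF G]]
    have "l2_norm ?P (case_prod G - case_prod (Z \<psi>)) = l2_norm M (\<psi> - \<psi>)"
      unfolding case_prod_diff by (rule is_zak_norm[OF L2_diff[OF \<psi> \<psi>] is_zak_diff[OF G is_zak_Z[OF \<psi>]]])
    then have "l2_norm ?P (case_prod G - case_prod (Z \<psi>)) = 0" by (simp only: diff_self l2_norm_zero)
    moreover have "case_prod G - g - (case_prod (Z \<psi>) - g) = case_prod G - case_prod (Z \<psi>)" by simp
    ultimately show ?thesis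
      using l2_norm_triangle_rev[OF L2_diff[OF GP g] L2_diff[OF ZP[OF \<psi>] g]] by simp
  qed
  have VI: "g \<in> V" if \<psi>: "\<psi> \<in> L2 M" and G: "is_zak \<psi> G" and g: "g \<in> L2 ?P" and 0: "l2_norm ?P (case_prod G - g) = 0"
    for \<psi> G g
    unfolding V_def using close[OF \<psi> G g] \<psi> g 0 by auto
  have V: "closed_subspace ?P V"
    unfolding closed_subspace_def
  proof (intro conjI)
    show VL: "V \<subseteq> L2 ?P" by (auto simp: V_def)
    show "cfun.subspace V"
      unfolding cfun.subspace_def
    proof (intro conjI ballI allI)
      show "0 \<in> V"
      proof (rule VI[OF L2_zero is_zak_zero L2_zero])
        have "case_prod 0 - 0 = (0 :: ('g \<Rightarrow> complex) \<times> 'x \<Rightarrow> complex)" by (auto simp: fun_eq_iff)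
        then show "l2_norm ?P (case_prod 0 - 0) = 0" by (simp only: l2_norm_zero)
      qed
      fix g assume "g \<in> V"
      then obtain \<psi> where g: "g \<in> L2 ?P" "\<psi> \<in> L2 M" "l2_norm ?P (case_prod (Z \<psi>) - g) = 0" by (auto simp: V_def)
      show "(\<lambda>p. c * g p) \<in> V" for c
      proof (rule VI[OF L2_cmult[OF g(2)] is_zak_scale[OF is_zak_Z[OF g(2)]] L2_cmult[OF g(1)]])
        have "case_prod (\<lambda>\<alpha> x. c * Z \<psi> \<alpha> x) - (\<lambda>p. c * g p) = (\<lambda>p. c * (case_prod (Z \<psi>) - g) p)"
          by (auto simp: fun_eq_iff right_diff_distrib)
        then show "l2_norm ?P (case_prod (\<lambda>\<alpha> x. c * Z \<psi> \<alpha> x) - (\<lambda>p. c * g p)) = 0"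
          using g(3) by (simp only: l2_norm_cmult mult_zero_right)
      qed
      fix h assume "h \<in> V"
      then obtain \<phi> where h: "h \<in> L2 ?P" "\<phi> \<in> L2 M" "l2_norm ?P (case_prod (Z \<phi>) - h) = 0" by (auto simp: V_def)
      show "g + h \<in> V"
      proof (rule VI[OF L2_add[OF g(2) h(2)] is_zak_add[OF is_zak_Z[OF g(2)] is_zak_Z[OF h(2)]] L2_add[OF g(1) h(1)]])
        have eq: "case_prod (Z \<psi> + Z \<phi>) - (g + h) = (case_prod (Z \<psi>) - g) + (case_prod (Z \<phi>) - h)"
          by (auto simp: fun_eq_iff)
        have "l2_norm ?P (case_prod (Z \<psi> + Z \<phi>) - (g + h)) \<le> l2_norm ?P (case_prod (Z \<psi>) - g) + l2_norm ?P (case_prod (Z \<phi>) - h)"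
          unfolding eq by (intro l2_norm_triangle L2_diff ZP g h)
        then show "l2_norm ?P (case_prod (Z \<psi> + Z \<phi>) - (g + h)) = 0"
          using g(3) h(3) l2_norm_nonneg[of ?P "case_prod (Z \<psi> + Z \<phi>) - (g + h)"] by linarith
      qed
    qed
    show "l2_closure ?P V = V"
    proof
      show "V \<subseteq> l2_closure ?P V" by (rule subset_l2_closure[OF VL])
      show "l2_closure ?P V \<subseteq> V"
      proof
        fix g assume gc: "g \<in> l2_closure ?P V"
        then have g: "g \<in> L2 ?P" by (simp add: l2_closure_def)
        have "\<exists>\<psi>\<in>L2 M. l2_norm ?P (case_prod (Z \<psi>) - g) < e" if e: "e > 0" for e
        proof -
          obtain h where h: "h \<in> V" "l2_norm ?P (g - h) < e" using l2_closureD[OF gc e] by blast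
          then obtain \<psi> where \<psi>: "h \<in> L2 ?P" "\<psi> \<in> L2 M" "l2_norm ?P (case_prod (Z \<psi>) - h) = 0" by (auto simp: V_def)
          have "l2_norm ?P (case_prod (Z \<psi>) - g) \<le> l2_norm ?P (case_prod (Z \<psi>) - h) + l2_norm ?P (h - g)"
            by (rule l2_norm_triangle_diff[OF ZP[OF \<psi>(2)] \<psi>(1) g])
          then have "l2_norm ?P (case_prod (Z \<psi>) - g) < e" using h(2) \<psi>(3) l2_norm_diff_commute[of ?P g h] by linarith
          then show ?thesis using \<psi>(2) by blast
        qed
        then have "\<exists>\<psi>\<in>L2 M. l2_norm ?P (case_prod (Z \<psi>) - g) < inverse (real (Suc n))" for n by simp
        then obtain \<psi> where \<psi>: "\<And>n. \<psi> n \<in> L2 M" "\<And>n. l2_norm ?P (case_prod (Z (\<psi> n)) - g) < inverse (real (Suc n))"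
          by metis
        have lim: "(\<lambda>n. l2_norm ?P (case_prod (Z (\<psi> n)) - g)) \<longlonglongrightarrow> 0"
          by (rule Lim_null_comparison[OF always_eventually LIMSEQ_inverse_real_of_nat])
            (use \<psi>(2) in \<open>auto intro: less_imp_le\<close>)
        \<comment> \<open>Through the isometry the preimages form a Cauchy sequence, and their limit
          is a preimage of \<open>g\<close> up to norm zero.\<close>
        have iso: "l2_norm M (\<psi> i - \<psi> j) = l2_norm ?P (case_prod (Z (\<psi> i)) - case_prod (Z (\<psi> j)))" for i j
          unfolding case_prod_diff
          by (rule is_zak_norm[OF L2_diff[OF \<psi>(1) \<psi>(1)] is_zak_diff[OF is_zak_Z[OF \<psi>(1)] is_zak_Z[OF \<psi>(1)]], symmetric])
        obtain \<phi> where \<phi>: "\<phi> \<in> L2 M" "(\<lambda>n. l2_norm M (\<psi> n - \<phi>)) \<longlonglongrightarrow> 0"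
        proof (rule L2_complete[of \<psi> M, OF \<psi>(1)])
          fix e :: real assume e: "e > 0"
          have "\<forall>\<^sub>F n in sequentially. l2_norm ?P (case_prod (Z (\<psi> n)) - g) < e/2"
            using e by (intro order_tendstoD(2)[OF lim]) auto
          then obtain K where K: "\<And>n. n \<ge> K \<Longrightarrow> l2_norm ?P (case_prod (Z (\<psi> n)) - g) < e/2"
            by (auto simp: eventually_sequentially)
          have "l2_norm M (\<psi> i - \<psi> j) < e" if "i \<ge> K" "j \<ge> K" for i j
            using l2_norm_triangle_diff[OF ZP[OF \<psi>(1)[of i]] g ZP[OF \<psi>(1)[of j]]] K[OF that(1)] K[OF that(2)]
              l2_norm_diff_commute[of ?P g "case_prod (Z (\<psi> j))"] unfolding iso by linarith
          then show "\<exists>K. \<forall>i\<ge>K. \<forall>j\<ge>K. l2_norm M (\<psi> i - \<psi> j) < e" by blast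
        qed blast
        have le: "l2_norm ?P (case_prod (Z \<phi>) - g) \<le> l2_norm M (\<psi> n - \<phi>) + l2_norm ?P (case_prod (Z (\<psi> n)) - g)" for n
        proof -
          have "l2_norm ?P (case_prod (Z (\<psi> n)) - case_prod (Z \<phi>)) = l2_norm M (\<psi> n - \<phi>)"
            unfolding case_prod_diff
            by (rule is_zak_norm[OF L2_diff[OF \<psi>(1) \<phi>(1)] is_zak_diff[OF is_zak_Z[OF \<psi>(1)] is_zak_Z[OF \<phi>(1)]]])
          then show ?thesis
            using l2_norm_triangle_diff[OF ZP[OF \<phi>(1)] ZP[OF \<psi>(1)[of n]] g]
              l2_norm_diff_commute[of ?P "case_prod (Z \<phi>)" "case_prod (Z (\<psi> n))"] by linarith
        qed
        have "l2_norm ?P (case_prod (Z \<phi>) - g) \<le> 0 + 0"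
          by (rule LIMSEQ_le_const[OF tendsto_add[OF \<phi>(2) lim]]) (use le in blast)
        then have "l2_norm ?P (case_prod (Z \<phi>) - g) = 0"
          using l2_norm_nonneg[of ?P "case_prod (Z \<phi>) - g"] by linarith
        then show "g \<in> V" using g \<phi>(1) by (auto simp: V_def)
      qed
    qed
  qed
  note FP = vec.L2_vec_L2[OF F]
  obtain p where p: "p \<in> V" "\<And>v. v \<in> V \<Longrightarrow> l2_inner ?P (case_prod F - p) v = 0"
    using projection_exists[OF V FP] by blast
  have pL: "p \<in> L2 ?P" using p(1) by (simp add: V_def)
  \<comment> \<open>The residual is replaced by a field all of whose fibres are square-integrable,
    so that fibrewise inner products are meaningful.\<close>
  obtain H where H: "H \<in> L2_vec m N" "AE q in ?P. case_prod H q = (case_prod F - p) q"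
    using vec.L2_vec_representative[OF L2_diff[OF FP pL]] by blast
  have orth: "l2_inner ?P (case_prod H) (case_prod G) = 0" if \<psi>: "\<psi> \<in> L2 M" and G: "is_zak \<psi> G" for \<psi> G
  proof -
    note GP = vec.L2_vec_L2[OF is_zakD(1)[OF G]]
    have "case_prod G \<in> V" by (rule VI[OF \<psi> G GP]) (simp only: diff_self l2_norm_zero)
    then have "l2_inner ?P (case_prod F - p) (case_prod G) = 0" by (rule p(2))
    moreover have "l2_inner ?P (case_prod H) (case_prod G) = l2_inner ?P (case_prod F - p) (case_prod G)"
      by (rule l2_inner_cong_AE)
        (use H(2) L2_measurable[OF vec.L2_vec_L2[OF H(1)]] L2_measurable[OF L2_diff[OF FP pL]] L2_measurable[OF GP] in auto)
    ultimately show ?thesis by simp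
  qed
  obtain D where D: "countable D" "D \<subseteq> L2 N"
    "\<And>f \<epsilon>. f \<in> L2 N \<Longrightarrow> \<epsilon> > 0 \<Longrightarrow> \<exists>d\<in>D. l2_norm N (f - d) < \<epsilon>"
    using l2_separableE[OF sep_N] by metis
  have "AE \<alpha> in m. l2_inner N (H \<alpha>) d = 0" if d: "d \<in> D" for d
  proof -
    \<comment> \<open>Extension of \<open>d\<close> by zero off the tile; its transform is the
      constant field, and its translates multiply this field by all character values.\<close>
    define f where "f x = indicator C x * d x" for x
    have f: "f \<in> L2 M" unfolding f_def[abs_def] using L2_extend[OF C_sets] d D(2) by blast
    have fz: "is_zak f (\<lambda>_. f)" by (rule is_zak_tile[OF f]) (simp add: f_def)
    have "AE \<alpha> in m. l2_inner N (H \<alpha>) f = 0"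
      by (rule fiberwise_orthogonal[OF H(1) is_zakD(1)[OF fz]]) (rule orth[OF rep_L2[OF f] is_zak_rep[OF fz]])
    moreover have "l2_inner N g f = l2_inner N g d" for g
      unfolding l2_inner_def f_def by (intro Bochner_Integration.integral_cong) (auto simp: space_N)
    ultimately show ?thesis by simp
  qed
  then have "AE \<alpha> in m. \<forall>d\<in>D. l2_inner N (H \<alpha>) d = 0" by (simp add: AE_ball_countable[OF D(1)])
  with AE_space have AE0: "AE \<alpha> in m. l2_norm N (H \<alpha>) = 0"
  proof eventually_elim
    case (elim \<alpha>)
    have L: "H \<alpha> \<in> L2 N" by (rule vec.L2_vec_fiber[OF H(1) elim(1)])
    have cs: "closed_subspace N {v \<in> L2 N. l2_inner N (H \<alpha>) v = 0}" by (rule closed_subspace_orthogonal[OF L])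
    have "D \<subseteq> {v \<in> L2 N. l2_inner N (H \<alpha>) v = 0}" using D(2) elim(2) by blast
    from l2_closure_mono[OF this, of N]
    have "l2_closure N D \<subseteq> {v \<in> L2 N. l2_inner N (H \<alpha>) v = 0}"
      unfolding closed_subspaceD(3)[OF cs] .
    moreover have "H \<alpha> \<in> l2_closure N D" using L D(3)[OF L] by (simp add: l2_closure_def)
    ultimately have "l2_inner N (H \<alpha>) (H \<alpha>) = 0" by blast
    then show ?case by (simp add: l2_inner_self)
  qed
  have "(l2_norm ?P (case_prod H))\<^sup>2 = (\<integral>\<alpha>. 0 \<partial>m)"
    unfolding vec.L2_vec_norm[OF H(1)]
    by (rule integral_cong_AE) (use AE0 vec.measurable_l2_norm_fiber[OF vec.L2_vec_measurable[OF H(1)]] in auto)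
  then have "l2_norm ?P (case_prod H) = 0" by simp
  moreover have "l2_norm ?P (case_prod H) = l2_norm ?P (case_prod F - p)"
    by (rule l2_norm_cong_AE) (use H(2) L2_measurable[OF vec.L2_vec_L2[OF H(1)]] L2_measurable[OF L2_diff[OF FP pL]] in auto)
  ultimately have Fp: "l2_norm ?P (case_prod F - p) = 0" by simp
  obtain \<psi> where \<psi>: "\<psi> \<in> L2 M" "l2_norm ?P (case_prod (Z \<psi>) - p) = 0" using p(1) by (auto simp: V_def)
  have "l2_norm ?P (case_prod (Z \<psi>) - case_prod F) \<le> l2_norm ?P (case_prod (Z \<psi>) - p) + l2_norm ?P (p - case_prod F)"
    by (rule l2_norm_triangle_diff[OF ZP[OF \<psi>(1)] pL FP])
  then have "l2_norm ?P (case_prod (Z \<psi> - F)) = 0"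
    unfolding case_prod_diff[symmetric]
    using Fp \<psi>(2) l2_norm_diff_commute[of ?P p "case_prod F"] l2_norm_nonneg[of ?P "case_prod (Z \<psi>) - case_prod F"] by linarith
  from vec.L2_vec_norm_zero[OF vec.L2_vec_diff[OF is_zakD(1)[OF is_zak_Z[OF \<psi>(1)]] F] this]
  have "AE \<alpha> in m. l2_norm N (Z \<psi> \<alpha> - F \<alpha>) = 0" by simp
  with \<psi>(1) show thesis by (rule that)
qed

end

section \<open>Invariant spaces and range functions\<close>

context zak_setting
begin

abbreviation range_fun :: "(('g \<Rightarrow> complex) \<Rightarrow> ('x \<Rightarrow> complex) set) \<Rightarrow> bool" where
  "range_fun \<equiv> measurable_range_function m N"

abbreviation space_of :: "(('g \<Rightarrow> complex) \<Rightarrow> ('x \<Rightarrow> complex) set) \<Rightarrow> ('x \<Rightarrow> complex) set" where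
  "space_of \<equiv> range_space M \<sigma> Jac C m"

lemma range_fun_closed: "range_fun J \<Longrightarrow> \<alpha> \<in> space m \<Longrightarrow> closed_subspace N (J \<alpha>)"
  by (simp add: measurable_range_function_def)

text \<open>Two representatives of a transform have fibres at distance zero almost everywhere, and
  closed fibres do not distinguish such vectors. Membership may thus be tested on any convenient
  representative.\<close>

lemma space_of_iff:
  assumes J: "\<And>\<alpha>. \<alpha> \<in> space m \<Longrightarrow> closed_subspace N (J \<alpha>)" and f: "f \<in> L2 M" and F: "is_zak f F"
  shows "f \<in> space_of J \<longleftrightarrow> (AE \<alpha> in m. F \<alpha> \<in> J \<alpha>)"
proof -
  have "AE \<alpha> in m. Z f \<alpha> \<in> J \<alpha> \<longleftrightarrow> F \<alpha> \<in> J \<alpha>"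
    using is_zak_AE_unique[OF f F is_zak_Z[OF f]] AE_space
  proof eventually_elim
    case (elim \<alpha>)
    note L = vec.L2_vec_fiber[OF is_zakD(1)[OF F] elim(2)] vec.L2_vec_fiber[OF is_zakD(1)[OF is_zak_Z[OF f]] elim(2)]
    show ?case
      using closed_subspace_norm_zero[OF J[OF elim(2)] _ L(1), of "Z f \<alpha>"]
        closed_subspace_norm_zero[OF J[OF elim(2)] _ L(2), of "F \<alpha>"] elim(1)
        l2_norm_diff_commute[of N "F \<alpha>" "Z f \<alpha>"] by auto
  qed
  then have "(AE \<alpha> in m. Z f \<alpha> \<in> J \<alpha>) \<longleftrightarrow> (AE \<alpha> in m. F \<alpha> \<in> J \<alpha>)"
    by (rule eventually_subst)
  then show ?thesis using f by (simp add: range_space_def)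
qed

section \<open>From range functions to invariant spaces\<close>

text \<open>Translation multiplies each fibre by a scalar, which a subspace absorbs. Closedness is
  inherited from the fibres because convergence in norm is fibrewise along a subsequence.\<close>

lemma invariant_space_of:
  assumes J: "\<And>\<alpha>. \<alpha> \<in> space m \<Longrightarrow> closed_subspace N (J \<alpha>)"
  shows "invariant_space M \<sigma> Jac (space_of J)"
proof -
  have sub: "space_of J \<subseteq> L2 M" by (auto simp: range_space_def)
  have memD: "AE \<alpha> in m. Z f \<alpha> \<in> J \<alpha>" if "f \<in> space_of J" for f
    using that by (simp add: range_space_def)
  note memI = space_of_iff[where J=J, OF J, THEN iffD2]
  have "cfun.subspace (space_of J)"
    unfolding cfun.subspace_def
  proof (intro conjI ballI allI)
    show "0 \<in> space_of J"
    proof (rule memI[OF _ L2_zero is_zak_zero])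
      show "AE \<alpha> in m. 0 \<alpha> \<in> J \<alpha>"
        by (rule AE_I2) (use cfun.subspace_0[OF closed_subspaceD(2)[OF J]] in simp)
    qed
    fix f assume f: "f \<in> space_of J"
    then have fL: "f \<in> L2 M" using sub by blast
    show "(\<lambda>x. c * f x) \<in> space_of J" for c
    proof (rule memI[OF _ L2_cmult[OF fL] is_zak_scale[OF is_zak_Z[OF fL]]])
      show "AE \<alpha> in m. (\<lambda>x. c * Z f \<alpha> x) \<in> J \<alpha>"
        using memD[OF f] AE_space by eventually_elim (rule closed_subspace_scale[OF J])
    qed
    fix g assume g: "g \<in> space_of J"
    then have gL: "g \<in> L2 M" using sub by blast
    show "f + g \<in> space_of J"
    proof (rule memI[OF _ L2_add[OF fL gL] is_zak_add[OF is_zak_Z[OF fL] is_zak_Z[OF gL]]])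
      show "AE \<alpha> in m. (Z f + Z g) \<alpha> \<in> J \<alpha>"
        using memD[OF f] memD[OF g] AE_space
        by eventually_elim (simp only: plus_fun_apply, rule closed_subspace_add[OF J])
    qed
  qed
  moreover have "l2_closure M (space_of J) = space_of J"
  proof
    show "space_of J \<subseteq> l2_closure M (space_of J)" by (rule subset_l2_closure[OF sub])
    show "l2_closure M (space_of J) \<subseteq> space_of J"
    proof
      fix f assume fc: "f \<in> l2_closure M (space_of J)"
      then have fL: "f \<in> L2 M" by (simp add: l2_closure_def)
      have "\<exists>g\<in>space_of J. l2_norm M (f - g) < inverse (real (Suc n))" for n
        by (rule l2_closureD[OF fc]) simp
      then obtain g where g: "\<And>n. g n \<in> space_of J" "\<And>n. l2_norm M (f - g n) < inverse (real (Suc n))"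
        by metis
      have gL: "g n \<in> L2 M" for n using g(1) sub by blast
      have eq: "l2_norm (m \<Otimes>\<^sub>M N) (case_prod (Z (g n)) - case_prod (Z f)) = l2_norm M (f - g n)" for n
        unfolding case_prod_diff l2_norm_diff_commute[of M f]
        by (rule is_zak_norm[OF L2_diff[OF gL fL] is_zak_diff[OF is_zak_Z[OF gL] is_zak_Z[OF fL]]])
      have lim: "(\<lambda>n. l2_norm (m \<Otimes>\<^sub>M N) (case_prod (Z (g n)) - case_prod (Z f))) \<longlonglongrightarrow> 0"
        unfolding eq
        by (rule Lim_null_comparison[OF always_eventually LIMSEQ_inverse_real_of_nat])
          (use g(2) in \<open>auto intro: less_imp_le\<close>)
      have "AE \<alpha> in m. Z f \<alpha> \<in> J \<alpha>"
        by (rule vec.L2_vec_closed_in_range[OF J is_zakD(1)[OF is_zak_Z[OF gL]] is_zakD(1)[OF is_zak_Z[OF fL]] lim memD[OF g(1)]])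
      then show "f \<in> space_of J" using fL by (simp add: range_space_def)
    qed
  qed
  moreover have "R a f \<in> space_of J" if f: "f \<in> space_of J" for a f
  proof -
    have fL: "f \<in> L2 M" using f sub by blast
    show ?thesis
    proof (rule memI[OF _ rep_L2[OF fL] is_zak_rep[OF is_zak_Z[OF fL]]])
      show "AE \<alpha> in m. (\<lambda>x. \<alpha> a * Z f \<alpha> x) \<in> J \<alpha>"
        using memD[OF f] AE_space by eventually_elim (rule closed_subspace_scale[OF J])
    qed
  qed
  ultimately show ?thesis using sub by (simp add: invariant_space_def closed_subspace_def)
qed

section \<open>From generators to range functions\<close>

definition fiber_span :: "('x \<Rightarrow> complex) set \<Rightarrow> ('g \<Rightarrow> complex) \<Rightarrow> ('x \<Rightarrow> complex) set" where
  "fiber_span A \<alpha> = closed_span N ((\<lambda>\<phi>. Z \<phi> \<alpha>) ` A)"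

lemma range_fun_fiber_span:
  assumes "countable A" "A \<subseteq> L2 M" shows "range_fun (fiber_span A)"
proof -
  have "range_fun (\<lambda>\<alpha>. closed_span N ((\<lambda>\<phi>. Z \<phi> \<alpha>) ` A))"
    by (rule vec.measurable_range_function_closed_span[OF sep_N assms(1)])
      (use assms(2) vec.L2_vecD(1,2)[OF is_zakD(1)[OF is_zak_Z]] in blast)+
  then show ?thesis by (simp add: fiber_span_def[abs_def])
qed

lemma generated_space_eq:
  assumes A: "countable A" "A \<subseteq> L2 M"
  shows "generated_space M \<sigma> Jac A = space_of (fiber_span A)"
proof
  define G where "G = {R a \<phi> | \<phi> a. \<phi> \<in> A}"
  have GL: "G \<subseteq> L2 M" using A(2) rep_L2 by (auto simp: G_def)
  have gen: "generated_space M \<sigma> Jac A = closed_span M G" by (simp add: generated_space_def G_def)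
  note J = range_fun_closed[OF range_fun_fiber_span[OF A]]
  have inv: "invariant_space M \<sigma> Jac (space_of (fiber_span A))" by (rule invariant_space_of[OF J])
  then have closed: "closed_subspace M (space_of (fiber_span A))" by (simp add: invariant_space_def)
  have span: "\<phi> \<in> space_of (fiber_span A)" if \<phi>: "\<phi> \<in> A" for \<phi>
  proof -
    have "AE \<alpha> in m. Z \<phi> \<alpha> \<in> fiber_span A \<alpha>"
    proof (rule AE_I2)
      fix \<alpha> assume \<alpha>: "\<alpha> \<in> space m"
      have "(\<lambda>\<phi>. Z \<phi> \<alpha>) ` A \<subseteq> L2 N" using A(2) vec.L2_vec_fiber[OF is_zakD(1)[OF is_zak_Z] \<alpha>] by blast
      from closed_span_superset[OF this] show "Z \<phi> \<alpha> \<in> fiber_span A \<alpha>" using \<phi> by (auto simp: fiber_span_def)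
    qed
    then show ?thesis using \<phi> A(2) by (auto simp: range_space_def)
  qed
  have "G \<subseteq> space_of (fiber_span A)"
    using span inv by (auto simp: G_def invariant_space_def)
  then show "generated_space M \<sigma> Jac A \<subseteq> space_of (fiber_span A)"
    unfolding gen by (rule closed_span_minimal[OF closed])
  note W = closed_subspace_closed_span[OF GL]
  show "space_of (fiber_span A) \<subseteq> generated_space M \<sigma> Jac A"
  proof
    fix f assume f: "f \<in> space_of (fiber_span A)"
    then have fL: "f \<in> L2 M" using closed closed_subspace_L2 by blast
    obtain g where g: "g \<in> closed_span M G" "\<And>v. v \<in> closed_span M G \<Longrightarrow> l2_inner M (f - g) v = 0"
      using projection_exists[OF W fL] by blast
    have gL: "g \<in> L2 M" by (rule closed_subspace_L2[OF W g(1)])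
    have hL: "f - g \<in> L2 M" by (rule L2_diff[OF fL gL])
    have "g \<in> space_of (fiber_span A)"
      using g(1) closed_span_minimal[OF closed \<open>G \<subseteq> space_of (fiber_span A)\<close>] by blast
    then have "f - g \<in> space_of (fiber_span A)" by (rule closed_subspace_diff[OF closed f])
    then have hJ: "AE \<alpha> in m. Z (f - g) \<alpha> \<in> fiber_span A \<alpha>" by (simp add: range_space_def)
    have "AE \<alpha> in m. l2_inner N (Z (f - g) \<alpha>) (Z \<phi> \<alpha>) = 0" if \<phi>: "\<phi> \<in> A" for \<phi>
    proof -
      have \<phi>L: "\<phi> \<in> L2 M" using \<phi> A(2) by blast
      show ?thesis
      proof (rule fiberwise_orthogonal[OF is_zakD(1)[OF is_zak_Z[OF hL]] is_zakD(1)[OF is_zak_Z[OF \<phi>L]]])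
        fix a
        have "R a \<phi> \<in> closed_span M G" using closed_span_superset[OF GL] \<phi> by (auto simp: G_def)
        then have "l2_inner M (f - g) (R a \<phi>) = 0" by (rule g(2))
        then show "l2_inner (m \<Otimes>\<^sub>M N) (case_prod (Z (f - g))) (case_prod (\<lambda>\<alpha> x. \<alpha> a * Z \<phi> \<alpha> x)) = 0"
          using is_zak_inner[OF hL is_zak_Z[OF hL] rep_L2[OF \<phi>L] is_zak_rep[OF is_zak_Z[OF \<phi>L]]] by simp
      qed
    qed
    then have "AE \<alpha> in m. \<forall>\<phi>\<in>A. l2_inner N (Z (f - g) \<alpha>) (Z \<phi> \<alpha>) = 0"
      by (simp add: AE_ball_countable[OF A(1)])
    with hJ AE_space have "AE \<alpha> in m. l2_norm N (Z (f - g) \<alpha>) = 0"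
    proof eventually_elim
      case (elim \<alpha>)
      have L: "Z \<phi> \<alpha> \<in> L2 N" if "\<phi> \<in> L2 M" for \<phi>
        by (rule vec.L2_vec_fiber[OF is_zakD(1)[OF is_zak_Z[OF that]] elim(2)])
      have "l2_inner N (Z (f - g) \<alpha>) (Z (f - g) \<alpha>) = 0"
        by (rule orthogonal_closed_span[OF L[OF hL] _ _ elim(1)[unfolded fiber_span_def]])
          (use A(2) L elim(3) in auto)
      then show ?case by (simp add: l2_inner_self)
    qed
    then have "(\<integral>\<alpha>. (l2_norm N (Z (f - g) \<alpha>))\<^sup>2 \<partial>m) = (\<integral>\<alpha>. 0 \<partial>m)"
      by (intro integral_cong_AE)
        (use vec.measurable_l2_norm_fiber[OF vec.L2_vec_measurable[OF is_zakD(1)[OF is_zak_Z[OF hL]]]] in auto)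
    then have "l2_norm M (f - g) = 0"
      using vec.L2_vec_norm[OF is_zakD(1)[OF is_zak_Z[OF hL]]] is_zak_norm[OF hL is_zak_Z[OF hL]] by simp
    then have "f \<in> closed_span M G"
      by (intro closed_subspace_norm_zero[OF W g(1) fL]) (simp add: l2_norm_diff_commute)
    then show "f \<in> generated_space M \<sigma> Jac A" by (simp only: gen)
  qed
qed

lemma invariant_space_generated:
  assumes "invariant_space M \<sigma> Jac V"
  obtains A where "countable A" "A \<subseteq> L2 M" "V = generated_space M \<sigma> Jac A"
proof -
  have V: "closed_subspace M V" and inv: "\<And>a f. f \<in> V \<Longrightarrow> R a f \<in> V"
    using assms by (auto simp: invariant_space_def)
  obtain A where A: "countable A" "A \<subseteq> V"
    "\<And>f \<epsilon>. f \<in> V \<Longrightarrow> \<epsilon> > 0 \<Longrightarrow> \<exists>a\<in>A. l2_norm M (f - a) < \<epsilon>"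
    using l2_separable_subset[OF sep closed_subspaceD(1)[OF V]] by blast
  have AL: "A \<subseteq> L2 M" using A(2) closed_subspaceD(1)[OF V] by blast
  define G where "G = {R a \<phi> | \<phi> a. \<phi> \<in> A}"
  have GV: "G \<subseteq> V" using A(2) inv by (auto simp: G_def)
  then have GL: "G \<subseteq> L2 M" using closed_subspaceD(1)[OF V] by blast
  have W: "closed_subspace M (closed_span M G)" by (rule closed_subspace_closed_span[OF GL])
  have "A \<subseteq> closed_span M G"
  proof
    fix f assume f: "f \<in> A"
    then have fL: "f \<in> L2 M" using AL by blast
    \<comment> \<open>The identity acts as \<open>R 0\<close>, which equals the identity map only
      almost everywhere, as \<open>Jac 0\<close> is 1 only almost everywhere; closedness bridges the
      gap.\<close>
    have "R 0 f \<in> closed_span M G" using closed_span_superset[OF GL] f by (auto simp: G_def)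
    then show "f \<in> closed_span M G"
      by (rule closed_subspace_AE[OF W _ L2_measurable[OF fL] rep_zero])
  qed
  then have "l2_closure M A \<subseteq> closed_span M G"
    using l2_closure_mono[of A "closed_span M G" M] by (simp only: closed_subspaceD(3)[OF W])
  moreover have "V \<subseteq> l2_closure M A"
    using A(3) closed_subspaceD(1)[OF V] by (auto simp: l2_closure_def)
  ultimately have "V = closed_span M G" using closed_span_minimal[OF V GV] by blast
  then have "V = generated_space M \<sigma> Jac A" by (simp add: generated_space_def G_def)
  with A(1) AL show thesis by (rule that)
qed

section \<open>Uniqueness of the range function and the bijection\<close>

text \<open>By surjectivity of the Zak transform, each field \<open>\<alpha> \<mapsto> P\<^sub>J(\<alpha>) a\<close> is the transform of an
  element of the space of \<open>J\<close>; letting \<open>a\<close> run through a countable dense set recovers \<open>J\<close>.\<close>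
lemma range_fun_mono:
  assumes J: "range_fun J" and J': "range_fun J'" and sub: "space_of J \<subseteq> space_of J'"
  shows "AE \<alpha> in m. J \<alpha> \<subseteq> J' \<alpha>"
proof -
  note cJ = range_fun_closed[OF J] and cJ' = range_fun_closed[OF J']
  obtain D where D: "countable D" "D \<subseteq> L2 N"
    "\<And>f \<epsilon>. f \<in> L2 N \<Longrightarrow> \<epsilon> > 0 \<Longrightarrow> \<exists>d\<in>D. l2_norm N (f - d) < \<epsilon>"
    using l2_separableE[OF sep_N] by metis
  have "AE \<alpha> in m. l2_proj N (J \<alpha>) d \<in> J' \<alpha>" if d: "d \<in> D" for d
  proof -
    have dL: "d \<in> L2 N" using d D(2) by blast
    have meas: "(\<lambda>\<alpha>. l2_proj N (J \<alpha>) d) \<in> m \<rightarrow>\<^sub>M l2_borel N"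
      using J dL by (simp add: measurable_range_function_def)
    have bd: "l2_norm N (l2_proj N (J \<alpha>) d) \<le> l2_norm N d" if \<alpha>: "\<alpha> \<in> space m" for \<alpha>
    proof (rule power2_le_imp_le)
      show "(l2_norm N (l2_proj N (J \<alpha>) d))\<^sup>2 \<le> (l2_norm N d)\<^sup>2"
        using l2_proj_pythagoras[OF cJ[OF \<alpha>] dL cfun.subspace_0[OF closed_subspaceD(2)[OF cJ[OF \<alpha>]]]] by simp
    qed simp
    \<comment> \<open>The projections form a measurable map into the function space, bounded by the
      norm of \<open>d\<close>. Before the transform can be inverted, this map must be replaced by a
      jointly measurable field.\<close>
    obtain F where F: "F \<in> L2_vec m N" "AE \<alpha> in m. l2_norm N (F \<alpha> - l2_proj N (J \<alpha>) d) = 0"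
      using vec.measurable_field_representative[OF dual.finite_measure_m sep_N meas bd] by blast
    obtain \<psi> where \<psi>: "\<psi> \<in> L2 M" "AE \<alpha> in m. l2_norm N (Z \<psi> \<alpha> - F \<alpha>) = 0"
      using zak_surjective[OF F(1)] by blast
    have Zp: "AE \<alpha> in m. Z \<psi> \<alpha> \<in> L2 N \<and> l2_norm N (Z \<psi> \<alpha> - l2_proj N (J \<alpha>) d) = 0"
      using F(2) \<psi>(2) AE_space
    proof eventually_elim
      case (elim \<alpha>)
      have ZL: "Z \<psi> \<alpha> \<in> L2 N" by (rule vec.L2_vec_fiber[OF is_zakD(1)[OF is_zak_Z[OF \<psi>(1)]] elim(3)])
      have "l2_norm N (Z \<psi> \<alpha> - l2_proj N (J \<alpha>) d)
          \<le> l2_norm N (Z \<psi> \<alpha> - F \<alpha>) + l2_norm N (F \<alpha> - l2_proj N (J \<alpha>) d)"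
        by (rule l2_norm_triangle_diff[OF ZL vec.L2_vec_fiber[OF F(1) elim(3)] l2_proj_L2[OF cJ[OF elim(3)] dL]])
      then show ?case
        using elim(1,2) ZL l2_norm_nonneg[of N "Z \<psi> \<alpha> - l2_proj N (J \<alpha>) d"] by linarith
    qed
    have "AE \<alpha> in m. Z \<psi> \<alpha> \<in> J \<alpha>"
      using Zp AE_space
    proof eventually_elim
      case (elim \<alpha>)
      show ?case
        by (rule closed_subspace_norm_zero[OF cJ[OF elim(2)] l2_proj_in[OF cJ[OF elim(2)] dL]])
          (use elim(1) l2_norm_diff_commute[of N "Z \<psi> \<alpha>" "l2_proj N (J \<alpha>) d"] in auto)
    qed
    then have "\<psi> \<in> space_of J" using \<psi>(1) by (simp add: range_space_def)
    then have "\<psi> \<in> space_of J'" using sub by blast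
    then have "AE \<alpha> in m. Z \<psi> \<alpha> \<in> J' \<alpha>" by (simp add: range_space_def)
    with Zp AE_space show ?thesis
    proof eventually_elim
      case (elim \<alpha>)
      show ?case
        by (rule closed_subspace_norm_zero[OF cJ'[OF elim(2)] elim(3) l2_proj_L2[OF cJ[OF elim(2)] dL]])
          (use elim(1) in auto)
    qed
  qed
  then have "AE \<alpha> in m. \<forall>d\<in>D. l2_proj N (J \<alpha>) d \<in> J' \<alpha>" by (simp add: AE_ball_countable[OF D(1)])
  with AE_space show ?thesis
  proof eventually_elim
    case (elim \<alpha>)
    show ?case
      by (rule closed_subspace_subset_via_proj[OF cJ[OF elim(1)] cJ'[OF elim(1)] D(2,3)])
        (use elim(2) in auto)
  qed
qed

lemma range_fun_unique:
  assumes "range_fun J" "range_fun J'"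
  shows "space_of J = space_of J' \<longleftrightarrow> (AE \<alpha> in m. J \<alpha> = J' \<alpha>)"
proof
  assume "space_of J = space_of J'"
  then have "AE \<alpha> in m. J \<alpha> \<subseteq> J' \<alpha>" "AE \<alpha> in m. J' \<alpha> \<subseteq> J \<alpha>"
    using range_fun_mono assms by auto
  then show "AE \<alpha> in m. J \<alpha> = J' \<alpha>" by eventually_elim blast
next
  assume eq: "AE \<alpha> in m. J \<alpha> = J' \<alpha>"
  have "(AE \<alpha> in m. Z f \<alpha> \<in> J \<alpha>) \<longleftrightarrow> (AE \<alpha> in m. Z f \<alpha> \<in> J' \<alpha>)" for f
  proof (rule eventually_subst)
    show "AE \<alpha> in m. Z f \<alpha> \<in> J \<alpha> \<longleftrightarrow> Z f \<alpha> \<in> J' \<alpha>" using eq by eventually_elim simp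
  qed
  then show "space_of J = space_of J'" by (simp add: range_space_def)
qed

lemma invariant_iff:
  "invariant_space M \<sigma> Jac V \<longleftrightarrow> (\<exists>J. range_fun J \<and> V = space_of J)"
proof
  assume "invariant_space M \<sigma> Jac V"
  then obtain A where "countable A" "A \<subseteq> L2 M" "V = generated_space M \<sigma> Jac A"
    by (rule invariant_space_generated)
  then show "\<exists>J. range_fun J \<and> V = space_of J"
    using range_fun_fiber_span generated_space_eq by blast
next
  assume "\<exists>J. range_fun J \<and> V = space_of J"
  then obtain J where J: "range_fun J" "V = space_of J" by blast
  show "invariant_space M \<sigma> Jac V" unfolding J(2) by (rule invariant_space_of[OF range_fun_closed[OF J(1)]])
qed

text \<open>By uniqueness, the classes of range functions equal almost everywhere are exactly the
  fibres of the map \<open>space_of\<close>, so the quotient is the set of these fibres.\<close>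

lemma range_function_class:
  assumes J: "range_fun J"
  shows "range_function_ae_eq m N `` {J} = {J'. range_fun J' \<and> space_of J = space_of J'}"
  using range_fun_unique[OF J] J by (auto simp: range_function_ae_eq_def)

text \<open>Each invariant space is sent to its fibre under \<open>space_of\<close>. Fibres of
  invariant spaces are nonempty by \<open>invariant_iff\<close>, and a member determines its space,
  whence injectivity.\<close>

lemma bij_invariant_spaces:
  "bij_betw (\<lambda>V. {J. range_fun J \<and> V = space_of J}) {V. invariant_space M \<sigma> Jac V}
     ({J. range_fun J} // range_function_ae_eq m N)"
  unfolding bij_betw_def
proof
  show "inj_on (\<lambda>V. {J. range_fun J \<and> V = space_of J}) {V. invariant_space M \<sigma> Jac V}"
    by (rule inj_onI) (use invariant_iff in blast)
  show "(\<lambda>V. {J. range_fun J \<and> V = space_of J}) ` {V. invariant_space M \<sigma> Jac V}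
      = {J. range_fun J} // range_function_ae_eq m N" (is "?L = ?Q")
  proof (intro equalityI subsetI)
    fix K assume "K \<in> ?L"
    then obtain V where V: "invariant_space M \<sigma> Jac V" "K = {J. range_fun J \<and> V = space_of J}" by blast
    then obtain J where "range_fun J" "V = space_of J" using invariant_iff by blast
    then have "K = range_function_ae_eq m N `` {J}" using V(2) range_function_class by simp
    then show "K \<in> ?Q" using \<open>range_fun J\<close> by (simp add: quotientI)
  next
    fix K assume "K \<in> ?Q"
    then obtain J where J: "range_fun J" "K = range_function_ae_eq m N `` {J}" by (auto elim: quotientE)
    then have "K = {J'. range_fun J' \<and> space_of J = space_of J'}" using range_function_class by simp
    moreover have "invariant_space M \<sigma> Jac (space_of J)" using J(1) invariant_iff by blast
    ultimately show "K \<in> ?L" by blast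
  qed
qed

end

theorem theorem4p3:
  fixes M :: "'x measure"
    and \<sigma> :: "'g::{ab_group_add,countable} \<Rightarrow> 'x \<Rightarrow> 'x"
    and Jac :: "'g \<Rightarrow> 'x \<Rightarrow> real"
    and C :: "'x set"
    and m :: "('g \<Rightarrow> complex) measure"
  assumes "sigma_finite_measure M"
    and "l2_separable M"
    and "measurable_action M \<sigma>"
    and "is_jacobian M \<sigma> Jac"
    and "tiling_set M \<sigma> C"
    and "normalized_haar m"
  shows "(\<forall>V. closed_subspace M V \<longrightarrow>
           (invariant_space M \<sigma> Jac V \<longleftrightarrow>
            (\<exists>J. measurable_range_function m (restrict_space M C) J \<and>
                 V = range_space M \<sigma> Jac C m J))) \<and>
         bij_betw
           (\<lambda>V. {J. measurable_range_function m (restrict_space M C) J \<and>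
                    V = range_space M \<sigma> Jac C m J})
           {V. invariant_space M \<sigma> Jac V}
           ({J. measurable_range_function m (restrict_space M C) J} //
              range_function_ae_eq m (restrict_space M C)) \<and>
         (\<forall>A V. countable A \<and> A \<subseteq> L2 M \<and> V = generated_space M \<sigma> Jac A \<longrightarrow>
           (\<exists>J. measurable_range_function m (restrict_space M C) J \<and>
                V = range_space M \<sigma> Jac C m J) \<and>
           (\<forall>J. measurable_range_function m (restrict_space M C) J \<and>
                V = range_space M \<sigma> Jac C m J \<longrightarrow>
                (AE \<alpha> in m. J \<alpha> =
                   closed_span (restrict_space M C) {zak M \<sigma> Jac C m \<phi> \<alpha> | \<phi>. \<phi> \<in> A})))"
proof -
  interpret zak_setting M \<sigma> Jac C m
    by (intro zak_setting.intro tiling_action.intro tiling_action_axioms.intro zak_setting_axioms.intro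
        haar.intro assms)
  \<comment> \<open>The fibrewise span is one range function for the generated space; uniqueness
    extends the formula to every range function that represents it.\<close>
  have unique: "AE \<alpha> in m. J \<alpha> = closed_span N {Z \<phi> \<alpha> | \<phi>. \<phi> \<in> A}"
    if "countable A" "A \<subseteq> L2 M" "range_fun J" "generated_space M \<sigma> Jac A = space_of J" for A J
  proof -
    have "AE \<alpha> in m. J \<alpha> = fiber_span A \<alpha>"
      using range_fun_unique[OF that(3) range_fun_fiber_span[OF that(1,2)]] generated_space_eq[OF that(1,2)] that(4)
      by simp
    moreover have "fiber_span A \<alpha> = closed_span N {Z \<phi> \<alpha> | \<phi>. \<phi> \<in> A}" for \<alpha>
      unfolding fiber_span_def by (intro arg_cong[where f="closed_span N"]) blast
    ultimately show ?thesis by simp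
  qed
  have ex: "\<exists>J. range_fun J \<and> generated_space M \<sigma> Jac A = space_of J" if "countable A" "A \<subseteq> L2 M" for A
    using range_fun_fiber_span[OF that] generated_space_eq[OF that] by blast
  show ?thesis
  proof (intro conjI allI impI; (elim conjE)?)
    show "invariant_space M \<sigma> Jac V \<longleftrightarrow> (\<exists>J. range_fun J \<and> V = space_of J)" for V
      by (rule invariant_iff)
    show "\<exists>J. range_fun J \<and> V = space_of J"
      if "countable A" "A \<subseteq> L2 M" "V = generated_space M \<sigma> Jac A" for A V
      unfolding that(3) by (rule ex[OF that(1,2)])
    show "AE \<alpha> in m. J \<alpha> = closed_span N {Z \<phi> \<alpha> | \<phi>. \<phi> \<in> A}"
      if "countable A" "A \<subseteq> L2 M" "V = generated_space M \<sigma> Jac A" "range_fun J" "V = space_of J" for A V J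
      by (rule unique[OF that(1,2,4)]) (use that(3,5) in simp)
  qed (rule bij_invariant_spaces)
qed

end
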